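(* In the setting of the context (linear system over horizon $N$ with affine purified-output-based control law with parameters $\chi$, ellitopic uncertainty set $\mathscr{D}[\rho]$ with $\rho>0$, and matrices $\mathbf{Z}[\chi],\mathbf{E}[\chi]$ affine in $\chi$), let $\mathcal{I}_1,\dots,\mathcal{I}_4$ be disjoint finite index sets and let the following data be given: $\mathcal{A}_i\in\mathbb{S}^{n_w}_+$, $\beta_i\in\mathbb{R}^{n_w}$, $\gamma_i\in\mathbb{R}$ for $i\in\mathcal{I}_1\cup\mathcal{I}_3$; $a_i\in\mathbb{R}^{n_w}$, $\gamma_i\in\mathbb{R}$ for $i\in\mathcal{I}_2$; $\mathcal{Q}_i\in\mathbb{R}^{m_i\times n_w}$ and positive definite $\Sigma_i\in\mathbb{S}^{m_i}$ for $i\in\mathcal{I}_4$. The problem of interest is to find $\chi$ such that $$\begin{array}{ll} \forall\zeta\in\mathscr{D}[\rho]:\ \mathbb{E}_\epsilon\left[\langle\mathcal{A}_i(\mathbf{w}-\beta_i),\mathbf{w}-\beta_i\rangle\right]\le\gamma_i,& i\in\mathcal{I}_1,\\ \forall\zeta\in\mathscr{D}[\rho]:\ \langle a_i,\mu_{\mathbf{w}}[\chi,\zeta]\rangle\le\gamma_i,& i\in\mathcal{I}_2,\\ \forall\zeta\in\mathscr{D}[\rho]:\ \langle\mathcal{A}_i(\mu_{\mathbf{w}}[\chi,\zeta]-\beta_i),\mu_{\mathbf{w}}[\chi,\zeta]-\beta_i\rangle\le\gamma_i,& i\in\mathcal{I}_3,\\ \mathcal{Q}_i\Sigma_{\mathbf{w}}[\chi]\mathcal{Q}_i^{\mathrm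 T}\preceq\Sigma_i,& i\in\mathcal{I}_4. \end{array}\qquad(\ast)$$ Put $R=\Pi^{1/2}$, $r_i=\beta_i^{\mathrm T}\mathcal{A}_i\beta_i$ for $i\in\mathcal{I}_1\cup\mathcal{I}_3$, and let the vector-valued $p_i[\chi]$ and real-valued $q_i[\chi]$, affine in $\chi$, be defined by the identities in $\zeta\in\mathbb{R}^{n_\zeta}$: $-2\beta_i^{\mathrm T}\mathcal{A}_i\mathbf{Z}[\chi][\zeta;1]=2p_i[\chi]^{\mathrm T}\zeta+q_i[\chi]$ for $i\in\mathcal{I}_1\cup\mathcal{I}_3$, and $a_i^{\mathrm T}\mathbf{Z}[\chi][\zeta;1]=2p_i[\chi]^{\mathrm T}\zeta+q_i[\chi]$ for $i\in\mathcal{I}_2$. Then the problem of interest is equivalent to the feasibility problem $(\mathcal{F})$ below, i.e. $\chi$ satisfies $(\ast)$ if and only if $\chi$ can be extended, by suitable additional variables ($X_i\in\mathbb{S}^{n_\zeta}$, $x_i\in\mathbb{R}^{n_\zeta}$, $\alpha_i,\delta_i\in\mathbb{R}$ for $i\in\mathcal{I}_1\cup\mathcal{I}_3$; $\lambda^i\in\mathbb{R}^K$, $\alpha_i\in\mathbb{R}$ for $i\in\mathcal{I}_2$), to a solution of $(\mathcal{F})$. Moreover every constraint of $(\mathcal{F})$ is convex in $\chi$ and the additional variables. The constraints of $(\mathcal{F})$ are: "Simple" constraints: $$\begin{bmatrix} X_i & x_i \\ x_i^{\mathrm T} & \alpha_i \end{bmatrix}\succeq\mathbf{Z}[\chi]^{\mathrm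 T}\mathcal{A}_i\mathbf{Z}[\chi],\quad i\in\mathcal{I}_1\cup\mathcal{I}_3,$$ $$\alpha_i+\delta_i+\|\mathcal{A}_i^{1/2}\mathbf{E}[\chi]R\|_{\mathrm{Fro}}^2+r_i\le\gamma_i,\ i\in\mathcal{I}_1;\qquad \alpha_i+\delta_i+r_i\le\gamma_i,\ i\in\mathcal{I}_3;$$ $$\lambda^i\ge0,\quad\begin{bmatrix} \alpha_i & -p_i[\chi]^{\mathrm T}P \\ -P^{\mathrm T}p_i[\chi] & \sum_k\lambda^i_kS_k \end{bmatrix}\succeq0,\quad\alpha_i+\rho\,\phi_{\mathcal{T}}(\lambda^i)+q_i[\chi]\le\gamma_i,\quad i\in\mathcal{I}_2;$$ $$\begin{bmatrix} \Sigma_i & \mathcal{Q}_i\mathbf{E}[\chi]R \\ R^{\mathrm T}\mathbf{E}[\chi]^{\mathrm T}\mathcal{Q}_i^{\mathrm T} & I_{n_\epsilon} \end{bmatrix}\succeq0,\quad i\in\mathcal{I}_4.$$ "Complex" (semi-infinite) constraints: $$\forall\zeta\in\mathscr{D}[\rho]:\ \zeta^{\mathrm T}X_i\zeta+2\zeta^{\mathrm T}(x_i+p_i[\chi])\le\delta_i-q_i[\chi],\quad i\in\mathcal{I}_1\cup\mathcal{I}_3.$$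
   Context: Notation: $\mathbb{S}^m$ is the space of real symmetric $m\times m$ matrices, $\mathbb{S}^m_+$ the positive semidefinite cone, $A\succeq B$ means $A-B\in\mathbb{S}^m_+$; $\|\cdot\|_{\mathrm{Fro}}$ is the Frobenius norm; $[u_1;\dots;u_k]$ denotes vertical stacking. System. For $0\le t\le N-1$, $\mathbf{x}_0=\mathbf{z}+\mathbf{s}_0$, $\mathbf{x}_{t+1}=A_t\mathbf{x}_t+B_t\mathbf{u}_t+B^{(d)}_t\mathbf{d}_t+B^{(s)}_t\mathbf{e}_t$, $\mathbf{y}_t=C_t\mathbf{x}_t+D^{(d)}_t\mathbf{d}_t+D^{(s)}_t\mathbf{e}_t$, with known matrices, states $\mathbf{x}_t\in\mathbb{R}^{n_x}$, controls $\mathbf{u}_t\in\mathbb{R}^{n_u}$, outputs $\mathbf{y}_t\in\mathbb{R}^{n_y}$. The deterministic disturbance is $\zeta=[\mathbf{z};\mathbf{d}_0;\dots;\mathbf{d}_{N-1}]\in\mathbb{R}^{n_\zeta}$; the stochastic disturbance $\epsilon=[\mathbf{s}_0;\mathbf{e}_0;\dots;\mathbf{e}_{N-1}]\in\mathbb{R}^{n_\epsilon}$ is a random vector with zero mean and known covariance matrix $\Pi$. Control law. The purified outputs are $\mathbf{v}_t=\mathbf{y}_t-\hat{\mathbf{y}}_t$, where $\hat{\mathbf{x}}_0=0$, $\hat{\mathbf{x}}_{t+1}=A_t\hat{\mathbf{x}}_t+B_t\mathbf{u}_t$, $\hat{\mathbf{y}}_t=C_t\hat{\mathbf{x}}_t$;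 they do not depend on the controls. An affine purified-output-based (POB) control law is $\mathbf{u}_t=h_t+\sum_{i=0}^tH^t_i\mathbf{v}_i$, $0\le t\le N-1$, with parameters $\chi=\{h_t\in\mathbb{R}^{n_u},H^t_j\in\mathbb{R}^{n_u\times n_y}\}_{0\le j\le t\le N-1}$. The state-control trajectory is $\mathbf{w}=[\mathbf{x}_1;\dots;\mathbf{x}_N;\mathbf{u}_0;\dots;\mathbf{u}_{N-1}]\in\mathbb{R}^{n_w}$, $n_w=(n_x+n_u)N$. Under the law with parameters $\chi$ it has the form $\mathbf{w}=\mathbf{Z}[\chi][\zeta;1]+\mathbf{E}[\chi]\epsilon$ for all $\zeta,\epsilon$, where the (uniquely determined) matrices $\mathbf{Z}[\chi]$, $\mathbf{E}[\chi]$ are affine functions of $\chi$. Set $\mu_{\mathbf{w}}[\chi,\zeta]=\mathbb{E}_\epsilon[\mathbf{w}]$, and let $\Sigma_{\mathbf{w}}[\chi]=\mathbf{E}[\chi]\Pi\mathbf{E}[\chi]^{\mathrm T}$ be the covariance matrix of $\mathbf{w}$ with respect to $\epsilon$ (independent of $\zeta$). Uncertainty set (ellitope). $\mathscr{D}[\rho]=\{\zeta\in\mathbb{R}^{n_\zeta}:\exists z\in\mathbb{R}^{\bar n},t\in\mathcal{T}:\zeta=Pz,\ z^{\mathrm T}S_kz\le\rho t_k,\ k\le K\}$, where $P\in\mathbb{R}^{n_\zeta\times\bar n}$, $S_k\in\mathbb{S}^{\bar n}_+$, $\sum_kS_k$ is positive definite, and $\mathcal{T}\subset\mathbb{R}^K_+$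 is a nonempty convex compact set intersecting the interior of $\mathbb{R}^K_+$ and monotone ($0\le t\le t'\in\mathcal{T}$ implies $t\in\mathcal{T}$). $\phi_{\mathcal{T}}(\lambda)=\max_{t\in\mathcal{T}}\lambda^{\mathrm T}t$. *)

theory Defs
  imports
    "HOL-Probability.Probability"
    "Jordan_Normal_Form.Matrix"
begin

text \<open>
  Vectors and matrices of the control system are those of \<^theory>\<open>Jordan_Normal_Form.Matrix\<close>, since
  the dimensions depend on the horizon and on the constraint index. Only the parameter \<open>t\<close> of an
  ellitope, which has a fixed number of coordinates but needs topology, lives in the
  type \<open>real ^ 'k\<close>. The notations of the latter that clash with the former are switched off.
\<close>

no_notation vec_nth (infixl \<open>$\<close> 90)
no_notation inner (infix \<open>\<bullet>\<close> 70)

section \<open>Matrices\<close>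

definition sym_mats :: "nat \<Rightarrow> real mat set" where
  "sym_mats m = {A \<in> carrier_mat m m. transpose_mat A = A}"

definition psd_mats :: "nat \<Rightarrow> real mat set" where
  "psd_mats m = {A \<in> sym_mats m. \<forall>v \<in> carrier_vec m. 0 \<le> v \<bullet> (A *\<^sub>v v)}"

definition pd_mats :: "nat \<Rightarrow> real mat set" where
  "pd_mats m = {A \<in> sym_mats m. \<forall>v \<in> carrier_vec m. v \<noteq> 0\<^sub>v m \<longrightarrow> 0 < v \<bullet> (A *\<^sub>v v)}"

definition loewner_ge :: "nat \<Rightarrow> real mat \<Rightarrow> real mat \<Rightarrow> bool" where
  "loewner_ge m A B \<longleftrightarrow> A \<in> sym_mats m \<and> B \<in> sym_mats m \<and> A - B \<in> psd_mats m"

definition psd_sqrt :: "nat \<Rightarrow> real mat \<Rightarrow> real mat" where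
  "psd_sqrt m A = (THE B. B \<in> psd_mats m \<and> B * B = A)"

definition fro_norm :: "real mat \<Rightarrow> real" where
  "fro_norm A = sqrt (\<Sum>i<dim_row A. \<Sum>j<dim_col A. (A $$ (i, j))\<^sup>2)"

definition sum_mat :: "nat \<Rightarrow> ('k::finite \<Rightarrow> real mat) \<Rightarrow> real mat" where
  "sum_mat m F = mat m m (\<lambda>ij. \<Sum>k\<in>UNIV. F k $$ ij)"

definition vstack :: "real vec list \<Rightarrow> real vec" where
  "vstack vs = foldr (@\<^sub>v) vs (0\<^sub>v 0)"

definition vslice :: "real vec \<Rightarrow> nat \<Rightarrow> nat \<Rightarrow> real vec" where
  "vslice v k m = vec m (\<lambda>i. v $ (k + i))"

definition append_one :: "real vec \<Rightarrow> real vec" where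
  "append_one v = v @\<^sub>v vec 1 (\<lambda>_. 1)"

text \<open>The matrix with rows \<open>[X, x]\<close> and \<open>[x\<^sup>T, \<alpha>]\<close>, and the one with rows \<open>[\<alpha>, x\<^sup>T]\<close> and \<open>[x, X]\<close>.\<close>

definition bordered :: "real mat \<Rightarrow> real vec \<Rightarrow> real \<Rightarrow> real mat" where
  "bordered X x \<alpha> = four_block_mat X (mat_of_cols (dim_vec x) [x])
     (mat_of_rows (dim_vec x) [x]) (mat 1 1 (\<lambda>_. \<alpha>))"

definition bordered_tl :: "real \<Rightarrow> real vec \<Rightarrow> real mat \<Rightarrow> real mat" where
  "bordered_tl \<alpha> x X = four_block_mat (mat 1 1 (\<lambda>_. \<alpha>)) (mat_of_rows (dim_vec x) [x])
     (mat_of_cols (dim_vec x) [x]) X"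

section \<open>Random vectors\<close>

definition mean_vec :: "'a measure \<Rightarrow> nat \<Rightarrow> ('a \<Rightarrow> real vec) \<Rightarrow> real vec" where
  "mean_vec M m X = vec m (\<lambda>i. integral\<^sup>L M (\<lambda>\<omega>. X \<omega> $ i))"

definition cov_mat :: "'a measure \<Rightarrow> nat \<Rightarrow> ('a \<Rightarrow> real vec) \<Rightarrow> real mat" where
  "cov_mat M m X = mat m m (\<lambda>(i, j). integral\<^sup>L M
     (\<lambda>\<omega>. (X \<omega> $ i - mean_vec M m X $ i) * (X \<omega> $ j - mean_vec M m X $ j)))"

text \<open>Square integrability is what makes the covariance matrix meaningful.\<close>

definition square_integrable_vec :: "'a measure \<Rightarrow> nat \<Rightarrow> ('a \<Rightarrow> real vec) \<Rightarrow> bool" where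
  "square_integrable_vec M m X \<longleftrightarrow>
     (\<forall>\<omega> \<in> space M. X \<omega> \<in> carrier_vec m) \<and>
     (\<forall>i<m. (\<lambda>\<omega>. X \<omega> $ i) \<in> borel_measurable M \<and> integrable M (\<lambda>\<omega>. (X \<omega> $ i)\<^sup>2))"

section \<open>Linear systems and purified-output-based control\<close>

record lin_sys =
  horizon :: nat
  dim_x :: nat
  dim_u :: nat
  dim_y :: nat
  dim_d :: "nat \<Rightarrow> nat"
  dim_e :: "nat \<Rightarrow> nat"
  mA :: "nat \<Rightarrow> real mat"
  mB :: "nat \<Rightarrow> real mat"
  mBd :: "nat \<Rightarrow> real mat"
  mBs :: "nat \<Rightarrow> real mat"
  mC :: "nat \<Rightarrow> real mat"
  mDd :: "nat \<Rightarrow> real mat"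
  mDs :: "nat \<Rightarrow> real mat"

definition is_lin_sys :: "lin_sys \<Rightarrow> bool" where
  "is_lin_sys s \<longleftrightarrow> (\<forall>t < horizon s.
     mA s t \<in> carrier_mat (dim_x s) (dim_x s) \<and>
     mB s t \<in> carrier_mat (dim_x s) (dim_u s) \<and>
     mBd s t \<in> carrier_mat (dim_x s) (dim_d s t) \<and>
     mBs s t \<in> carrier_mat (dim_x s) (dim_e s t) \<and>
     mC s t \<in> carrier_mat (dim_y s) (dim_x s) \<and>
     mDd s t \<in> carrier_mat (dim_y s) (dim_d s t) \<and>
     mDs s t \<in> carrier_mat (dim_y s) (dim_e s t))"

definition n_zeta :: "lin_sys \<Rightarrow> nat" where
  "n_zeta s = dim_x s + (\<Sum>t<horizon s. dim_d s t)"

definition n_eps :: "lin_sys \<Rightarrow> nat" where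
  "n_eps s = dim_x s + (\<Sum>t<horizon s. dim_e s t)"

definition n_w :: "lin_sys \<Rightarrow> nat" where
  "n_w s = (dim_x s + dim_u s) * horizon s"

text \<open>The components of \<open>\<zeta> = [z; d\<^sub>0; \<dots>]\<close> and \<open>\<epsilon> = [s\<^sub>0; e\<^sub>0; \<dots>]\<close>.\<close>

definition init_z :: "lin_sys \<Rightarrow> real vec \<Rightarrow> real vec" where
  "init_z s \<zeta> = vslice \<zeta> 0 (dim_x s)"

definition dist_d :: "lin_sys \<Rightarrow> real vec \<Rightarrow> nat \<Rightarrow> real vec" where
  "dist_d s \<zeta> t = vslice \<zeta> (dim_x s + (\<Sum>i<t. dim_d s i)) (dim_d s t)"

definition init_s :: "lin_sys \<Rightarrow> real vec \<Rightarrow> real vec" where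
  "init_s s \<epsilon> = vslice \<epsilon> 0 (dim_x s)"

definition dist_e :: "lin_sys \<Rightarrow> real vec \<Rightarrow> nat \<Rightarrow> real vec" where
  "dist_e s \<epsilon> t = vslice \<epsilon> (dim_x s + (\<Sum>i<t. dim_e s i)) (dim_e s t)"

primrec state :: "lin_sys \<Rightarrow> (nat \<Rightarrow> real vec) \<Rightarrow> real vec \<Rightarrow> real vec \<Rightarrow> nat \<Rightarrow> real vec" where
  "state s u \<zeta> \<epsilon> 0 = init_z s \<zeta> + init_s s \<epsilon>"
| "state s u \<zeta> \<epsilon> (Suc t) = mA s t *\<^sub>v state s u \<zeta> \<epsilon> t + mB s t *\<^sub>v u t
     + mBd s t *\<^sub>v dist_d s \<zeta> t + mBs s t *\<^sub>v dist_e s \<epsilon> t"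

definition output_y :: "lin_sys \<Rightarrow> (nat \<Rightarrow> real vec) \<Rightarrow> real vec \<Rightarrow> real vec \<Rightarrow> nat \<Rightarrow> real vec" where
  "output_y s u \<zeta> \<epsilon> t = mC s t *\<^sub>v state s u \<zeta> \<epsilon> t
     + mDd s t *\<^sub>v dist_d s \<zeta> t + mDs s t *\<^sub>v dist_e s \<epsilon> t"

primrec model_state :: "lin_sys \<Rightarrow> (nat \<Rightarrow> real vec) \<Rightarrow> nat \<Rightarrow> real vec" where
  "model_state s u 0 = 0\<^sub>v (dim_x s)"
| "model_state s u (Suc t) = mA s t *\<^sub>v model_state s u t + mB s t *\<^sub>v u t"

definition purified :: "lin_sys \<Rightarrow> (nat \<Rightarrow> real vec) \<Rightarrow> real vec \<Rightarrow> real vec \<Rightarrow> nat \<Rightarrow> real vec" where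
  "purified s u \<zeta> \<epsilon> t = output_y s u \<zeta> \<epsilon> t - mC s t *\<^sub>v model_state s u t"

text \<open>Parameters of a control law; \<open>pob_H chi t j\<close> is \<open>H\<^sup>t\<^sub>j\<close>.\<close>

record pob =
  pob_h :: "nat \<Rightarrow> real vec"
  pob_H :: "nat \<Rightarrow> nat \<Rightarrow> real mat"

definition pob_params :: "lin_sys \<Rightarrow> pob set" where
  "pob_params s = {chi. \<forall>t < horizon s. pob_h chi t \<in> carrier_vec (dim_u s) \<and>
     (\<forall>j\<le>t. pob_H chi t j \<in> carrier_mat (dim_u s) (dim_y s))}"

definition pob_law :: "lin_sys \<Rightarrow> pob \<Rightarrow> (nat \<Rightarrow> real vec) \<Rightarrow> nat \<Rightarrow> real vec" where
  "pob_law s chi v t = vec (dim_u s) (\<lambda>r. pob_h chi t $ r + (\<Sum>i\<le>t. (pob_H chi t i *\<^sub>v v i) $ r))"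

text \<open>
  The closed loop is built up causally: \<open>controls_upto s chi \<zeta> \<epsilon> t\<close> is the control sequence whose first
  \<open>t\<close> entries obey the law and whose remaining entries are zero. The purified outputs up to time \<open>t\<close>
  involve only controls at earlier times. The lemma \<open>controls_law\<close> below confirms that the resulting
  sequence obeys the law with respect to its own purified outputs.
\<close>

primrec controls_upto ::
    "lin_sys \<Rightarrow> pob \<Rightarrow> real vec \<Rightarrow> real vec \<Rightarrow> nat \<Rightarrow> (nat \<Rightarrow> real vec)" where
  "controls_upto s chi \<zeta> \<epsilon> 0 = (\<lambda>_. 0\<^sub>v (dim_u s))"
| "controls_upto s chi \<zeta> \<epsilon> (Suc t) = (let u = controls_upto s chi \<zeta> \<epsilon> t in
     u(t := pob_law s chi (purified s u \<zeta> \<epsilon>) t))"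

definition controls :: "lin_sys \<Rightarrow> pob \<Rightarrow> real vec \<Rightarrow> real vec \<Rightarrow> nat \<Rightarrow> real vec" where
  "controls s chi \<zeta> \<epsilon> = controls_upto s chi \<zeta> \<epsilon> (horizon s)"

lemma purified_cong:
  assumes "\<And>i. i < t \<Longrightarrow> u i = u' i"
  shows "purified s u \<zeta> \<epsilon> t = purified s u' \<zeta> \<epsilon> t"
proof -
  have "state s u \<zeta> \<epsilon> j = state s u' \<zeta> \<epsilon> j \<and> model_state s u j = model_state s u' j"
    if "j \<le> t" for j
    using that
  proof (induction j)
    case (Suc j)
    then show ?case by (simp add: assms[of j])
  qed simp
  then show ?thesis
    by (simp add: purified_def output_y_def)
qed

lemma controls_upto_stable:
  "i < t \<Longrightarrow> t \<le> t' \<Longrightarrow> controls_upto s chi \<zeta> \<epsilon> t' i = controls_upto s chi \<zeta> \<epsilon> t i"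
proof (induction t' rule: nat_induct)
  case (Suc t')
  then show ?case by (cases "t = Suc t'") (auto simp: Let_def)
qed simp

lemma controls_law:
  assumes "t < horizon s"
  shows "controls s chi \<zeta> \<epsilon> t = pob_law s chi (purified s (controls s chi \<zeta> \<epsilon>) \<zeta> \<epsilon>) t"
proof -
  let ?u = "controls_upto s chi \<zeta> \<epsilon> t"
  have *: "controls s chi \<zeta> \<epsilon> i = ?u i" if "i < t" for i
    unfolding controls_def by (rule controls_upto_stable[of i t "horizon s"]) (use that assms in auto)
  have "purified s (controls s chi \<zeta> \<epsilon>) \<zeta> \<epsilon> i = purified s ?u \<zeta> \<epsilon> i" if "i \<le> t" for i
    using that by (intro purified_cong *) auto
  then have "pob_law s chi (purified s (controls s chi \<zeta> \<epsilon>) \<zeta> \<epsilon>) t = pob_law s chi (purified s ?u \<zeta> \<epsilon>) t"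
    unfolding pob_law_def by (intro arg_cong[where f = "vec (dim_u s)"] ext) simp
  moreover have "controls s chi \<zeta> \<epsilon> t = controls_upto s chi \<zeta> \<epsilon> (Suc t) t"
    unfolding controls_def by (rule controls_upto_stable) (use assms in auto)
  ultimately show ?thesis by (simp add: Let_def)
qed

definition traj :: "lin_sys \<Rightarrow> pob \<Rightarrow> real vec \<Rightarrow> real vec \<Rightarrow> real vec" where
  "traj s chi \<zeta> \<epsilon> = (let u = controls s chi \<zeta> \<epsilon> in
     vstack (map (state s u \<zeta> \<epsilon>) [1..<Suc (horizon s)] @ map u [0..<horizon s]))"

text \<open>
  A representing pair is unique: setting \<open>\<epsilon> = 0\<close> and varying \<open>\<zeta>\<close> determines \<open>Z\<close>, after which varying
  \<open>\<epsilon>\<close> determines \<open>E\<close>. It exists because the purified outputs are linear in \<open>(\<zeta>, \<epsilon>)\<close> and do not depend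
  on the controls.
\<close>

definition represents_traj :: "lin_sys \<Rightarrow> pob \<Rightarrow> real mat \<Rightarrow> real mat \<Rightarrow> bool" where
  "represents_traj s chi Z E \<longleftrightarrow>
     Z \<in> carrier_mat (n_w s) (n_zeta s + 1) \<and> E \<in> carrier_mat (n_w s) (n_eps s) \<and>
     (\<forall>\<zeta> \<in> carrier_vec (n_zeta s). \<forall>\<epsilon> \<in> carrier_vec (n_eps s).
        traj s chi \<zeta> \<epsilon> = Z *\<^sub>v append_one \<zeta> + E *\<^sub>v \<epsilon>)"

definition matZ :: "lin_sys \<Rightarrow> pob \<Rightarrow> real mat" where
  "matZ s chi = (THE Z. \<exists>E. represents_traj s chi Z E)"

definition matE :: "lin_sys \<Rightarrow> pob \<Rightarrow> real mat" where
  "matE s chi = (THE E. \<exists>Z. represents_traj s chi Z E)"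

definition mu_w :: "lin_sys \<Rightarrow> 'a measure \<Rightarrow> ('a \<Rightarrow> real vec) \<Rightarrow> pob \<Rightarrow> real vec \<Rightarrow> real vec" where
  "mu_w s M eps chi \<zeta> = mean_vec M (n_w s) (\<lambda>\<omega>. traj s chi \<zeta> (eps \<omega>))"

definition Sigma_w :: "lin_sys \<Rightarrow> real mat \<Rightarrow> pob \<Rightarrow> real mat" where
  "Sigma_w s Cov chi = matE s chi * Cov * transpose_mat (matE s chi)"

section \<open>Ellitopes\<close>

record 'k ellitope =
  dim_z :: nat
  ell_P :: "real mat"
  ell_S :: "'k \<Rightarrow> real mat"
  ell_T :: "(real ^ 'k) set"

definition is_ellitope :: "nat \<Rightarrow> 'k::finite ellitope \<Rightarrow> bool" where
  "is_ellitope m D \<longleftrightarrow>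
     ell_P D \<in> carrier_mat m (dim_z D) \<and>
     (\<forall>k. ell_S D k \<in> psd_mats (dim_z D)) \<and>
     sum_mat (dim_z D) (ell_S D) \<in> pd_mats (dim_z D) \<and>
     ell_T D \<subseteq> {t. 0 \<le> t} \<and> ell_T D \<noteq> {} \<and> convex (ell_T D) \<and> compact (ell_T D) \<and>
     ell_T D \<inter> interior {t. 0 \<le> t} \<noteq> {} \<and>
     (\<forall>t t'. 0 \<le> t \<and> t \<le> t' \<and> t' \<in> ell_T D \<longrightarrow> t \<in> ell_T D)"

definition ell_set :: "'k::finite ellitope \<Rightarrow> real \<Rightarrow> real vec set" where
  "ell_set D \<rho> = {ell_P D *\<^sub>v z | z t. z \<in> carrier_vec (dim_z D) \<and> t \<in> ell_T D \<and>
     (\<forall>k. z \<bullet> (ell_S D k *\<^sub>v z) \<le> \<rho> * vec_nth t k)}"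

definition phi_T :: "(real ^ 'k::finite) set \<Rightarrow> real ^ 'k \<Rightarrow> real" where
  "phi_T T l = (SUP t\<in>T. inner l t)"

section \<open>Design specifications\<close>

record 'i spec =
  I1 :: "'i set"
  I2 :: "'i set"
  I3 :: "'i set"
  I4 :: "'i set"
  spA :: "'i \<Rightarrow> real mat"
  spbeta :: "'i \<Rightarrow> real vec"
  spgamma :: "'i \<Rightarrow> real"
  spa :: "'i \<Rightarrow> real vec"
  spm :: "'i \<Rightarrow> nat"
  spQ :: "'i \<Rightarrow> real mat"
  spSigma :: "'i \<Rightarrow> real mat"

definition is_spec :: "nat \<Rightarrow> 'i spec \<Rightarrow> bool" where
  "is_spec m sp \<longleftrightarrow>
     finite (I1 sp) \<and> finite (I2 sp) \<and> finite (I3 sp) \<and> finite (I4 sp) \<and>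
     I1 sp \<inter> I2 sp = {} \<and> I1 sp \<inter> I3 sp = {} \<and> I1 sp \<inter> I4 sp = {} \<and>
     I2 sp \<inter> I3 sp = {} \<and> I2 sp \<inter> I4 sp = {} \<and> I3 sp \<inter> I4 sp = {} \<and>
     (\<forall>i \<in> I1 sp \<union> I3 sp. spA sp i \<in> psd_mats m \<and> spbeta sp i \<in> carrier_vec m) \<and>
     (\<forall>i \<in> I2 sp. spa sp i \<in> carrier_vec m) \<and>
     (\<forall>i \<in> I4 sp. spQ sp i \<in> carrier_mat (spm sp i) m \<and> spSigma sp i \<in> pd_mats (spm sp i))"

definition meets_spec ::
    "lin_sys \<Rightarrow> 'a measure \<Rightarrow> ('a \<Rightarrow> real vec) \<Rightarrow> real mat \<Rightarrow> 'k::finite ellitope \<Rightarrow> real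
      \<Rightarrow> 'i spec \<Rightarrow> pob \<Rightarrow> bool" where
  "meets_spec s M eps Cov D \<rho> sp chi \<longleftrightarrow>
     (\<forall>i \<in> I1 sp. \<forall>\<zeta> \<in> ell_set D \<rho>.
        integral\<^sup>L M (\<lambda>\<omega>. (spA sp i *\<^sub>v (traj s chi \<zeta> (eps \<omega>) - spbeta sp i))
          \<bullet> (traj s chi \<zeta> (eps \<omega>) - spbeta sp i)) \<le> spgamma sp i) \<and>
     (\<forall>i \<in> I2 sp. \<forall>\<zeta> \<in> ell_set D \<rho>. spa sp i \<bullet> mu_w s M eps chi \<zeta> \<le> spgamma sp i) \<and>
     (\<forall>i \<in> I3 sp. \<forall>\<zeta> \<in> ell_set D \<rho>.
        (spA sp i *\<^sub>v (mu_w s M eps chi \<zeta> - spbeta sp i)) \<bullet> (mu_w s M eps chi \<zeta> - spbeta sp i)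
          \<le> spgamma sp i) \<and>
     (\<forall>i \<in> I4 sp. loewner_ge (spm sp i) (spSigma sp i)
        (spQ sp i * Sigma_w s Cov chi * transpose_mat (spQ sp i)))"

section \<open>The feasibility problem\<close>

definition r_const :: "'i spec \<Rightarrow> 'i \<Rightarrow> real" where
  "r_const sp i = spbeta sp i \<bullet> (spA sp i *\<^sub>v spbeta sp i)"

definition defines_pq :: "lin_sys \<Rightarrow> 'i spec \<Rightarrow> pob \<Rightarrow> 'i \<Rightarrow> real vec \<Rightarrow> real \<Rightarrow> bool" where
  "defines_pq s sp chi i p q \<longleftrightarrow> p \<in> carrier_vec (n_zeta s) \<and>
     (\<forall>\<zeta> \<in> carrier_vec (n_zeta s).
        (if i \<in> I2 sp then spa sp i \<bullet> (matZ s chi *\<^sub>v append_one \<zeta>)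
         else - 2 * (spbeta sp i \<bullet> (spA sp i *\<^sub>v (matZ s chi *\<^sub>v append_one \<zeta>))))
        = 2 * (p \<bullet> \<zeta>) + q)"

definition vec_p :: "lin_sys \<Rightarrow> 'i spec \<Rightarrow> pob \<Rightarrow> 'i \<Rightarrow> real vec" where
  "vec_p s sp chi i = (THE p. \<exists>q. defines_pq s sp chi i p q)"

definition real_q :: "lin_sys \<Rightarrow> 'i spec \<Rightarrow> pob \<Rightarrow> 'i \<Rightarrow> real" where
  "real_q s sp chi i = (THE q. \<exists>p. defines_pq s sp chi i p q)"

text \<open>
  The decision variables: \<open>chi\<close> together with the additional ones. Entries at indices \<open>i\<close> to which
  they do not belong are irrelevant.
\<close>

record ('i, 'k) fvars =
  vchi :: pob
  vX :: "'i \<Rightarrow> real mat"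
  vx :: "'i \<Rightarrow> real vec"
  valpha :: "'i \<Rightarrow> real"
  vdelta :: "'i \<Rightarrow> real"
  vlambda :: "'i \<Rightarrow> real ^ 'k"

definition fvars_dom :: "lin_sys \<Rightarrow> 'i spec \<Rightarrow> ('i, 'k::finite) fvars set" where
  "fvars_dom s sp = {V. vchi V \<in> pob_params s \<and>
     (\<forall>i \<in> I1 sp \<union> I3 sp. vX V i \<in> sym_mats (n_zeta s) \<and> vx V i \<in> carrier_vec (n_zeta s))}"

definition con_quad :: "lin_sys \<Rightarrow> 'i spec \<Rightarrow> 'i \<Rightarrow> ('i, 'k::finite) fvars \<Rightarrow> bool" where
  "con_quad s sp i V \<longleftrightarrow> loewner_ge (n_zeta s + 1) (bordered (vX V i) (vx V i) (valpha V i))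
     (transpose_mat (matZ s (vchi V)) * spA sp i * matZ s (vchi V))"

definition con_budget1 ::
    "lin_sys \<Rightarrow> real mat \<Rightarrow> 'i spec \<Rightarrow> 'i \<Rightarrow> ('i, 'k::finite) fvars \<Rightarrow> bool" where
  "con_budget1 s Cov sp i V \<longleftrightarrow> valpha V i + vdelta V i
     + (fro_norm (psd_sqrt (n_w s) (spA sp i) * matE s (vchi V) * psd_sqrt (n_eps s) Cov))\<^sup>2
     + r_const sp i \<le> spgamma sp i"

definition con_budget3 :: "'i spec \<Rightarrow> 'i \<Rightarrow> ('i, 'k::finite) fvars \<Rightarrow> bool" where
  "con_budget3 sp i V \<longleftrightarrow> valpha V i + vdelta V i + r_const sp i \<le> spgamma sp i"

definition con_lambda :: "'i \<Rightarrow> ('i, 'k::finite) fvars \<Rightarrow> bool" where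
  "con_lambda i V \<longleftrightarrow> 0 \<le> vlambda V i"

definition con_lin :: "lin_sys \<Rightarrow> 'k::finite ellitope \<Rightarrow> 'i spec \<Rightarrow> 'i \<Rightarrow> ('i, 'k) fvars \<Rightarrow> bool" where
  "con_lin s D sp i V \<longleftrightarrow> bordered_tl (valpha V i)
       (- (transpose_mat (ell_P D) *\<^sub>v vec_p s sp (vchi V) i))
       (sum_mat (dim_z D) (\<lambda>k. vec_nth (vlambda V i) k \<cdot>\<^sub>m ell_S D k)) \<in> psd_mats (1 + dim_z D)"

definition con_budget2 ::
    "lin_sys \<Rightarrow> 'k::finite ellitope \<Rightarrow> real \<Rightarrow> 'i spec \<Rightarrow> 'i \<Rightarrow> ('i, 'k) fvars \<Rightarrow> bool" where
  "con_budget2 s D \<rho> sp i V \<longleftrightarrow> valpha V i + \<rho> * phi_T (ell_T D) (vlambda V i)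
     + real_q s sp (vchi V) i \<le> spgamma sp i"

definition con_cov :: "lin_sys \<Rightarrow> real mat \<Rightarrow> 'i spec \<Rightarrow> 'i \<Rightarrow> ('i, 'k::finite) fvars \<Rightarrow> bool" where
  "con_cov s Cov sp i V \<longleftrightarrow> (let R = psd_sqrt (n_eps s) Cov; E = matE s (vchi V) in
     four_block_mat (spSigma sp i) (spQ sp i * E * R)
       (transpose_mat R * transpose_mat E * transpose_mat (spQ sp i)) (1\<^sub>m (n_eps s))
     \<in> psd_mats (spm sp i + n_eps s))"

definition con_robust ::
    "lin_sys \<Rightarrow> 'k::finite ellitope \<Rightarrow> real \<Rightarrow> 'i spec \<Rightarrow> 'i \<Rightarrow> ('i, 'k) fvars \<Rightarrow> bool" where
  "con_robust s D \<rho> sp i V \<longleftrightarrow> (\<forall>\<zeta> \<in> ell_set D \<rho>.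
     \<zeta> \<bullet> (vX V i *\<^sub>v \<zeta>) + 2 * (\<zeta> \<bullet> (vx V i + vec_p s sp (vchi V) i))
       \<le> vdelta V i - real_q s sp (vchi V) i)"

definition F_constraints ::
    "lin_sys \<Rightarrow> real mat \<Rightarrow> 'k::finite ellitope \<Rightarrow> real \<Rightarrow> 'i spec \<Rightarrow> (('i, 'k) fvars \<Rightarrow> bool) set" where
  "F_constraints s Cov D \<rho> sp =
     con_quad s sp ` (I1 sp \<union> I3 sp) \<union>
     con_budget1 s Cov sp ` I1 sp \<union>
     con_budget3 sp ` I3 sp \<union>
     con_lambda ` I2 sp \<union>
     con_lin s D sp ` I2 sp \<union>
     con_budget2 s D \<rho> sp ` I2 sp \<union>
     con_cov s Cov sp ` I4 sp \<union>
     con_robust s D \<rho> sp ` (I1 sp \<union> I3 sp)"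

definition F_solutions ::
    "lin_sys \<Rightarrow> real mat \<Rightarrow> 'k::finite ellitope \<Rightarrow> real \<Rightarrow> 'i spec \<Rightarrow> ('i, 'k) fvars set" where
  "F_solutions s Cov D \<rho> sp = {V \<in> fvars_dom s sp. \<forall>c \<in> F_constraints s Cov D \<rho> sp. c V}"

text \<open>
  The variables do not form a vector space type, so convexity of a constraint (of its feasible set) is
  spelled out with componentwise convex combinations.
\<close>

definition fvars_mix ::
    "real \<Rightarrow> ('i, 'k::finite) fvars \<Rightarrow> ('i, 'k) fvars \<Rightarrow> ('i, 'k) fvars" where
  "fvars_mix \<theta> V W = \<lparr>
     vchi = \<lparr>pob_h = (\<lambda>t. (1 - \<theta>) \<cdot>\<^sub>v pob_h (vchi V) t + \<theta> \<cdot>\<^sub>v pob_h (vchi W) t),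
             pob_H = (\<lambda>t j. (1 - \<theta>) \<cdot>\<^sub>m pob_H (vchi V) t j + \<theta> \<cdot>\<^sub>m pob_H (vchi W) t j)\<rparr>,
     vX = (\<lambda>i. (1 - \<theta>) \<cdot>\<^sub>m vX V i + \<theta> \<cdot>\<^sub>m vX W i),
     vx = (\<lambda>i. (1 - \<theta>) \<cdot>\<^sub>v vx V i + \<theta> \<cdot>\<^sub>v vx W i),
     valpha = (\<lambda>i. (1 - \<theta>) * valpha V i + \<theta> * valpha W i),
     vdelta = (\<lambda>i. (1 - \<theta>) * vdelta V i + \<theta> * vdelta W i),
     vlambda = (\<lambda>i. (1 - \<theta>) *\<^sub>R vlambda V i + \<theta> *\<^sub>R vlambda W i)\<rparr>"

definition convex_constraint ::
    "('i, 'k::finite) fvars set \<Rightarrow> (('i, 'k) fvars \<Rightarrow> bool) \<Rightarrow> bool" where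
  "convex_constraint X c \<longleftrightarrow> (\<forall>V W \<theta>. V \<in> X \<and> c V \<and> W \<in> X \<and> c W \<and> 0 \<le> \<theta> \<and> \<theta> \<le> 1 \<longrightarrow>
     fvars_mix \<theta> V W \<in> X \<and> c (fvars_mix \<theta> V W))"

end

theory Submission
  imports Defs
begin

text \<open>
  The purified outputs do not depend on the controls: the difference between the state and the model
  state evolves as if no control were applied (\<open>state_eq_uncontrolled_plus_model\<close>). Hence the controls,
  and with them the whole trajectory, are affine in the disturbances for fixed parameters \<open>\<chi>\<close>, and affine
  in \<open>\<chi>\<close> for fixed disturbances. The first fact makes \<open>Z[\<chi>]\<close> and \<open>E[\<chi>]\<close> well defined
  (\<open>represents_traj_matZ_matE\<close>), the second makes them, and the forms \<open>p\<^sub>i[\<chi>]\<close> and \<open>q\<^sub>i[\<chi>]\<close>, affine in \<open>\<chi>\<close>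
  (\<open>matZ_matE_mix\<close>, \<open>vec_p_real_q_mix\<close>).

  Since the noise is centred, the mean of \<open>w\<close> is \<open>\<mu> = Z[\<chi>][\<zeta>;1]\<close>, and the expectation of a quadratic
  function of \<open>w\<close> is its value at \<open>\<mu>\<close> plus the trace of \<open>A E \<Pi> E\<^sup>T\<close>, which is the squared Frobenius norm of
  \<open>A\<^sup>1\<^sup>/\<^sup>2 E R\<close> (\<open>expectation_quad_form_affine\<close>). So the first and the third family of specifications both
  ask for a bound on a convex quadratic function of \<open>\<mu>\<close> over the uncertainty set. Such a bound is
  equivalent to the constraints on \<open>X\<^sub>i, x\<^sub>i, \<alpha>\<^sub>i, \<delta>\<^sub>i\<close>: in one direction take the bordered matrix equal to
  \<open>Z\<^sup>T A Z\<close> and let \<open>\<delta>\<^sub>i\<close> absorb the slack, in the other evaluate the matrix inequality at \<open>[\<zeta>;1]\<close>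
  (\<open>robust_quad_iff\<close>).

  For the second family one bounds a linear form over an ellitope. The set \<open>T\<close> has a point with positive
  coordinates, which is Slater's condition, so Lagrangian duality holds and the dual optimum is attained
  (\<open>ellitope_dual_multiplier\<close>); the inner maximisation over \<open>z\<close> of a concave quadratic function is
  expressed by the semidefinite constraint (\<open>ellitope_robust_linear_iff\<close>). The fourth family is a Schur
  complement (\<open>con_cov_iff\<close>).

  Convexity of each constraint is then read off: every semidefinite constraint says that certain
  quadratic forms are nonnegative for all arguments, and these forms are affine or concave in the
  variables; the remaining constraints bound sums of affine terms, the support function of \<open>T\<close> and the
  squared Frobenius norm.

  Both \<open>A\<^sup>1\<^sup>/\<^sup>2\<close> and \<open>\<Pi>\<^sup>1\<^sup>/\<^sup>2\<close> are defined by a description, so one also needs that a positive semidefinite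
  matrix has exactly one positive semidefinite square root (\<open>psd_sqrt\<close>).
\<close>

section \<open>Quadratic forms of symmetric matrices\<close>

lemma scalar_prod_sum:
  "w \<in> carrier_vec n \<Longrightarrow> v \<bullet> w = (\<Sum>i<n. v $ i * w $ i)"
  by (auto simp: scalar_prod_def atLeast0LessThan)

lemma mult_mat_vec_index_sum:
  assumes "A \<in> carrier_mat n m" "v \<in> carrier_vec m" "i < n"
  shows "(A *\<^sub>v v) $ i = (\<Sum>j<m. A $$ (i, j) * v $ j)"
  using assms by (simp add: scalar_prod_sum[of v m])

lemma mult_mat_index_sum:
  assumes "A \<in> carrier_mat n m" "B \<in> carrier_mat m k" "i < n" "j < k"
  shows "(A * B) $$ (i, j) = (\<Sum>l<m. A $$ (i, l) * B $$ (l, j))"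
  using assms by (simp add: scalar_prod_sum[of "col B j" m])

lemma scalar_prod_mult_mat_vec_sum:
  assumes "A \<in> carrier_mat n m" "v \<in> carrier_vec n" "w \<in> carrier_vec m"
  shows "v \<bullet> (A *\<^sub>v w) = (\<Sum>i<n. \<Sum>j<m. v $ i * A $$ (i, j) * w $ j)"
proof -
  have "v \<bullet> (A *\<^sub>v w) = (\<Sum>i<n. v $ i * (A *\<^sub>v w) $ i)"
    by (rule scalar_prod_sum) (use assms in simp)
  also have "\<dots> = (\<Sum>i<n. \<Sum>j<m. v $ i * A $$ (i, j) * w $ j)"
    using assms by (intro sum.cong refl, subst mult_mat_vec_index_sum)
      (auto simp: sum_distrib_left mult.assoc)
  finally show ?thesis .
qed

lemma smult_mat_mult_vec:
  assumes "A \<in> carrier_mat n m" "v \<in> carrier_vec m"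
  shows "(c \<cdot>\<^sub>m A) *\<^sub>v v = c \<cdot>\<^sub>v (A *\<^sub>v (v :: real vec))"
  using assms by (intro eq_vecI) (auto simp: scalar_prod_def sum_distrib_left mult.assoc)

lemma scalar_prod_self_nonneg: "0 \<le> (v :: real vec) \<bullet> v"
  by (auto simp: scalar_prod_def intro!: sum_nonneg)

lemma scalar_prod_self_eq_0:
  assumes "v \<in> carrier_vec n" "(v :: real vec) \<bullet> v = 0"
  shows "v = 0\<^sub>v n"
proof -
  have "(\<Sum>i<n. v $ i * v $ i) = 0"
    using assms by (simp flip: scalar_prod_sum[of v n])
  then have "\<forall>i<n. v $ i = 0"
    by (subst (asm) sum_nonneg_eq_0_iff) auto
  then show ?thesis using assms(1) by (intro eq_vecI) auto
qed

lemma scalar_prod_mult_self: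
  assumes "L \<in> carrier_mat k n" "x \<in> carrier_vec n"
  shows "(L *\<^sub>v x) \<bullet> (L *\<^sub>v (x :: real vec)) = x \<bullet> ((transpose_mat L * L) *\<^sub>v x)"
proof -
  have "x \<bullet> ((transpose_mat L * L) *\<^sub>v x) = x \<bullet> (transpose_mat L *\<^sub>v (L *\<^sub>v x))"
    using assms by (subst assoc_mult_mat_vec[of _ n k _ n]) auto
  also have "\<dots> = (transpose_mat (transpose_mat L) *\<^sub>v x) \<bullet> (L *\<^sub>v x)"
    using assms by (intro transpose_vec_mult_scalar[symmetric, of _ n k]) auto
  finally show ?thesis by simp
qed

lemma sym_matsD:
  assumes "A \<in> sym_mats n"
  shows "A \<in> carrier_mat n n" "transpose_mat A = A"
  using assms by (auto simp: sym_mats_def)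

lemma sym_mats_index:
  assumes "A \<in> sym_mats n" "i < n" "j < n"
  shows "A $$ (i, j) = A $$ (j, i)"
  using index_transpose_mat(1)[of j A i] sym_matsD[OF assms(1)] assms by auto

lemma sym_mats_row:
  assumes "A \<in> sym_mats n" "i < n"
  shows "row A i = col A i"
  using col_transpose[of i A] sym_matsD[OF assms(1)] assms(2) by auto

lemma sym_matsI_index:
  assumes "A \<in> carrier_mat n n" "\<And>i j. i < n \<Longrightarrow> j < n \<Longrightarrow> A $$ (i, j) = A $$ (j, i)"
  shows "A \<in> sym_mats n"
  using assms by (auto simp: sym_mats_def intro!: eq_matI)

lemma psd_matsD:
  assumes "A \<in> psd_mats n"
  shows "A \<in> sym_mats n" "A \<in> carrier_mat n n" "transpose_mat A = A"
    "\<And>v. v \<in> carrier_vec n \<Longrightarrow> 0 \<le> v \<bullet> (A *\<^sub>v v)"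
  using assms by (auto simp: psd_mats_def sym_mats_def)

lemma sym_mats_swap:
  assumes "A \<in> sym_mats n" "v \<in> carrier_vec n" "w \<in> carrier_vec n"
  shows "v \<bullet> (A *\<^sub>v w) = w \<bullet> (A *\<^sub>v v)"
  using transpose_vec_mult_scalar[of A n n w v] assms
  by (metis sym_matsD comm_scalar_prod mult_mat_vec_carrier)

lemma quad_form_add_smult:
  assumes A: "A \<in> sym_mats n" and v: "v \<in> carrier_vec n" and w: "w \<in> carrier_vec n"
  shows "(v + t \<cdot>\<^sub>v w) \<bullet> (A *\<^sub>v (v + t \<cdot>\<^sub>v w))
    = v \<bullet> (A *\<^sub>v v) + 2 * t * (w \<bullet> (A *\<^sub>v v)) + t\<^sup>2 * (w \<bullet> (A *\<^sub>v w))"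
proof -
  note Ac = sym_matsD(1)[OF A]
  have c: "A *\<^sub>v v \<in> carrier_vec n" "A *\<^sub>v w \<in> carrier_vec n" "t \<cdot>\<^sub>v w \<in> carrier_vec n"
    using Ac v w by auto
  have "A *\<^sub>v (v + t \<cdot>\<^sub>v w) = A *\<^sub>v v + t \<cdot>\<^sub>v (A *\<^sub>v w)"
    using Ac v w by (simp add: mult_add_distrib_mat_vec mult_mat_vec)
  then have "(v + t \<cdot>\<^sub>v w) \<bullet> (A *\<^sub>v (v + t \<cdot>\<^sub>v w))
      = v \<bullet> (A *\<^sub>v v) + t * (v \<bullet> (A *\<^sub>v w)) + t * (w \<bullet> (A *\<^sub>v v)) + t * t * (w \<bullet> (A *\<^sub>v w))"
    using v w c by (simp add: add_scalar_prod_distrib[of _ n] scalar_prod_add_distrib[of _ n]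
        algebra_simps)
  then show ?thesis
    using sym_mats_swap[OF A v w] by (simp add: power2_eq_square)
qed

lemma quad_form_convex:
  assumes A: "A \<in> psd_mats n" and v: "v \<in> carrier_vec n" and w: "w \<in> carrier_vec n"
    and \<theta>: "0 \<le> \<theta>" "\<theta> \<le> 1"
  shows "((1 - \<theta>) \<cdot>\<^sub>v v + \<theta> \<cdot>\<^sub>v w) \<bullet> (A *\<^sub>v ((1 - \<theta>) \<cdot>\<^sub>v v + \<theta> \<cdot>\<^sub>v w))
    \<le> (1 - \<theta>) * (v \<bullet> (A *\<^sub>v v)) + \<theta> * (w \<bullet> (A *\<^sub>v w))"
proof -
  define d where "d = w + (- 1) \<cdot>\<^sub>v v"
  have d: "d \<in> carrier_vec n" using v w by (simp add: d_def)
  have mix: "(1 - \<theta>) \<cdot>\<^sub>v v + \<theta> \<cdot>\<^sub>v w = v + \<theta> \<cdot>\<^sub>v d" and w_eq: "w = v + 1 \<cdot>\<^sub>v d"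
    using v w by (auto simp: d_def algebra_simps intro!: eq_vecI)
  note S = psd_matsD(1)[OF A]
  have ww: "w \<bullet> (A *\<^sub>v w) = v \<bullet> (A *\<^sub>v v) + 2 * (d \<bullet> (A *\<^sub>v v)) + d \<bullet> (A *\<^sub>v d)"
    using quad_form_add_smult[OF S v d, of 1] w_eq by simp
  have "0 \<le> \<theta> * (1 - \<theta>) * (d \<bullet> (A *\<^sub>v d))"
    using psd_matsD(4)[OF A d] \<theta> by simp
  then show ?thesis
    unfolding mix ww quad_form_add_smult[OF S v d]
    by (simp add: algebra_simps power2_eq_square)
qed

text \<open>
  If \<open>A v\<close> were nonzero, moving from \<open>v\<close> in the direction \<open>- A v\<close> would lower the quadratic form
  below its minimum 0 to first order.
\<close>

lemma psd_mats_kernel: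
  assumes A: "A \<in> psd_mats n" and v: "v \<in> carrier_vec n" and 0: "v \<bullet> (A *\<^sub>v v) = 0"
  shows "A *\<^sub>v v = 0\<^sub>v n"
proof -
  define w where "w = A *\<^sub>v v"
  define a where "a = w \<bullet> w"
  define b where "b = w \<bullet> (A *\<^sub>v w)"
  have w: "w \<in> carrier_vec n"
    using psd_matsD(2)[OF A] v by (simp add: w_def)
  have b: "0 \<le> b" unfolding b_def by (rule psd_matsD(4)[OF A w])
  \<comment> \<open>the minimiser over \<open>t\<close> would be \<open>- a / b\<close>; the shift by 1 avoids the case \<open>b = 0\<close>\<close>
  define t where "t = - (a / (b + 1))"
  have "0 \<le> (v + t \<cdot>\<^sub>v w) \<bullet> (A *\<^sub>v (v + t \<cdot>\<^sub>v w))"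
    by (rule psd_matsD(4)[OF A]) (use v w in simp)
  also have "\<dots> = 2 * t * a + t\<^sup>2 * b"
    unfolding quad_form_add_smult[OF psd_matsD(1)[OF A] v w] 0 by (simp add: a_def b_def w_def)
  also have "\<dots> = - (a\<^sup>2 * (b + 2) / (b + 1)\<^sup>2)"
    using b by (simp add: t_def divide_simps power2_eq_square) (simp add: algebra_simps)
  finally have "a\<^sup>2 * (b + 2) / (b + 1)\<^sup>2 \<le> 0" by simp
  moreover have "0 < a\<^sup>2 * (b + 2) / (b + 1)\<^sup>2" if "a \<noteq> 0"
    using b that by simp
  ultimately have "a = 0" by fastforce
  then show ?thesis
    using scalar_prod_self_eq_0[OF w] by (simp add: a_def w_def)
qed

section \<open>The positive semidefinite square root\<close>

lemma trace_mult_commute: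
  assumes "A \<in> carrier_mat n m" "B \<in> carrier_mat m n"
  shows "(\<Sum>i<n. (A * B) $$ (i, i)) = (\<Sum>j<m. (B * A) $$ (j, j :: nat) :: real)"
proof -
  have "(\<Sum>i<n. (A * B) $$ (i, i)) = (\<Sum>i<n. \<Sum>j<m. A $$ (i, j) * B $$ (j, i))"
    using assms by (intro sum.cong refl mult_mat_index_sum) auto
  also have "\<dots> = (\<Sum>j<m. \<Sum>i<n. B $$ (j, i) * A $$ (i, j))"
    by (subst sum.swap) (simp add: mult.commute)
  also have "\<dots> = (\<Sum>j<m. (B * A) $$ (j, j))"
    using assms by (intro sum.cong refl mult_mat_index_sum[symmetric]) auto
  finally show ?thesis .
qed

text \<open>
  With \<open>D = B - C\<close> the hypothesis gives \<open>B D + D C = 0\<close>. Multiplying by \<open>D\<close> and taking traces,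
  the nonnegative numbers \<open>d \<bullet> B d\<close> and \<open>d \<bullet> C d\<close>, summed over the columns \<open>d\<close> of \<open>D\<close>, vanish.
  So \<open>B d = C d = 0\<close>, whence \<open>D\<^sup>2 = 0\<close> and, by symmetry, \<open>D = 0\<close>. This avoids the spectral theorem.
\<close>

lemma psd_mats_sqrt_unique:
  assumes B: "B \<in> psd_mats n" and C: "C \<in> psd_mats n" and eq: "B * B = C * C"
  shows "B = C"
proof -
  note Bc = psd_matsD(2)[OF B] and Cc = psd_matsD(2)[OF C]
  define D where "D = B - C"
  have Dc: "D \<in> carrier_mat n n" unfolding D_def by (rule minus_carrier_mat[OF Cc])
  have D: "D \<in> sym_mats n"
  proof (rule sym_matsI_index[OF Dc])
    fix i j assume "i < n" "j < n"
    then show "D $$ (i, j) = D $$ (j, i)"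
      using sym_mats_index[OF psd_matsD(1)[OF B], of i j] sym_mats_index[OF psd_matsD(1)[OF C], of i j]
        Bc Cc by (simp add: D_def)
  qed
  have "B * D = B * B - B * C" "D * C = B * C - C * C"
    using Bc Cc by (simp_all add: D_def mult_minus_distrib_mat[of _ n n _ n] minus_mult_distrib_mat[of _ n n _ _ n])
  then have 0: "B * D + D * C = 0\<^sub>m n n"
    using Bc Cc eq by (intro eq_matI) auto
  have diag: "col D i \<bullet> (S *\<^sub>v col D i) = (D * (S * D)) $$ (i, i)"
    if "i < n" "S \<in> carrier_mat n n" for i and S :: "real mat"
  proof -
    have "row D i = col D i" by (rule sym_mats_row[OF D that(1)])
    then show ?thesis using that Dc by (simp add: col_mult2[of _ n n _ n])
  qed
  have "(\<Sum>i<n. col D i \<bullet> (B *\<^sub>v col D i) + col D i \<bullet> (C *\<^sub>v col D i))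
      = (\<Sum>i<n. (D * (B * D)) $$ (i, i)) + (\<Sum>i<n. (D * C * D) $$ (i, i))"
    using Bc Cc Dc by (simp add: diag sum.distrib assoc_mult_mat[of _ n n _ n _ n])
  also have "(\<Sum>i<n. (D * C * D) $$ (i, i)) = (\<Sum>i<n. (D * (D * C)) $$ (i, i))"
    using Dc Cc by (intro trace_mult_commute) auto
  also have "(\<Sum>i<n. (D * (B * D)) $$ (i, i)) + (\<Sum>i<n. (D * (D * C)) $$ (i, i))
      = (\<Sum>i<n. (D * (B * D + D * C)) $$ (i, i))"
    using Bc Cc Dc by (simp add: mult_add_distrib_mat[of _ n n _ n] flip: sum.distrib)
  also have "\<dots> = 0" using Dc by (simp add: 0)
  finally have sum0: "(\<Sum>i<n. col D i \<bullet> (B *\<^sub>v col D i) + col D i \<bullet> (C *\<^sub>v col D i)) = 0" .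
  have col0: "col D i = 0\<^sub>v n" if i: "i < n" for i
  proof -
    define d where "d = col D i"
    have d: "d \<in> carrier_vec n" unfolding d_def by (rule carrier_vecI) (use Dc in simp)
    have nn: "0 \<le> col D i \<bullet> (B *\<^sub>v col D i)" "0 \<le> col D i \<bullet> (C *\<^sub>v col D i)" for i
      using psd_matsD(4)[OF B] psd_matsD(4)[OF C] Dc by auto
    have "d \<bullet> (B *\<^sub>v d) + d \<bullet> (C *\<^sub>v d) = 0"
      using sum0 i nn unfolding d_def by (subst (asm) sum_nonneg_eq_0_iff) (auto intro: add_nonneg_nonneg)
    with nn[of i] have "d \<bullet> (B *\<^sub>v d) = 0" "d \<bullet> (C *\<^sub>v d) = 0" by (auto simp: d_def)
    then have "B *\<^sub>v d = 0\<^sub>v n" "C *\<^sub>v d = 0\<^sub>v n"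
      using psd_mats_kernel[OF B d] psd_mats_kernel[OF C d] by auto
    then have "D *\<^sub>v d = 0\<^sub>v n"
      using Bc Cc d by (simp add: D_def minus_mult_distrib_mat_vec[of _ n n])
    then have "(D *\<^sub>v d) $ i = 0" using i by simp
    moreover have "(D *\<^sub>v d) $ i = d \<bullet> d"
      using i Dc sym_mats_row[OF D i] by (simp add: d_def)
    ultimately show ?thesis using scalar_prod_self_eq_0[OF d] by (simp add: d_def)
  qed
  have D0: "D $$ (i, j) = 0" if "i < n" "j < n" for i j
    using that Dc arg_cong[OF col0[OF that(2)], of "\<lambda>x. x $ i"] by simp
  show ?thesis
  proof (rule eq_matI)
    fix i j assume "i < dim_row C" "j < dim_col C"
    then show "B $$ (i, j) = C $$ (i, j)" using D0[of i j] Bc Cc by (simp add: D_def)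
  qed (use Bc Cc in auto)
qed

lemma gbinomial_Suc_rec:
  "(a gchoose Suc k) = (a gchoose k) * (a - of_nat k) / (of_nat (Suc k) :: real)"
  by (simp add: gbinomial_prod_rev field_simps del: of_nat_Suc)

text \<open>
  The Taylor coefficients of \<open>sqrt (1 - x)\<close> at 0.
\<close>

definition sqrt_coeff :: "nat \<Rightarrow> real" where
  "sqrt_coeff k = (- 1) ^ k * (1 / 2 gchoose k)"

lemma sqrt_coeff_0 [simp]: "sqrt_coeff 0 = 1"
  by (simp add: sqrt_coeff_def)

lemma sqrt_coeff_nonpos: "sqrt_coeff (Suc k) \<le> 0"
proof (induction k)
  case (Suc k)
  have *: "sqrt_coeff (Suc (Suc k)) = sqrt_coeff (Suc k) * ((real k + 1 / 2) / real (Suc (Suc k)))"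
    by (simp add: sqrt_coeff_def gbinomial_Suc_rec[of _ "Suc k"] field_simps)
  show ?case unfolding * by (rule mult_nonpos_nonneg[OF Suc]) simp
qed (simp add: sqrt_coeff_def)

text \<open>
  The partial sums are again signed binomial coefficients, now with upper index \<open>-1/2\<close>. As all
  coefficients but the first are nonpositive, this bounds the series at the radius of convergence.
\<close>

lemma sqrt_coeff_partial_sums_nonneg: "0 \<le> (\<Sum>k\<le>n. sqrt_coeff k)"
proof -
  have "0 \<le> (- 1) ^ m * (- (1 / 2) gchoose m :: real)" for m
  proof (induction m)
    case (Suc m)
    have "(- 1) ^ Suc m * (- (1 / 2) gchoose Suc m :: real)
        = (- 1) ^ m * (- (1 / 2) gchoose m) * ((real m + 1 / 2) / real (Suc m))"
      by (simp add: gbinomial_Suc_rec[of _ m] field_simps)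
    then show ?case using Suc by (auto intro!: mult_nonneg_nonneg)
  qed simp
  then show ?thesis
    using gbinomial_sum_lower_neg[of "1 / 2 :: real" n]
    by (simp add: sqrt_coeff_def mult.commute)
qed

lemma summable_abs_sqrt_coeff: "summable (\<lambda>k. \<bar>sqrt_coeff k\<bar>)"
proof -
  have "summable (\<lambda>k. - sqrt_coeff (Suc k))"
  proof (rule summableI_nonneg_bounded)
    fix n
    show "0 \<le> - sqrt_coeff (Suc n)" using sqrt_coeff_nonpos by simp
    have "{..n} = {..<Suc n}" by auto
    then show "(\<Sum>k<n. - sqrt_coeff (Suc k)) \<le> 1"
      using sqrt_coeff_partial_sums_nonneg[of n]
      by (simp add: sum.lessThan_Suc_shift sum_negf del: sum.lessThan_Suc)
  qed
  then have "summable (\<lambda>k. \<bar>sqrt_coeff (Suc k)\<bar>)"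
    using sqrt_coeff_nonpos by (simp add: abs_of_nonpos)
  then show ?thesis by (subst (asm) summable_Suc_iff)
qed

lemma suminf_sqrt_coeff_nonneg: "0 \<le> (\<Sum>k. sqrt_coeff k)"
proof -
  have "summable sqrt_coeff"
    using summable_abs_sqrt_coeff by (rule summable_rabs_cancel)
  from summable_LIMSEQ'[OF this] show ?thesis
    by (rule LIMSEQ_le_const) (use sqrt_coeff_partial_sums_nonneg in auto)
qed

text \<open>
  The coefficientwise form of \<open>sqrt (1 - x) * sqrt (1 - x) = 1 - x\<close>, by Vandermonde's identity.
\<close>

lemma sqrt_coeff_convolution:
  "(\<Sum>k\<le>n. sqrt_coeff k * sqrt_coeff (n - k)) = (if n = 0 then 1 else if n = 1 then - 1 else 0)"
proof -
  have "(\<Sum>k\<le>n. sqrt_coeff k * sqrt_coeff (n - k))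
      = (\<Sum>k=0..n. (- 1) ^ n * ((1 / 2 gchoose k) * (1 / 2 gchoose (n - k))))"
    by (rule sum.cong) (auto simp: sqrt_coeff_def simp flip: power_add)
  also have "\<dots> = (- 1) ^ n * (1 gchoose n)"
    by (simp add: gbinomial_Vandermonde flip: sum_distrib_left)
  also have "(1 gchoose n :: real) = of_nat (1 choose n)"
    using binomial_gbinomial[of 1 n, where ?'a = real] by simp
  finally show ?thesis by (cases n) (auto simp: binomial_eq_0)
qed

lemma pow_mat_add:
  assumes "X \<in> carrier_mat n n"
  shows "X ^\<^sub>m (a + b) = X ^\<^sub>m a * (X ^\<^sub>m b :: real mat)"
proof (induction b)
  case 0
  show ?case using assms right_mult_one_mat[of "X ^\<^sub>m a" n n] by simp
next
  case (Suc b)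
  then show ?case
    using assoc_mult_mat[of "X ^\<^sub>m a" n n "X ^\<^sub>m b" n X n] assms by simp
qed

lemma sym_mats_pow:
  assumes "X \<in> sym_mats n"
  shows "X ^\<^sub>m k \<in> sym_mats n"
proof (induction k)
  case 0
  show ?case using sym_matsD[OF assms] by (simp add: sym_mats_def)
next
  case (Suc k)
  note X = sym_matsD[OF assms] and Xk = sym_matsD[OF Suc]
  have "transpose_mat (X ^\<^sub>m Suc k) = X * X ^\<^sub>m k"
    using X Xk by (simp add: transpose_mult[of _ n n _ n])
  also have "\<dots> = X ^\<^sub>m Suc k"
    using pow_mat_add[OF X(1), of 1 k] pow_mat_add[OF X(1), of k 1] X by simp
  finally show ?case
    using mult_carrier_mat[OF Xk(1) X(1)] by (simp add: sym_mats_def)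
qed

lemma psd_mats_smult:
  assumes "A \<in> psd_mats n" "0 \<le> c"
  shows "c \<cdot>\<^sub>m A \<in> psd_mats n"
proof -
  note A = psd_matsD[OF assms(1)]
  have "c \<cdot>\<^sub>m A \<in> sym_mats n"
    using A(2) sym_mats_index[OF A(1)] by (intro sym_matsI_index) auto
  moreover have "0 \<le> v \<bullet> ((c \<cdot>\<^sub>m A) *\<^sub>v v)" if v: "v \<in> carrier_vec n" for v
    using mult_mat_vec_carrier[OF A(2) v] v A(4)[OF v] assms(2) by (simp add: smult_mat_mult_vec[OF A(2) v])
  ultimately show ?thesis by (simp add: psd_mats_def)
qed

text \<open>
  Existence without diagonalisation: insert \<open>X\<close> into the binomial series of \<open>sqrt (1 - x)\<close>. The entries of
  the powers of a contraction are bounded by 1, so the series converges absolutely in each entry, and the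
  Cauchy product computes its square. It is positive semidefinite because \<open>v \<bullet> X\<^sup>k v \<le> v \<bullet> v\<close>, the
  coefficients with \<open>k > 0\<close> are nonpositive, and the sum of all coefficients is nonnegative.
\<close>

lemma exists_sqrt_one_minus_contraction:
  assumes X: "X \<in> sym_mats n"
    and contr: "\<And>v. v \<in> carrier_vec n \<Longrightarrow> (X *\<^sub>v v) \<bullet> (X *\<^sub>v v) \<le> v \<bullet> v"
  shows "\<exists>B \<in> psd_mats n. B * B = 1\<^sub>m n - X"
proof -
  note Xc = sym_matsD(1)[OF X]
  have Pc: "X ^\<^sub>m k \<in> carrier_mat n n" for k using Xc by simp
  have pow_contr: "(X ^\<^sub>m k *\<^sub>v v) \<bullet> (X ^\<^sub>m k *\<^sub>v v) \<le> v \<bullet> v" if "v \<in> carrier_vec n" for k v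
    using that
  proof (induction k arbitrary: v)
    case (Suc k)
    have "X ^\<^sub>m Suc k *\<^sub>v v = X ^\<^sub>m k *\<^sub>v (X *\<^sub>v v)"
      using Pc Xc Suc.prems by (simp add: assoc_mult_mat_vec[of _ n n _ n])
    then show ?case
      using Suc.IH[of "X *\<^sub>v v"] contr[OF Suc.prems] Xc Suc.prems by simp
  qed (use Xc in simp)
  have entry: "\<bar>(X ^\<^sub>m k) $$ (i, j)\<bar> \<le> 1" if ij: "i < n" "j < n" for i j k
  proof -
    define w where "w = X ^\<^sub>m k *\<^sub>v unit_vec n j"
    have w: "w \<in> carrier_vec n" unfolding w_def by (rule mult_mat_vec_carrier[OF Pc]) simp
    have "w $ i = (\<Sum>l<n. (X ^\<^sub>m k) $$ (i, l) * (unit_vec n j :: real vec) $ l)"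
      unfolding w_def by (rule mult_mat_vec_index_sum[OF Pc]) (use ij in auto)
    also have "\<dots> = (X ^\<^sub>m k) $$ (i, j)"
      using ij by (simp add: unit_vec_def if_distrib[of "(*) _"] cong: if_cong)
    finally have wi: "w $ i = (X ^\<^sub>m k) $$ (i, j)" .
    have "(w $ i)\<^sup>2 \<le> (\<Sum>l<n. (w $ l)\<^sup>2)"
      by (rule member_le_sum) (use ij in auto)
    also have "\<dots> = w \<bullet> w" using w by (simp add: scalar_prod_sum[OF w] power2_eq_square)
    also have "\<dots> \<le> unit_vec n j \<bullet> unit_vec n j"
      unfolding w_def by (rule pow_contr) simp
    also have "\<dots> = 1" using ij by simp
    finally show ?thesis unfolding wi by (simp add: abs_le_square_iff flip: abs_le_square_iff[of _ 1, simplified])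
  qed
  have summ: "summable (\<lambda>k. norm (sqrt_coeff k * (X ^\<^sub>m k) $$ (i, j)))" if "i < n" "j < n" for i j
    by (rule summable_comparison_test'[OF summable_abs_sqrt_coeff, of 0])
      (use entry[OF that] in \<open>simp add: abs_mult mult_left_le\<close>)
  define B where "B = mat n n (\<lambda>(i, j). \<Sum>k. sqrt_coeff k * (X ^\<^sub>m k) $$ (i, j))"
  have Bc: "B \<in> carrier_mat n n" by (simp add: B_def)
  have Bs: "(\<lambda>k. sqrt_coeff k * (X ^\<^sub>m k) $$ (i, j)) sums B $$ (i, j)" if "i < n" "j < n" for i j
    using summable_sums[OF summable_norm_cancel[OF summ[OF that]]] that by (simp add: B_def)
  have "B \<in> sym_mats n"
    using sym_mats_index[OF sym_mats_pow[OF X]]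
    by (intro sym_matsI_index[OF Bc]) (simp add: B_def)
  moreover have "0 \<le> v \<bullet> (B *\<^sub>v v)" if v: "v \<in> carrier_vec n" for v
  proof -
    have s: "(\<lambda>k. sqrt_coeff k * (v \<bullet> (X ^\<^sub>m k *\<^sub>v v))) sums (v \<bullet> (B *\<^sub>v v))"
    proof -
      have "(\<lambda>k. \<Sum>i<n. \<Sum>j<n. v $ i * (sqrt_coeff k * (X ^\<^sub>m k) $$ (i, j)) * v $ j)
          sums (\<Sum>i<n. \<Sum>j<n. v $ i * B $$ (i, j) * v $ j)"
        by (intro sums_sum sums_mult sums_mult2 Bs) auto
      then show ?thesis
        by (simp add: scalar_prod_mult_mat_vec_sum[OF Pc v v] scalar_prod_mult_mat_vec_sum[OF Bc v v]
            sum_distrib_left mult_ac)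
    qed
    have le: "v \<bullet> (X ^\<^sub>m k *\<^sub>v v) \<le> v \<bullet> v" for k
    proof -
      define w where "w = X ^\<^sub>m k *\<^sub>v v"
      have w: "w \<in> carrier_vec n" unfolding w_def by (rule mult_mat_vec_carrier[OF Pc v])
      have "0 \<le> (v - w) \<bullet> (v - w)" by (rule scalar_prod_self_nonneg)
      also have "\<dots> = v \<bullet> v - 2 * (v \<bullet> w) + w \<bullet> w"
        using v w by (simp add: minus_scalar_prod_distrib[of _ n] scalar_prod_minus_distrib[of _ n]
            comm_scalar_prod[OF w v])
      finally show ?thesis using pow_contr[OF v, of k] by (simp add: w_def)
    qed
    have "0 \<le> (\<Sum>k. sqrt_coeff k) * (v \<bullet> v)"
      by (intro mult_nonneg_nonneg suminf_sqrt_coeff_nonneg scalar_prod_self_nonneg)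
    also have "\<dots> \<le> v \<bullet> (B *\<^sub>v v)"
    proof (rule sums_le[OF _ sums_mult2[OF summable_sums[OF summable_rabs_cancel[OF summable_abs_sqrt_coeff]]] s])
      fix k
      show "sqrt_coeff k * (v \<bullet> v) \<le> sqrt_coeff k * (v \<bullet> (X ^\<^sub>m k *\<^sub>v v))"
      proof (cases k)
        case 0
        then show ?thesis using Xc v by simp
      next
        case (Suc m)
        then show ?thesis using le[of k] sqrt_coeff_nonpos[of m] by (simp add: mult_left_mono_neg)
      qed
    qed
    finally show ?thesis .
  qed
  moreover have "B * B = 1\<^sub>m n - X"
  proof (rule eq_matI)
    fix i j assume "i < dim_row (1\<^sub>m n - X)" "j < dim_col (1\<^sub>m n - X)"
    then have ij: "i < n" "j < n" using Xc by auto
    have "(\<lambda>m. \<Sum>l<n. \<Sum>k\<le>m. (sqrt_coeff k * (X ^\<^sub>m k) $$ (i, l))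
          * (sqrt_coeff (m - k) * (X ^\<^sub>m (m - k)) $$ (l, j)))
        sums (\<Sum>l<n. B $$ (i, l) * B $$ (l, j))"
      using ij Cauchy_product_sums[OF summ summ] sums_unique[OF Bs]
      by (intro sums_sum) (auto simp: sums_iff)
    moreover have "(\<Sum>l<n. \<Sum>k\<le>m. (sqrt_coeff k * (X ^\<^sub>m k) $$ (i, l))
          * (sqrt_coeff (m - k) * (X ^\<^sub>m (m - k)) $$ (l, j)))
        = (if m = 0 then 1 else if m = 1 then - 1 else 0) * (X ^\<^sub>m m) $$ (i, j)" for m
    proof -
      have "(\<Sum>l<n. \<Sum>k\<le>m. (sqrt_coeff k * (X ^\<^sub>m k) $$ (i, l))
          * (sqrt_coeff (m - k) * (X ^\<^sub>m (m - k)) $$ (l, j)))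
        = (\<Sum>k\<le>m. sqrt_coeff k * sqrt_coeff (m - k)
            * (\<Sum>l<n. (X ^\<^sub>m k) $$ (i, l) * (X ^\<^sub>m (m - k)) $$ (l, j)))"
        by (subst sum.swap) (simp add: sum_distrib_left mult_ac)
      also have "\<dots> = (\<Sum>k\<le>m. sqrt_coeff k * sqrt_coeff (m - k) * (X ^\<^sub>m m) $$ (i, j))"
      proof (rule sum.cong[OF refl])
        fix k assume "k \<in> {..m}"
        then have "X ^\<^sub>m m = X ^\<^sub>m k * X ^\<^sub>m (m - k)"
          using pow_mat_add[OF Xc, of k "m - k"] by simp
        then show "sqrt_coeff k * sqrt_coeff (m - k)
            * (\<Sum>l<n. (X ^\<^sub>m k) $$ (i, l) * (X ^\<^sub>m (m - k)) $$ (l, j))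
          = sqrt_coeff k * sqrt_coeff (m - k) * (X ^\<^sub>m m) $$ (i, j)"
          using mult_mat_index_sum[OF Pc Pc ij, of k "m - k"] by simp
      qed
      finally show ?thesis by (simp add: sqrt_coeff_convolution flip: sum_distrib_right)
    qed
    moreover have "(\<lambda>m. (if m = 0 then 1 else if m = 1 then - 1 else 0) * (X ^\<^sub>m m) $$ (i, j))
        sums (\<Sum>m<2. (if m = 0 then 1 else if m = 1 then - 1 else 0) * (X ^\<^sub>m m) $$ (i, j))"
      by (rule sums_finite) auto
    ultimately have "(\<Sum>l<n. B $$ (i, l) * B $$ (l, j))
      = (\<Sum>m<2. (if m = 0 then 1 else if m = 1 then - 1 else 0) * (X ^\<^sub>m m) $$ (i, j))"
      by (simp only: sums_unique2)
    then show "(B * B) $$ (i, j) = (1\<^sub>m n - X) $$ (i, j)"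
      using ij Xc by (simp add: mult_mat_index_sum[OF Bc Bc ij] numeral_2_eq_2)
  qed (use Bc Xc in auto)
  ultimately show ?thesis using Bc by (auto simp: psd_mats_def)
qed

lemma quad_form_le_const:
  assumes A: "A \<in> carrier_mat n n"
  shows "\<exists>c > 0. \<forall>v \<in> carrier_vec n. v \<bullet> (A *\<^sub>v v) \<le> c * (v \<bullet> v :: real)"
proof (intro exI conjI ballI)
  define c where "c = 1 + (\<Sum>i<n. \<Sum>j<n. \<bar>A $$ (i, j)\<bar>)"
  show "0 < c" by (simp add: c_def add_pos_nonneg sum_nonneg)
  fix v :: "real vec" assume v: "v \<in> carrier_vec n"
  have sq: "(v $ i)\<^sup>2 \<le> v \<bullet> v" if "i < n" for i
    unfolding scalar_prod_sum[OF v] power2_eq_square[symmetric]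
    by (rule member_le_sum) (use that in auto)
  have "v $ i * A $$ (i, j) * v $ j \<le> \<bar>A $$ (i, j)\<bar> * (v \<bullet> v)" if "i < n" "j < n" for i j
  proof -
    have "0 \<le> (\<bar>v $ i\<bar> - \<bar>v $ j\<bar>)\<^sup>2" by simp
    then have "\<bar>v $ i\<bar> * \<bar>v $ j\<bar> \<le> v \<bullet> v"
      using sq[OF that(1)] sq[OF that(2)] by (simp add: power2_diff)
    then have "\<bar>A $$ (i, j)\<bar> * (\<bar>v $ i\<bar> * \<bar>v $ j\<bar>) \<le> \<bar>A $$ (i, j)\<bar> * (v \<bullet> v)"
      by (intro mult_left_mono) auto
    moreover have "v $ i * A $$ (i, j) * v $ j \<le> \<bar>A $$ (i, j)\<bar> * (\<bar>v $ i\<bar> * \<bar>v $ j\<bar>)"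
      using abs_ge_self[of "v $ i * A $$ (i, j) * v $ j"] by (simp add: abs_mult mult_ac)
    ultimately show ?thesis by linarith
  qed
  then have "v \<bullet> (A *\<^sub>v v) \<le> (\<Sum>i<n. \<Sum>j<n. \<bar>A $$ (i, j)\<bar> * (v \<bullet> v))"
    unfolding scalar_prod_mult_mat_vec_sum[OF A v v] by (intro sum_mono) auto
  also have "\<dots> = (c - 1) * (v \<bullet> v)" by (simp add: c_def sum_distrib_right)
  also have "\<dots> \<le> c * (v \<bullet> v)" using scalar_prod_self_nonneg[of v] by (simp add: left_diff_distrib)
  finally show "v \<bullet> (A *\<^sub>v v) \<le> c * (v \<bullet> v)" .
qed

text \<open>
  Scaling reduces the claim to a contraction: if \<open>A\<close> is bounded by \<open>c\<close>, then \<open>X = 1 - A / c\<close> satisfies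
  \<open>\<bar>X v\<bar> \<le> \<bar>v\<bar>\<close>, because \<open>\<bar>A v\<bar>\<^sup>2 \<le> c (v \<bullet> A v)\<close>.
\<close>

lemma psd_mats_sqrt_exists:
  assumes A: "A \<in> psd_mats n"
  shows "\<exists>B \<in> psd_mats n. B * B = A"
proof -
  note Ac = psd_matsD(2)[OF A]
  obtain c where c: "c > 0" "\<And>v. v \<in> carrier_vec n \<Longrightarrow> v \<bullet> (A *\<^sub>v v) \<le> c * (v \<bullet> v)"
    using quad_form_le_const[OF Ac] by blast
  define X where "X = 1\<^sub>m n - (1 / c) \<cdot>\<^sub>m A"
  have Xc: "X \<in> carrier_mat n n"
    unfolding X_def by (rule minus_carrier_mat) (use Ac in simp)
  have X: "X \<in> sym_mats n"
    using Ac sym_mats_index[OF psd_matsD(1)[OF A]] by (intro sym_matsI_index[OF Xc]) (auto simp: X_def)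
  have "(X *\<^sub>v v) \<bullet> (X *\<^sub>v v) \<le> v \<bullet> v" if v: "v \<in> carrier_vec n" for v
  proof -
    define w where "w = A *\<^sub>v v"
    have w: "w \<in> carrier_vec n" using Ac v by (simp add: w_def)
    have Xv: "X *\<^sub>v v = v + (- (1 / c)) \<cdot>\<^sub>v w"
    proof (rule eq_vecI)
      fix i assume "i < dim_vec (v + (- (1 / c)) \<cdot>\<^sub>v w)"
      then have i: "i < n" using w by simp
      have "(X *\<^sub>v v) $ i = (\<Sum>j<n. (if i = j then v $ j else 0) - (1 / c) * (A $$ (i, j) * v $ j))"
        unfolding mult_mat_vec_index_sum[OF Xc v i]
        using i Ac by (intro sum.cong) (auto simp: X_def algebra_simps)
      also have "\<dots> = (v + (- (1 / c)) \<cdot>\<^sub>v w) $ i"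
        using i v w mult_mat_vec_index_sum[OF Ac v i]
        by (simp add: sum_subtractf flip: w_def sum_distrib_left sum_divide_distrib)
      finally show "(X *\<^sub>v v) $ i = (v + (- (1 / c)) \<cdot>\<^sub>v w) $ i" .
    qed (use Xc w in auto)
    have "0 \<le> (v + (- (1 / c)) \<cdot>\<^sub>v w) \<bullet> (A *\<^sub>v (v + (- (1 / c)) \<cdot>\<^sub>v w))"
      by (rule psd_matsD(4)[OF A]) (use v w in simp)
    also have "\<dots> = v \<bullet> w - 2 * (w \<bullet> w) / c + w \<bullet> (A *\<^sub>v w) / c\<^sup>2"
      unfolding quad_form_add_smult[OF psd_matsD(1)[OF A] v w] by (simp add: w_def power_divide)
    also have "\<dots> \<le> v \<bullet> w - 2 * (w \<bullet> w) / c + (c * (w \<bullet> w)) / c\<^sup>2"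
      using c(2)[OF w] by (intro add_left_mono divide_right_mono) auto
    also have "\<dots> = v \<bullet> w - (w \<bullet> w) / c" using c(1) by (simp add: power2_eq_square field_simps)
    finally have key: "(w \<bullet> w) / c \<le> v \<bullet> w" by simp
    have "(X *\<^sub>v v) \<bullet> (X *\<^sub>v v) = v \<bullet> v - 2 * (v \<bullet> w) / c + (w \<bullet> w) / c\<^sup>2"
      unfolding Xv using v w
      by (simp add: add_scalar_prod_distrib[of _ n] scalar_prod_add_distrib[of _ n]
          comm_scalar_prod[OF w v] power2_eq_square diff_divide_distrib)
    also have "(w \<bullet> w) / c\<^sup>2 \<le> (v \<bullet> w) / c"
      using divide_right_mono[OF key, of c] c(1) by (simp add: power2_eq_square)
    also have "v \<bullet> v - 2 * (v \<bullet> w) / c + (v \<bullet> w) / c = v \<bullet> v - (v \<bullet> w) / c"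
      by (simp add: field_simps)
    also have "\<dots> \<le> v \<bullet> v"
      using psd_matsD(4)[OF A v] c(1) by (simp add: w_def)
    finally show ?thesis by simp
  qed
  then obtain B where B: "B \<in> psd_mats n" "B * B = 1\<^sub>m n - X"
    using exists_sqrt_one_minus_contraction[OF X] by blast
  have "(sqrt c \<cdot>\<^sub>m B) * (sqrt c \<cdot>\<^sub>m B) = c \<cdot>\<^sub>m (B * B)"
    using psd_matsD(2)[OF B(1)] c(1)
    by (intro eq_matI)
      (simp_all add: mult_smult_assoc_mat[of _ n n _ n] mult_smult_distrib[of _ n n _ n] flip: mult.assoc)
  also have "\<dots> = A"
    unfolding B(2) using Ac c(1) by (intro eq_matI) (auto simp: X_def)
  finally have "(sqrt c \<cdot>\<^sub>m B) * (sqrt c \<cdot>\<^sub>m B) = A" .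
  moreover have "sqrt c \<cdot>\<^sub>m B \<in> psd_mats n"
    using B(1) c(1) by (intro psd_mats_smult) auto
  ultimately show ?thesis by blast
qed

lemma psd_sqrt:
  assumes A: "A \<in> psd_mats n"
  shows "psd_sqrt n A \<in> psd_mats n" "psd_sqrt n A * psd_sqrt n A = A"
proof -
  obtain B where "B \<in> psd_mats n \<and> B * B = A"
    using psd_mats_sqrt_exists[OF A] by blast
  then have "psd_sqrt n A \<in> psd_mats n \<and> psd_sqrt n A * psd_sqrt n A = A"
    unfolding psd_sqrt_def by (rule theI) (use psd_mats_sqrt_unique \<open>_ \<and> B * B = A\<close> in metis)
  then show "psd_sqrt n A \<in> psd_mats n" "psd_sqrt n A * psd_sqrt n A = A" by auto
qed

section \<open>Block matrices, the Loewner order and the Frobenius norm\<close>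

lemma quad_form_four_block:
  assumes A: "A \<in> carrier_mat n n" and B: "B \<in> carrier_mat n m" and D: "D \<in> carrier_mat m m"
    and a: "a \<in> carrier_vec n" and d: "d \<in> carrier_vec m"
  shows "(a @\<^sub>v d) \<bullet> (four_block_mat A B (transpose_mat B) D *\<^sub>v (a @\<^sub>v (d :: real vec)))
    = a \<bullet> (A *\<^sub>v a) + 2 * (a \<bullet> (B *\<^sub>v d)) + d \<bullet> (D *\<^sub>v d)"
proof -
  have Bt: "transpose_mat B \<in> carrier_mat m n" using B by simp
  have c: "A *\<^sub>v a \<in> carrier_vec n" "B *\<^sub>v d \<in> carrier_vec n"
      "transpose_mat B *\<^sub>v a \<in> carrier_vec m" "D *\<^sub>v d \<in> carrier_vec m"
    using mult_mat_vec_carrier[OF A a] mult_mat_vec_carrier[OF B d] mult_mat_vec_carrier[OF Bt a]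
      mult_mat_vec_carrier[OF D d] by auto
  have "d \<bullet> (transpose_mat B *\<^sub>v a) = a \<bullet> (B *\<^sub>v d)"
    using transpose_vec_mult_scalar[OF B d a] comm_scalar_prod[OF d c(3)] by simp
  then show ?thesis
    unfolding four_block_mat_mult_vec[OF A B Bt D a d] using a d c
    by (simp add: scalar_prod_append[of _ n _ m] scalar_prod_add_distrib[of _ n]
        scalar_prod_add_distrib[of _ m])
qed

lemma sym_four_block:
  assumes A: "A \<in> sym_mats n" and B: "B \<in> carrier_mat n m" and D: "D \<in> sym_mats m"
  shows "four_block_mat A B (transpose_mat B) D \<in> sym_mats (n + m)"
proof -
  note A' = sym_matsD[OF A] and D' = sym_matsD[OF D]
  have "transpose_mat (four_block_mat A B (transpose_mat B) D) = four_block_mat A B (transpose_mat B) D"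
    using transpose_four_block_mat[OF A'(1) B _ D'(1), of "transpose_mat B"] B A'(2) D'(2) by simp
  then show ?thesis using A' D' by (simp add: sym_mats_def)
qed

lemma carrier_vec_add_cases:
  assumes "v \<in> carrier_vec (n + m)"
  obtains a d where "a \<in> carrier_vec n" "d \<in> carrier_vec m" "v = a @\<^sub>v (d :: real vec)"
  using that[of "vec_first v n" "vec_last v m"] vec_first_last_append[OF assms] by auto

lemma psd_four_block_iff:
  assumes A: "A \<in> sym_mats n" and B: "B \<in> carrier_mat n m" and D: "D \<in> sym_mats m"
  shows "four_block_mat A B (transpose_mat B) D \<in> psd_mats (n + m) \<longleftrightarrow>
    (\<forall>a \<in> carrier_vec n. \<forall>d \<in> carrier_vec m.
       0 \<le> a \<bullet> (A *\<^sub>v a) + 2 * (a \<bullet> (B *\<^sub>v d)) + d \<bullet> (D *\<^sub>v d))"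
proof -
  note q = quad_form_four_block[OF sym_matsD(1)[OF A] B sym_matsD(1)[OF D]]
  show ?thesis
    using sym_four_block[OF A B D]
    by (auto simp: psd_mats_def simp flip: q elim!: carrier_vec_add_cases)
qed

text \<open>
  Completing the square: the form of the block matrix at \<open>(a, d)\<close> is
  \<open>a \<bullet> A a - \<bar>B\<^sup>T a\<bar>\<^sup>2 + \<bar>B\<^sup>T a + d\<bar>\<^sup>2\<close>, and \<open>d = - B\<^sup>T a\<close> removes the last term.
\<close>

lemma schur_identity_block_iff:
  assumes A: "A \<in> sym_mats n" and B: "B \<in> carrier_mat n m"
  shows "four_block_mat A B (transpose_mat B) (1\<^sub>m m) \<in> psd_mats (n + m) \<longleftrightarrow>
    (\<forall>a \<in> carrier_vec n. (transpose_mat B *\<^sub>v a) \<bullet> (transpose_mat B *\<^sub>v a) \<le> a \<bullet> (A *\<^sub>v a))"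
proof -
  have I: "1\<^sub>m m \<in> sym_mats m" by (simp add: sym_mats_def)
  have Bt: "transpose_mat B \<in> carrier_mat m n" using B by simp
  have expand: "a \<bullet> (A *\<^sub>v a) + 2 * (a \<bullet> (B *\<^sub>v d)) + d \<bullet> (1\<^sub>m m *\<^sub>v d)
      = (a \<bullet> (A *\<^sub>v a) - (transpose_mat B *\<^sub>v a) \<bullet> (transpose_mat B *\<^sub>v a))
        + (transpose_mat B *\<^sub>v a + d) \<bullet> (transpose_mat B *\<^sub>v a + d)"
    if a: "a \<in> carrier_vec n" and d: "d \<in> carrier_vec m" for a d
  proof -
    define b where "b = transpose_mat B *\<^sub>v a"
    have b: "b \<in> carrier_vec m" unfolding b_def by (rule mult_mat_vec_carrier[OF Bt a])
    have "a \<bullet> (B *\<^sub>v d) = b \<bullet> d" unfolding b_def by (rule transpose_vec_mult_scalar[OF B d a, symmetric])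
    then show ?thesis using b d
      by (simp add: add_scalar_prod_distrib[of _ m] scalar_prod_add_distrib[of _ m]
          comm_scalar_prod[OF d b] flip: b_def)
  qed
  show ?thesis
    unfolding psd_four_block_iff[OF A B I]
  proof (intro iffI ballI)
    fix a :: "real vec" assume *: "\<forall>a \<in> carrier_vec n. \<forall>d \<in> carrier_vec m.
       0 \<le> a \<bullet> (A *\<^sub>v a) + 2 * (a \<bullet> (B *\<^sub>v d)) + d \<bullet> (1\<^sub>m m *\<^sub>v d)" and a: "a \<in> carrier_vec n"
    define b where "b = transpose_mat B *\<^sub>v a"
    have b: "b \<in> carrier_vec m" unfolding b_def by (rule mult_mat_vec_carrier[OF Bt a])
    have "b + - b = 0\<^sub>v m" using b by simp
    then show "(transpose_mat B *\<^sub>v a) \<bullet> (transpose_mat B *\<^sub>v a) \<le> a \<bullet> (A *\<^sub>v a)"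
      using *[rule_format, OF a, of "- b"] expand[OF a, of "- b"] b by (simp flip: b_def)
  next
    fix a d :: "real vec" assume *: "\<forall>a \<in> carrier_vec n.
        (transpose_mat B *\<^sub>v a) \<bullet> (transpose_mat B *\<^sub>v a) \<le> a \<bullet> (A *\<^sub>v a)"
      and a: "a \<in> carrier_vec n" and d: "d \<in> carrier_vec m"
    show "0 \<le> a \<bullet> (A *\<^sub>v a) + 2 * (a \<bullet> (B *\<^sub>v d)) + d \<bullet> (1\<^sub>m m *\<^sub>v d)"
      unfolding expand[OF a d]
      by (intro add_nonneg_nonneg scalar_prod_self_nonneg) (use * a in auto)
  qed
qed

lemma quad_form_congruence:
  assumes A: "A \<in> carrier_mat m m" and E: "E \<in> carrier_mat m n" and y: "y \<in> carrier_vec n"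
  shows "y \<bullet> ((transpose_mat E * A * E) *\<^sub>v y) = (E *\<^sub>v y) \<bullet> (A *\<^sub>v (E *\<^sub>v (y :: real vec)))"
proof -
  have Et: "transpose_mat E \<in> carrier_mat n m" using E by simp
  note Ey = mult_mat_vec_carrier[OF E y]
  note AEy = mult_mat_vec_carrier[OF A Ey]
  have "(transpose_mat E * A * E) *\<^sub>v y = transpose_mat E *\<^sub>v (A *\<^sub>v (E *\<^sub>v y))"
    using assoc_mult_mat_vec[OF mult_carrier_mat[OF Et A] E y] assoc_mult_mat_vec[OF Et A Ey] by simp
  then show ?thesis
    using transpose_vec_mult_scalar[OF Et AEy y] by simp
qed

lemma sym_mats_congruence:
  assumes A: "A \<in> sym_mats m" and E: "E \<in> carrier_mat m n"
  shows "transpose_mat E * A * E \<in> sym_mats n"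
proof -
  note A' = sym_matsD[OF A]
  have Et: "transpose_mat E \<in> carrier_mat n m" using E by simp
  have "transpose_mat (transpose_mat E * A * E) = transpose_mat E * (A * E)"
    using transpose_mult[OF mult_carrier_mat[OF Et A'(1)] E] transpose_mult[OF Et A'(1)] A'(2) by simp
  also have "\<dots> = transpose_mat E * A * E" by (rule assoc_mult_mat[OF Et A'(1) E, symmetric])
  finally show ?thesis
    using mult_carrier_mat[OF mult_carrier_mat[OF Et A'(1)] E] by (simp add: sym_mats_def)
qed

lemma loewner_ge_iff:
  assumes A: "A \<in> sym_mats n" and C: "C \<in> sym_mats n"
  shows "loewner_ge n A C \<longleftrightarrow> (\<forall>v \<in> carrier_vec n. v \<bullet> (C *\<^sub>v v) \<le> v \<bullet> (A *\<^sub>v v))"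
proof -
  note Ac = sym_matsD(1)[OF A] and Cc = sym_matsD(1)[OF C]
  have mc: "A - C \<in> carrier_mat n n" by (rule minus_carrier_mat[OF Cc])
  have "A - C \<in> sym_mats n"
    using Ac Cc sym_mats_index[OF A] sym_mats_index[OF C] by (intro sym_matsI_index[OF mc]) simp
  moreover have "v \<bullet> ((A - C) *\<^sub>v v) = v \<bullet> (A *\<^sub>v v) - v \<bullet> (C *\<^sub>v v)" if v: "v \<in> carrier_vec n" for v
    using v Ac Cc mult_mat_vec_carrier[OF Ac v] mult_mat_vec_carrier[OF Cc v]
    by (simp add: minus_mult_distrib_mat_vec[of _ n n] scalar_prod_minus_distrib[of _ n])
  ultimately show ?thesis
    using A C by (auto simp: loewner_ge_def psd_mats_def)
qed

lemma mat_of_cols_singleton_mult: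
  assumes "x \<in> carrier_vec n"
  shows "mat_of_cols n [x] *\<^sub>v vec 1 (\<lambda>_. \<tau>) = \<tau> \<cdot>\<^sub>v (x :: real vec)"
  using assms by (intro eq_vecI) (auto simp: scalar_prod_def mat_of_cols_def)

lemma bordered_sym:
  assumes "X \<in> sym_mats n" "x \<in> carrier_vec n"
  shows "bordered X x \<alpha> \<in> sym_mats (n + 1)"
proof -
  have 1: "mat 1 1 (\<lambda>_. \<alpha>) \<in> sym_mats 1" by (rule sym_matsI_index) auto
  have c: "mat_of_cols n [x] \<in> carrier_mat n 1"
    using mat_of_cols_carrier(1)[of n "[x]"] by simp
  show ?thesis
    using sym_four_block[OF assms(1) c 1] assms(2) by (simp add: bordered_def transpose_mat_of_cols del: One_nat_def)
qed

lemma quad_form_bordered: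
  assumes X: "X \<in> carrier_mat n n" and x: "x \<in> carrier_vec n" and v: "v \<in> carrier_vec n"
  shows "(v @\<^sub>v vec 1 (\<lambda>_. \<tau>)) \<bullet> (bordered X x \<alpha> *\<^sub>v (v @\<^sub>v vec 1 (\<lambda>_. \<tau>)))
    = v \<bullet> (X *\<^sub>v v) + 2 * \<tau> * (v \<bullet> x) + \<alpha> * \<tau>\<^sup>2"
proof -
  have c: "mat_of_cols n [x] \<in> carrier_mat n 1" using mat_of_cols_carrier(1)[of n "[x]"] by simp
  have 1: "vec 1 (\<lambda>_. \<tau>) \<bullet> (mat 1 1 (\<lambda>_. \<alpha>) *\<^sub>v vec 1 (\<lambda>_. \<tau>)) = \<alpha> * \<tau>\<^sup>2"
    by (simp add: scalar_prod_def power2_eq_square)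
  show ?thesis
    using quad_form_four_block[OF X c _ v, of "mat 1 1 (\<lambda>_. \<alpha>)" "vec 1 (\<lambda>_. \<tau>)"] x v
    unfolding 1 mat_of_cols_singleton_mult[OF x]
    by (simp add: bordered_def transpose_mat_of_cols del: One_nat_def)
qed

lemma bordered_tl_psd_iff:
  assumes X: "X \<in> sym_mats n" and x: "x \<in> carrier_vec n"
  shows "bordered_tl \<alpha> x X \<in> psd_mats (1 + n) \<longleftrightarrow>
    (\<forall>\<tau>. \<forall>z \<in> carrier_vec n. 0 \<le> \<alpha> * \<tau>\<^sup>2 + 2 * \<tau> * (x \<bullet> z) + z \<bullet> (X *\<^sub>v z))"
proof -
  have c: "mat_of_rows n [x] \<in> carrier_mat 1 n" using mat_of_rows_carrier(1)[of n "[x]"] by simp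
  have s: "mat 1 1 (\<lambda>_. \<alpha>) \<in> sym_mats 1" by (rule sym_matsI_index) auto
  have 1: "vec 1 (\<lambda>_. \<tau>) \<bullet> (mat 1 1 (\<lambda>_. \<alpha>) *\<^sub>v vec 1 (\<lambda>_. \<tau>)) = \<alpha> * \<tau>\<^sup>2" for \<tau>
    by (simp add: scalar_prod_def power2_eq_square)
  have 2: "vec 1 (\<lambda>_. \<tau>) \<bullet> (mat_of_rows n [x] *\<^sub>v z) = \<tau> * (x \<bullet> z)" if "z \<in> carrier_vec n" for \<tau> z
  proof -
    have "(mat_of_rows n [x] *\<^sub>v z) $ 0 = x \<bullet> z"
      using x by (simp add: mat_of_rows_row)
    moreover have "mat_of_rows n [x] *\<^sub>v z \<in> carrier_vec 1"
      by (rule mult_mat_vec_carrier[OF c that])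
    ultimately show ?thesis by (subst scalar_prod_sum) (auto simp del: index_mult_mat_vec)
  qed
  have 3: "a = vec 1 (\<lambda>_. a $ 0)" if "a \<in> carrier_vec 1" for a :: "real vec"
    using that by (intro eq_vecI) auto
  have "bordered_tl \<alpha> x X \<in> psd_mats (1 + n) \<longleftrightarrow> (\<forall>a \<in> carrier_vec 1. \<forall>d \<in> carrier_vec n.
       0 \<le> a \<bullet> (mat 1 1 (\<lambda>_. \<alpha>) *\<^sub>v a) + 2 * (a \<bullet> (mat_of_rows n [x] *\<^sub>v d)) + d \<bullet> (X *\<^sub>v d))"
    using psd_four_block_iff[OF s c X] x by (simp add: bordered_tl_def transpose_mat_of_rows)
  also have "\<dots> \<longleftrightarrow> (\<forall>\<tau>. \<forall>z \<in> carrier_vec n. 0 \<le> \<alpha> * \<tau>\<^sup>2 + 2 * \<tau> * (x \<bullet> z) + z \<bullet> (X *\<^sub>v z))"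
    (is "?l = ?r")
  proof
    assume ?l
    show ?r
    proof (intro allI ballI)
      fix \<tau> :: real and z :: "real vec" assume z: "z \<in> carrier_vec n"
      show "0 \<le> \<alpha> * \<tau>\<^sup>2 + 2 * \<tau> * (x \<bullet> z) + z \<bullet> (X *\<^sub>v z)"
        using \<open>?l\<close>[rule_format, of "vec 1 (\<lambda>_. \<tau>)" z] z unfolding 1 2[OF z] by simp
    qed
  next
    assume ?r
    show ?l
    proof (intro ballI)
      fix a d :: "real vec" assume a: "a \<in> carrier_vec 1" and d: "d \<in> carrier_vec n"
      have "0 \<le> \<alpha> * (a $ 0)\<^sup>2 + 2 * (a $ 0) * (x \<bullet> d) + d \<bullet> (X *\<^sub>v d)"
        using \<open>?r\<close> d by blast
      then show "0 \<le> a \<bullet> (mat 1 1 (\<lambda>_. \<alpha>) *\<^sub>v a) + 2 * (a \<bullet> (mat_of_rows n [x] *\<^sub>v d)) + d \<bullet> (X *\<^sub>v d)"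
        using 1[of "a $ 0"] 2[OF d, of "a $ 0"] 3[OF a] by simp
    qed
  qed
  finally show ?thesis .
qed

text \<open>
  For positive semidefinite \<open>X\<close> it suffices to test vectors whose first coordinate is 1: other
  nonzero values follow by scaling, and at 0 only the form of \<open>X\<close> remains.
\<close>

lemma bordered_tl_psdI:
  assumes X: "X \<in> psd_mats n" and x: "x \<in> carrier_vec n"
    and *: "\<And>z. z \<in> carrier_vec n \<Longrightarrow> 0 \<le> \<alpha> + 2 * (x \<bullet> z) + z \<bullet> (X *\<^sub>v z)"
  shows "bordered_tl \<alpha> x X \<in> psd_mats (1 + n)"
  unfolding bordered_tl_psd_iff[OF psd_matsD(1)[OF X] x]
proof (intro allI ballI)
  fix \<tau> :: real and z :: "real vec" assume z: "z \<in> carrier_vec n"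
  show "0 \<le> \<alpha> * \<tau>\<^sup>2 + 2 * \<tau> * (x \<bullet> z) + z \<bullet> (X *\<^sub>v z)"
  proof (cases "\<tau> = 0")
    case True
    then show ?thesis using psd_matsD(4)[OF X z] by simp
  next
    case False
    note Xz = mult_mat_vec_carrier[OF psd_matsD(2)[OF X] z]
    have "X *\<^sub>v ((1 / \<tau>) \<cdot>\<^sub>v z) = (1 / \<tau>) \<cdot>\<^sub>v (X *\<^sub>v z)"
      using psd_matsD(2)[OF X] z by (simp add: mult_mat_vec)
    then have "0 \<le> \<alpha> + 2 * (x \<bullet> z) / \<tau> + (z \<bullet> (X *\<^sub>v z)) / \<tau>\<^sup>2"
      using *[of "(1 / \<tau>) \<cdot>\<^sub>v z"] z x Xz by (simp add: power2_eq_square)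
    then have "0 \<le> \<tau>\<^sup>2 * (\<alpha> + 2 * (x \<bullet> z) / \<tau> + (z \<bullet> (X *\<^sub>v z)) / \<tau>\<^sup>2)" by simp
    also have "\<dots> = \<alpha> * \<tau>\<^sup>2 + 2 * \<tau> * (x \<bullet> z) + z \<bullet> (X *\<^sub>v z)"
      using False by (simp add: field_simps power2_eq_square)
    finally show ?thesis .
  qed
qed

lemma sum_mat_carrier [simp]: "sum_mat n F \<in> carrier_mat n n"
  by (simp add: sum_mat_def)

lemma quad_form_sum_mat:
  assumes F: "\<And>k. F k \<in> carrier_mat n n" and v: "v \<in> carrier_vec n"
  shows "v \<bullet> (sum_mat n F *\<^sub>v v) = (\<Sum>k\<in>UNIV. v \<bullet> (F k *\<^sub>v v))"
proof -
  have "v \<bullet> (sum_mat n F *\<^sub>v v) = (\<Sum>i<n. \<Sum>j<n. \<Sum>k\<in>UNIV. v $ i * F k $$ (i, j) * v $ j)"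
    unfolding scalar_prod_mult_mat_vec_sum[OF sum_mat_carrier v v]
    by (simp add: sum_mat_def sum_distrib_left sum_distrib_right)
  also have "\<dots> = (\<Sum>i<n. \<Sum>k\<in>UNIV. \<Sum>j<n. v $ i * F k $$ (i, j) * v $ j)"
    by (intro sum.cong refl sum.swap)
  also have "\<dots> = (\<Sum>k\<in>UNIV. \<Sum>i<n. \<Sum>j<n. v $ i * F k $$ (i, j) * v $ j)"
    by (rule sum.swap)
  finally show ?thesis by (simp add: scalar_prod_mult_mat_vec_sum[OF F v v])
qed

lemma sum_mat_sym:
  assumes "\<And>k. F k \<in> sym_mats n"
  shows "sum_mat n F \<in> sym_mats n"
proof (rule sym_matsI_index[OF sum_mat_carrier])
  fix i j assume "i < n" "j < n"
  then show "sum_mat n F $$ (i, j) = sum_mat n F $$ (j, i)"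
    using sym_mats_index[OF assms] by (simp add: sum_mat_def cong: sum.cong)
qed

lemma sum_mat_psd:
  assumes "\<And>k. F k \<in> psd_mats n"
  shows "sum_mat n F \<in> psd_mats n"
proof -
  have "0 \<le> v \<bullet> (sum_mat n F *\<^sub>v v)" if "v \<in> carrier_vec n" for v
    using that psd_matsD[OF assms] by (subst quad_form_sum_mat) (auto intro!: sum_nonneg)
  then show ?thesis using sum_mat_sym[OF psd_matsD(1)[OF assms]] by (simp add: psd_mats_def)
qed

lemma fro_norm_sq: "(fro_norm L)\<^sup>2 = (\<Sum>i<dim_row L. \<Sum>j<dim_col L. (L $$ (i, j))\<^sup>2)"
  unfolding fro_norm_def by (intro real_sqrt_pow2 sum_nonneg) auto

lemma fro_norm_sq_eq_trace:
  assumes L: "L \<in> carrier_mat n m"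
  shows "(fro_norm L)\<^sup>2 = (\<Sum>j<m. (transpose_mat L * L) $$ (j, j))"
proof -
  have Lt: "transpose_mat L \<in> carrier_mat m n" using L by simp
  have "(fro_norm L)\<^sup>2 = (\<Sum>j<m. \<Sum>i<n. (L $$ (i, j))\<^sup>2)"
    unfolding fro_norm_sq using L by (simp, subst sum.swap, simp)
  also have "\<dots> = (\<Sum>j<m. (transpose_mat L * L) $$ (j, j))"
    using L by (intro sum.cong refl) (auto simp: mult_mat_index_sum[OF Lt L] power2_eq_square
        simp del: index_mult_mat)
  finally show ?thesis .
qed

text \<open>
  Both sides are the trace of \<open>E\<^sup>T A E C\<close>. The right-hand side is the expectation of \<open>\<epsilon> \<bullet> (E\<^sup>T A E) \<epsilon>\<close> when
  \<open>C\<close> is the covariance matrix of a centred random vector \<open>\<epsilon>\<close>.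
\<close>

lemma fro_norm_sqrt_sandwich:
  assumes A: "A \<in> psd_mats n" and E: "E \<in> carrier_mat n m" and C: "C \<in> psd_mats m"
  shows "(fro_norm (psd_sqrt n A * E * psd_sqrt m C))\<^sup>2
    = (\<Sum>k<m. \<Sum>l<m. (transpose_mat E * A * E) $$ (k, l) * C $$ (k, l))"
proof -
  define H where "H = psd_sqrt n A"
  define R where "R = psd_sqrt m C"
  have H: "H \<in> carrier_mat n n" "transpose_mat H = H" "H * H = A"
    using psd_sqrt[OF A] psd_matsD(2,3) unfolding H_def by auto
  have R: "R \<in> carrier_mat m m" "transpose_mat R = R" "R * R = C"
    using psd_sqrt[OF C] psd_matsD(2,3) unfolding R_def by auto
  define G where "G = transpose_mat E * A * E"
  have G: "G \<in> carrier_mat m m"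
    unfolding G_def using E by (intro mult_carrier_mat[of _ m n]) (auto intro!: psd_matsD(2)[OF A])
  have Et: "transpose_mat E \<in> carrier_mat m n" using E by simp
  note HE = mult_carrier_mat[OF H(1) E]
  have HER: "H * E * R \<in> carrier_mat n m" by (rule mult_carrier_mat[OF HE R(1)])
  have "transpose_mat (H * E * R) = R * (transpose_mat E * H)"
    using transpose_mult[OF HE R(1)] transpose_mult[OF H(1) E] H R by simp
  then have "transpose_mat (H * E * R) * (H * E * R) = R * (transpose_mat E * H) * (H * E * R)"
    by simp
  also have "\<dots> = R * ((transpose_mat E * H) * (H * E * R))"
    by (rule assoc_mult_mat[OF R(1) mult_carrier_mat[OF Et H(1)] HER])
  also have "(transpose_mat E * H) * (H * E * R) = (transpose_mat E * H) * (H * E) * R"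
    by (rule assoc_mult_mat[OF mult_carrier_mat[OF Et H(1)] HE R(1), symmetric])
  also have "(transpose_mat E * H) * (H * E) = G"
    unfolding G_def
    using assoc_mult_mat[OF Et H(1) HE] assoc_mult_mat[OF H(1) H(1) E] H(3)
      assoc_mult_mat[OF Et psd_matsD(2)[OF A] E] by simp
  finally have LL: "transpose_mat (H * E * R) * (H * E * R) = R * (G * R)" .
  have "(fro_norm (H * E * R))\<^sup>2 = (\<Sum>j<m. (R * (G * R)) $$ (j, j))"
    unfolding fro_norm_sq_eq_trace[OF HER] LL ..
  also have "\<dots> = (\<Sum>j<m. (G * R * R) $$ (j, j))"
    by (rule trace_mult_commute[OF R(1) mult_carrier_mat[OF G R(1)]])
  also have "G * R * R = G * C" using assoc_mult_mat[OF G R(1) R(1)] R(3) by simp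
  also have "(\<Sum>j<m. (G * C) $$ (j, j)) = (\<Sum>k<m. \<Sum>l<m. G $$ (k, l) * C $$ (k, l))"
    using sym_mats_index[OF psd_matsD(1)[OF C]]
    by (intro sum.cong refl) (simp add: mult_mat_index_sum[OF G psd_matsD(2)[OF C]])
  finally show ?thesis unfolding G_def H_def R_def .
qed

section \<open>Lagrangian duality over an ellitope\<close>

lemma inner_vec_sum: "inner a t = (\<Sum>k\<in>UNIV. vec_nth a k * vec_nth t k)"
  for a t :: "real ^ 'k::finite"
  by (simp add: inner_vec_def)

lemma nonneg_vec_iff: "0 \<le> (t :: real ^ 'k::finite) \<longleftrightarrow> (\<forall>k. 0 \<le> vec_nth t k)"
  by (simp add: Finite_Cartesian_Product.less_eq_vec_def)

lemma is_ellitopeD: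
  assumes "is_ellitope m D"
  shows "ell_P D \<in> carrier_mat m (dim_z D)" "\<And>k. ell_S D k \<in> psd_mats (dim_z D)"
    "ell_T D \<noteq> {}" "convex (ell_T D)" "compact (ell_T D)" "\<And>t. t \<in> ell_T D \<Longrightarrow> 0 \<le> t"
  using assms by (auto simp: is_ellitope_def)

text \<open>
  Slater's condition for the constraints \<open>z \<bullet> S\<^sub>k z \<le> \<rho> t\<^sub>k\<close>, at \<open>z = 0\<close>.
\<close>

lemma ellitope_interior_point:
  assumes "is_ellitope m (D :: 'k::finite ellitope)"
  obtains t where "t \<in> ell_T D" "\<And>k. 0 < vec_nth t k"
proof -
  obtain t where t: "t \<in> ell_T D" "t \<in> interior {t. 0 \<le> t}"
    using assms by (auto simp: is_ellitope_def)
  then obtain e where e: "e > 0" "ball t e \<subseteq> {t. 0 \<le> t}"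
    by (auto simp: mem_interior)
  have "0 < vec_nth t k" for k
  proof -
    have "t - (e / 2) *\<^sub>R axis k 1 \<in> ball t e" using e(1) by (simp add: dist_norm)
    then have "0 \<le> t - (e / 2) *\<^sub>R axis k 1" using e(2) by blast
    then have "0 \<le> vec_nth (t - (e / 2) *\<^sub>R axis k 1) k" unfolding nonneg_vec_iff by blast
    then show ?thesis using e(1) by (simp add: axis_def)
  qed
  with t(1) that show thesis by blast
qed

lemma phi_T_attained:
  assumes "compact T" "T \<noteq> {}"
  obtains t where "t \<in> T" "phi_T T l = inner l t"
proof -
  have "continuous_on T (inner l)" by (intro continuous_intros)
  then obtain t where t: "t \<in> T" "\<And>x. x \<in> T \<Longrightarrow> inner l x \<le> inner l t"
    using continuous_attains_sup[OF assms] by blast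
  have "phi_T T l = inner l t"
    unfolding phi_T_def by (rule cSup_eq_maximum) (use t in auto)
  with t(1) that show thesis by blast
qed

lemma phi_T_upper:
  assumes "compact T" "t \<in> T"
  shows "inner l t \<le> phi_T T l"
proof -
  have "compact (inner l ` T)"
    by (intro compact_continuous_image continuous_intros assms)
  then have "bdd_above (inner l ` T)"
    by (intro bounded_imp_bdd_above compact_imp_bounded)
  then show ?thesis unfolding phi_T_def by (intro cSUP_upper assms)
qed

lemma phi_T_convex:
  assumes "compact T" "T \<noteq> {}" "0 \<le> \<theta>" "\<theta> \<le> 1"
  shows "phi_T T ((1 - \<theta>) *\<^sub>R a + \<theta> *\<^sub>R b) \<le> (1 - \<theta>) * phi_T T a + \<theta> * phi_T T b"
proof -
  obtain t where t: "t \<in> T" "phi_T T ((1 - \<theta>) *\<^sub>R a + \<theta> *\<^sub>R b) = inner ((1 - \<theta>) *\<^sub>R a + \<theta> *\<^sub>R b) t"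
    using phi_T_attained[OF assms(1,2)] by blast
  then show ?thesis
    using assms phi_T_upper[OF assms(1) t(1)]
    by (simp add: inner_add_left add_mono mult_left_mono)
qed

lemma quad_form_weighted_sum_mat:
  assumes S: "\<And>k. S k \<in> carrier_mat n n" and z: "z \<in> carrier_vec n"
  shows "z \<bullet> (sum_mat n (\<lambda>k. vec_nth l k \<cdot>\<^sub>m S k) *\<^sub>v z) = (\<Sum>k\<in>UNIV. vec_nth l k * (z \<bullet> (S k *\<^sub>v z)))"
proof -
  have "z \<bullet> ((c \<cdot>\<^sub>m S k) *\<^sub>v z) = c * (z \<bullet> (S k *\<^sub>v z))" for c k
    using mult_mat_vec_carrier[OF S z] z by (simp add: smult_mat_mult_vec[OF S z])
  then show ?thesis using S z by (simp add: quad_form_sum_mat)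
qed

text \<open>
  The usual separation argument for strong duality. The convex set \<open>C\<close> consists of the pairs \<open>(u, r)\<close> for
  which some \<open>(z, t)\<close> has constraint values at most \<open>u\<close> and objective excess over \<open>\<gamma>\<close> greater than \<open>r\<close>; by
  the bound it misses the origin. As \<open>C\<close> is upward closed in \<open>u\<close> and downward closed in \<open>r\<close>, a separating
  functional \<open>(a, b)\<close> has \<open>a \<ge> 0\<close> and \<open>b \<le> 0\<close>, and Slater's condition excludes \<open>b = 0\<close>. The
  multiplier is \<open>a / - b\<close>.
\<close>

lemma ellitope_dual_multiplier:
  fixes D :: "'k::finite ellitope"
  assumes D: "is_ellitope m D" and \<rho>: "\<rho> > 0" and c: "c \<in> carrier_vec (dim_z D)"
    and bound: "\<forall>z \<in> carrier_vec (dim_z D). \<forall>t \<in> ell_T D.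
      (\<forall>k. z \<bullet> (ell_S D k *\<^sub>v z) \<le> \<rho> * vec_nth t k) \<longrightarrow> 2 * (c \<bullet> z) \<le> \<gamma>"
  shows "\<exists>l \<ge> 0. \<forall>z \<in> carrier_vec (dim_z D). \<forall>t \<in> ell_T D.
      2 * (c \<bullet> z) \<le> \<gamma> + (\<Sum>k\<in>UNIV. vec_nth l k * (z \<bullet> (ell_S D k *\<^sub>v z))) - \<rho> * inner l t"
proof -
  define n where "n = dim_z D"
  note Dd = is_ellitopeD[OF D, folded n_def]
  define Q where "Q k z = z \<bullet> (ell_S D k *\<^sub>v z)" for k z
  define C :: "((real ^ 'k) \<times> real) set" where
    "C = {(u, r). \<exists>z \<in> carrier_vec n. \<exists>t \<in> ell_T D.
       (\<forall>k. Q k z - \<rho> * vec_nth t k \<le> vec_nth u k) \<and> r < 2 * (c \<bullet> z) - \<gamma>}"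
  have CI: "(u, r) \<in> C" if "z \<in> carrier_vec n" "t \<in> ell_T D"
      "\<And>k. Q k z - \<rho> * vec_nth t k \<le> vec_nth u k" "r < 2 * (c \<bullet> z) - \<gamma>" for u r z t
    using that unfolding C_def by blast
  have "convex C"
    unfolding convex_alt
  proof (intro ballI allI impI)
    fix x y :: "(real ^ 'k) \<times> real" and \<theta> :: real
    assume "x \<in> C" "y \<in> C" and \<theta>: "0 \<le> \<theta> \<and> \<theta> \<le> 1"
    obtain u r u' r' where xy: "x = (u, r)" "y = (u', r')" by (cases x, cases y) auto
    obtain z t where z: "z \<in> carrier_vec n" "t \<in> ell_T D" "\<And>k. Q k z - \<rho> * vec_nth t k \<le> vec_nth u k"
        "r < 2 * (c \<bullet> z) - \<gamma>"
      using \<open>x \<in> C\<close> unfolding C_def xy by blast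
    obtain z' t' where z': "z' \<in> carrier_vec n" "t' \<in> ell_T D" "\<And>k. Q k z' - \<rho> * vec_nth t' k \<le> vec_nth u' k"
        "r' < 2 * (c \<bullet> z') - \<gamma>"
      using \<open>y \<in> C\<close> unfolding C_def xy by blast
    have "((1 - \<theta>) *\<^sub>R u + \<theta> *\<^sub>R u', (1 - \<theta>) * r + \<theta> * r') \<in> C"
    proof (rule CI)
      show "(1 - \<theta>) \<cdot>\<^sub>v z + \<theta> \<cdot>\<^sub>v z' \<in> carrier_vec n" using z z' by simp
      show "(1 - \<theta>) *\<^sub>R t + \<theta> *\<^sub>R t' \<in> ell_T D"
        using Dd(4) z(2) z'(2) \<theta> by (simp add: convex_alt)
      fix k
      have "Q k ((1 - \<theta>) \<cdot>\<^sub>v z + \<theta> \<cdot>\<^sub>v z') \<le> (1 - \<theta>) * Q k z + \<theta> * Q k z'"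
        unfolding Q_def by (rule quad_form_convex[OF Dd(2) z(1) z'(1)]) (use \<theta> in auto)
      moreover have "(1 - \<theta>) * (Q k z - \<rho> * vec_nth t k) + \<theta> * (Q k z' - \<rho> * vec_nth t' k)
          \<le> (1 - \<theta>) * vec_nth u k + \<theta> * vec_nth u' k"
        using z(3) z'(3) \<theta> by (intro add_mono mult_left_mono) auto
      ultimately show "Q k ((1 - \<theta>) \<cdot>\<^sub>v z + \<theta> \<cdot>\<^sub>v z') - \<rho> * vec_nth ((1 - \<theta>) *\<^sub>R t + \<theta> *\<^sub>R t') k
          \<le> vec_nth ((1 - \<theta>) *\<^sub>R u + \<theta> *\<^sub>R u') k"
        by (simp add: algebra_simps)
    next
      have cz: "2 * (c \<bullet> ((1 - \<theta>) \<cdot>\<^sub>v z + \<theta> \<cdot>\<^sub>v z')) - \<gamma>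
          = (1 - \<theta>) * (2 * (c \<bullet> z) - \<gamma>) + \<theta> * (2 * (c \<bullet> z') - \<gamma>)"
        using c z(1) z'(1) by (simp add: scalar_prod_add_distrib[of _ n] n_def algebra_simps)
      show "(1 - \<theta>) * r + \<theta> * r' < 2 * (c \<bullet> ((1 - \<theta>) \<cdot>\<^sub>v z + \<theta> \<cdot>\<^sub>v z')) - \<gamma>"
      proof (cases "\<theta> = 0")
        case False
        then show ?thesis
          unfolding cz using \<theta> z(4) z'(4) by (intro add_le_less_mono mult_left_mono mult_strict_left_mono) auto
      qed (use z(4) cz in simp)
    qed
    then show "(1 - \<theta>) *\<^sub>R x + \<theta> *\<^sub>R y \<in> C" by (simp add: xy)
  qed
  moreover have "0 \<notin> C"
  proof
    assume "0 \<in> C"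
    then obtain z t where "z \<in> carrier_vec n" "t \<in> ell_T D" "\<And>k. Q k z - \<rho> * vec_nth t k \<le> 0"
        "0 < 2 * (c \<bullet> z) - \<gamma>"
      unfolding C_def zero_prod_def by auto
    then show False using bound by (force simp: n_def Q_def)
  qed
  ultimately obtain w where w: "w \<noteq> 0" "\<forall>x\<in>C. 0 \<le> inner w x"
    using separating_hyperplane_set_0 by blast
  obtain a b where wab: "w = (a, b)" by (cases w)
  have sep: "0 \<le> inner a u + b * r" if "(u, r) \<in> C" for u r
    using w(2) that by (auto simp: wab)
  obtain t0 where t0: "t0 \<in> ell_T D" "\<And>k. 0 < vec_nth t0 k"
    using ellitope_interior_point[OF D] by blast
  have Q0: "Q k (0\<^sub>v n) = 0" for k
    using mult_mat_vec_carrier[OF psd_matsD(2)[OF Dd(2)], of "0\<^sub>v n"] by (simp add: Q_def)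
  \<comment> \<open>the points of \<open>C\<close> obtained from the Slater point\<close>
  have C0: "(u, r) \<in> C" if "\<And>k. - \<rho> * vec_nth t0 k \<le> vec_nth u k" "r < - \<gamma>" for u r
    by (rule CI[of "0\<^sub>v n" t0]) (use that t0 c Q0 in \<open>auto simp: n_def\<close>)
  define u0 where "u0 = (- \<rho>) *\<^sub>R t0"
  have "b \<le> 0"
  proof (rule ccontr)
    assume "\<not> b \<le> 0"
    then have b: "b > 0" by simp
    \<comment> \<open>lowering \<open>r\<close> far enough makes the separating functional negative\<close>
    define r where "r = min (- \<gamma> - 1) (- (inner a u0) / b - 1)"
    have "(u0, r) \<in> C" by (rule C0) (auto simp: u0_def r_def)
    moreover have "b * r \<le> b * (- (inner a u0) / b - 1)"
      using b by (intro mult_left_mono) (auto simp: r_def)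
    moreover have "b * (- (inner a u0) / b - 1) = - inner a u0 - b"
      using b by (simp add: field_simps)
    ultimately show False using sep[of u0 r] b by linarith
  qed
  have a: "0 \<le> vec_nth a k" for k
  proof (rule ccontr)
    assume "\<not> 0 \<le> vec_nth a k"
    then have neg: "vec_nth a k < 0" by simp
    define q where "q = inner a u0 + b * (- \<gamma> - 1)"
    \<comment> \<open>raising the \<open>k\<close>-th coordinate of \<open>u\<close> far enough makes the separating functional negative\<close>
    define M where "M = (\<bar>q\<bar> + 1) / - vec_nth a k"
    have M: "0 \<le> M" using neg unfolding M_def by (intro divide_nonneg_pos) auto
    have "(u0 + M *\<^sub>R axis k 1, - \<gamma> - 1) \<in> C"
      using M by (intro C0) (auto simp: u0_def axis_def)
    from sep[OF this] have "0 \<le> q + M * vec_nth a k"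
      by (simp add: q_def inner_add_right inner_axis)
    also have "M * vec_nth a k = - (\<bar>q\<bar> + 1)" using neg by (simp add: M_def)
    finally show False by linarith
  qed
  have "b \<noteq> 0"
  proof
    assume b: "b = 0"
    have "(u0, - \<gamma> - 1) \<in> C" by (rule C0) (auto simp: u0_def)
    from sep[OF this] have "\<rho> * inner a t0 \<le> 0" by (simp add: b u0_def)
    then have "inner a t0 \<le> 0" using \<rho> by (simp add: mult_le_0_iff)
    moreover have "\<forall>k. 0 \<le> vec_nth a k * vec_nth t0 k" using a t0(2) by (simp add: less_imp_le)
    ultimately have "\<forall>k. vec_nth a k * vec_nth t0 k = 0"
      using sum_nonneg_eq_0_iff[of UNIV "\<lambda>k. vec_nth a k * vec_nth t0 k"]
      by (auto simp: inner_vec_sum intro: antisym sum_nonneg)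
    then have "a = 0" using t0(2) by (auto simp: Finite_Cartesian_Product.vec_eq_iff less_le)
    then show False using w(1) wab b by (simp add: zero_prod_def)
  qed
  with \<open>b \<le> 0\<close> have b: "b < 0" by simp
  define l where "l = (1 / - b) *\<^sub>R a"
  show ?thesis
  proof (intro exI[of _ l] conjI ballI)
    show "0 \<le> l" using a b by (simp add: l_def nonneg_vec_iff divide_nonneg_neg)
    fix z :: "real vec" and t assume z: "z \<in> carrier_vec (dim_z D)" and t: "t \<in> ell_T D"
    define u where "u = (\<chi> k. Q k z - \<rho> * vec_nth t k)"
    have "2 * (c \<bullet> z) - \<gamma> \<le> inner l u"
    proof (rule dense_le)
      fix r assume "r < 2 * (c \<bullet> z) - \<gamma>"
      then have "(u, r) \<in> C" by (intro CI[of z t]) (use z t in \<open>auto simp: u_def n_def\<close>)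
      from sep[OF this] have "(- b) * r \<le> inner a u" by simp
      then show "r \<le> inner l u" using b by (simp add: l_def field_simps)
    qed
    also have "inner l u = (\<Sum>k\<in>UNIV. vec_nth l k * Q k z) - \<rho> * inner l t"
      by (simp add: inner_vec_sum u_def right_diff_distrib sum_subtractf sum_distrib_left mult_ac)
    finally show "2 * (c \<bullet> z) \<le> \<gamma> + (\<Sum>k\<in>UNIV. vec_nth l k * (z \<bullet> (ell_S D k *\<^sub>v z))) - \<rho> * inner l t"
      by (simp add: Q_def)
  qed
qed

text \<open>
  Maximising the inequality of the multiplier over \<open>t\<close> produces the support function of \<open>T\<close>. What is left is
  an inequality between a linear and a quadratic form in \<open>z\<close>, that is, the semidefinite constraint with
  \<open>\<alpha> = \<gamma> - \<rho> \<phi>(\<lambda>)\<close>. The converse is weak duality.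
\<close>

lemma ellitope_robust_linear_iff:
  fixes D :: "'k::finite ellitope"
  assumes D: "is_ellitope m D" and \<rho>: "\<rho> > 0" and p: "p \<in> carrier_vec m"
  shows "(\<forall>\<zeta> \<in> ell_set D \<rho>. 2 * (p \<bullet> \<zeta>) \<le> \<gamma>) \<longleftrightarrow>
    (\<exists>l \<alpha>. 0 \<le> l \<and>
       bordered_tl \<alpha> (- (transpose_mat (ell_P D) *\<^sub>v p)) (sum_mat (dim_z D) (\<lambda>k. vec_nth l k \<cdot>\<^sub>m ell_S D k))
         \<in> psd_mats (1 + dim_z D) \<and>
       \<alpha> + \<rho> * phi_T (ell_T D) l \<le> \<gamma>)" (is "?robust \<longleftrightarrow> ?dual")
proof -
  define n where "n = dim_z D"
  note Dd = is_ellitopeD[OF D, folded n_def]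
  note S = Dd(2) and Sc = psd_matsD(2)[OF Dd(2)]
  define c where "c = transpose_mat (ell_P D) *\<^sub>v p"
  have c: "c \<in> carrier_vec n" unfolding c_def using Dd(1) by (intro mult_mat_vec_carrier[OF _ p]) simp
  have pc: "p \<bullet> (ell_P D *\<^sub>v z) = c \<bullet> z" if "z \<in> carrier_vec n" for z
    unfolding c_def by (rule transpose_vec_mult_scalar[OF Dd(1) that p, symmetric])
  have S_psd: "sum_mat n (\<lambda>k. vec_nth l k \<cdot>\<^sub>m ell_S D k) \<in> psd_mats n" if "0 \<le> l" for l
    using that by (intro sum_mat_psd psd_mats_smult S) (simp add: nonneg_vec_iff)
  show ?thesis
  proof
    assume R: ?robust
    have bound: "\<forall>z \<in> carrier_vec (dim_z D). \<forall>t \<in> ell_T D.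
      (\<forall>k. z \<bullet> (ell_S D k *\<^sub>v z) \<le> \<rho> * vec_nth t k) \<longrightarrow> 2 * (c \<bullet> z) \<le> \<gamma>"
    proof (intro ballI impI)
      fix z :: "real vec" and t
      assume z: "z \<in> carrier_vec (dim_z D)" "t \<in> ell_T D"
        "\<forall>k. z \<bullet> (ell_S D k *\<^sub>v z) \<le> \<rho> * vec_nth t k"
      then have "ell_P D *\<^sub>v z \<in> ell_set D \<rho>" by (auto simp: ell_set_def)
      then show "2 * (c \<bullet> z) \<le> \<gamma>" using R pc z(1) by (auto simp: n_def)
    qed
    obtain l where l: "0 \<le> l" "\<forall>z \<in> carrier_vec (dim_z D). \<forall>t \<in> ell_T D.
        2 * (c \<bullet> z) \<le> \<gamma> + (\<Sum>k\<in>UNIV. vec_nth l k * (z \<bullet> (ell_S D k *\<^sub>v z))) - \<rho> * inner l t"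
      using ellitope_dual_multiplier[OF D \<rho> c[unfolded n_def] bound] by blast
    obtain t where t: "t \<in> ell_T D" "phi_T (ell_T D) l = inner l t"
      using phi_T_attained[OF Dd(5,3)] by blast
    have "bordered_tl (\<gamma> - \<rho> * phi_T (ell_T D) l) (- c) (sum_mat n (\<lambda>k. vec_nth l k \<cdot>\<^sub>m ell_S D k))
        \<in> psd_mats (1 + n)"
    proof (rule bordered_tl_psdI[OF S_psd[OF l(1)]])
      fix z :: "real vec" assume z: "z \<in> carrier_vec n"
      show "0 \<le> \<gamma> - \<rho> * phi_T (ell_T D) l + 2 * (- c \<bullet> z)
          + z \<bullet> (sum_mat n (\<lambda>k. vec_nth l k \<cdot>\<^sub>m ell_S D k) *\<^sub>v z)"
        using l(2)[rule_format, OF z[unfolded n_def] t(1)] z c t(2) by (simp add: quad_form_weighted_sum_mat[OF Sc z])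
    qed (use c in simp)
    then show ?dual
      using l(1) unfolding c_def n_def
      by (intro exI[of _ l] exI[of _ "\<gamma> - \<rho> * phi_T (ell_T D) l"]) auto
  next
    assume ?dual
    then obtain l \<alpha> where l: "0 \<le> l" and psd: "bordered_tl \<alpha> (- c)
          (sum_mat n (\<lambda>k. vec_nth l k \<cdot>\<^sub>m ell_S D k)) \<in> psd_mats (1 + n)"
      and \<alpha>: "\<alpha> + \<rho> * phi_T (ell_T D) l \<le> \<gamma>"
      unfolding c_def n_def by blast
    have "2 * (c \<bullet> z) \<le> \<gamma>" if z: "z \<in> carrier_vec n" and t: "t \<in> ell_T D"
        and zt: "\<forall>k. z \<bullet> (ell_S D k *\<^sub>v z) \<le> \<rho> * vec_nth t k" for z t
    proof -
      have mc: "- c \<in> carrier_vec n" using c by simp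
      have "0 \<le> \<alpha> - 2 * (c \<bullet> z) + (\<Sum>k\<in>UNIV. vec_nth l k * (z \<bullet> (ell_S D k *\<^sub>v z)))"
        using psd[unfolded bordered_tl_psd_iff[OF psd_matsD(1)[OF S_psd[OF l]] mc], rule_format, of z 1] z c
        by (simp add: quad_form_weighted_sum_mat[OF Sc z])
      also have "(\<Sum>k\<in>UNIV. vec_nth l k * (z \<bullet> (ell_S D k *\<^sub>v z)))
          \<le> (\<Sum>k\<in>UNIV. vec_nth l k * (\<rho> * vec_nth t k))"
        using zt l by (intro sum_mono mult_left_mono) (auto simp: nonneg_vec_iff)
      also have "\<dots> = \<rho> * inner l t" by (simp add: inner_vec_sum sum_distrib_left mult_ac)
      also have "\<dots> \<le> \<rho> * phi_T (ell_T D) l"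
        using phi_T_upper[OF Dd(5) t] \<rho> by (intro mult_left_mono) auto
      finally show ?thesis using \<alpha> by simp
    qed
    then show ?robust using pc by (auto simp: ell_set_def n_def)
  qed
qed

section \<open>Functions of two vectors with affine components\<close>

text \<open>
  The coefficients are kept explicit, and those of the two arguments separate, because they become the
  entries of the matrices \<open>Z\<close> (which also takes the constant) and \<open>E\<close>.
\<close>

definition affine_fun :: "nat \<Rightarrow> nat \<Rightarrow> (real vec \<Rightarrow> real vec \<Rightarrow> real) \<Rightarrow> bool" where
  "affine_fun n m f \<longleftrightarrow> (\<exists>c d k. \<forall>x \<in> carrier_vec n. \<forall>y \<in> carrier_vec m.
     f x y = (\<Sum>i<n. c i * x $ i) + (\<Sum>j<m. d j * y $ j) + k)"

lemma affine_fun_const: "affine_fun n m (\<lambda>_ _. k)"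
  unfolding affine_fun_def
  by (rule exI[of _ "\<lambda>_. 0"], rule exI[of _ "\<lambda>_. 0"], rule exI[of _ k]) simp

lemma affine_fun_fst: "i < n \<Longrightarrow> affine_fun n m (\<lambda>x _. x $ i)"
  unfolding affine_fun_def
  by (rule exI[of _ "\<lambda>j. if j = i then 1 else 0"], rule exI[of _ "\<lambda>_. 0"], rule exI[of _ 0])
    (simp add: if_distrib[of "\<lambda>c. c * _"] cong: if_cong)

lemma affine_fun_snd: "i < m \<Longrightarrow> affine_fun n m (\<lambda>_ y. y $ i)"
  unfolding affine_fun_def
  by (rule exI[of _ "\<lambda>_. 0"], rule exI[of _ "\<lambda>j. if j = i then 1 else 0"], rule exI[of _ 0])
    (simp add: if_distrib[of "\<lambda>c. c * _"] cong: if_cong)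

lemma affine_fun_add:
  assumes "affine_fun n m f" "affine_fun n m g"
  shows "affine_fun n m (\<lambda>x y. f x y + g x y)"
proof -
  obtain c d k where f: "\<forall>x \<in> carrier_vec n. \<forall>y \<in> carrier_vec m.
      f x y = (\<Sum>i<n. c i * x $ i) + (\<Sum>j<m. d j * y $ j) + k"
    using assms(1) unfolding affine_fun_def by blast
  obtain c' d' k' where g: "\<forall>x \<in> carrier_vec n. \<forall>y \<in> carrier_vec m.
      g x y = (\<Sum>i<n. c' i * x $ i) + (\<Sum>j<m. d' j * y $ j) + k'"
    using assms(2) unfolding affine_fun_def by blast
  show ?thesis
    unfolding affine_fun_def
    by (rule exI[of _ "\<lambda>i. c i + c' i"], rule exI[of _ "\<lambda>j. d j + d' j"], rule exI[of _ "k + k'"])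
      (simp add: f g sum.distrib distrib_right)
qed

lemma affine_fun_cmult:
  assumes "affine_fun n m f"
  shows "affine_fun n m (\<lambda>x y. a * f x y)"
proof -
  obtain c d k where f: "\<forall>x \<in> carrier_vec n. \<forall>y \<in> carrier_vec m.
      f x y = (\<Sum>i<n. c i * x $ i) + (\<Sum>j<m. d j * y $ j) + k"
    using assms(1) unfolding affine_fun_def by blast
  show ?thesis
    unfolding affine_fun_def
    by (rule exI[of _ "\<lambda>i. a * c i"], rule exI[of _ "\<lambda>j. a * d j"], rule exI[of _ "a * k"])
      (simp add: f sum_distrib_left distrib_left mult.assoc)
qed

lemma affine_fun_sum:
  assumes "\<And>i. i \<in> I \<Longrightarrow> affine_fun n m (f i)"
  shows "affine_fun n m (\<lambda>x y. \<Sum>i\<in>I. f i x y)"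
  using assms
  by (induction I rule: infinite_finite_induct) (auto intro: affine_fun_const affine_fun_add)

lemma affine_fun_cong:
  assumes "affine_fun n m g"
    "\<And>x y. x \<in> carrier_vec n \<Longrightarrow> y \<in> carrier_vec m \<Longrightarrow> f x y = g x y"
  shows "affine_fun n m f"
  using assms unfolding affine_fun_def by simp

definition affine_vec :: "nat \<Rightarrow> nat \<Rightarrow> nat \<Rightarrow> (real vec \<Rightarrow> real vec \<Rightarrow> real vec) \<Rightarrow> bool" where
  "affine_vec n m p F \<longleftrightarrow>
     (\<forall>x \<in> carrier_vec n. \<forall>y \<in> carrier_vec m. F x y \<in> carrier_vec p) \<and>
     (\<forall>i<p. affine_fun n m (\<lambda>x y. F x y $ i))"

lemma affine_vecD:
  assumes "affine_vec n m p F"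
  shows "\<And>x y. x \<in> carrier_vec n \<Longrightarrow> y \<in> carrier_vec m \<Longrightarrow> F x y \<in> carrier_vec p"
    "\<And>i. i < p \<Longrightarrow> affine_fun n m (\<lambda>x y. F x y $ i)"
  using assms by (auto simp: affine_vec_def)

lemma affine_vec_const: "v \<in> carrier_vec p \<Longrightarrow> affine_vec n m p (\<lambda>_ _. v)"
  by (simp add: affine_vec_def affine_fun_const)

lemma affine_vec_add:
  assumes F: "affine_vec n m p F" and G: "affine_vec n m p G"
  shows "affine_vec n m p (\<lambda>x y. F x y + G x y)"
  unfolding affine_vec_def
proof (intro conjI ballI allI impI)
  fix i assume i: "i < p"
  show "affine_fun n m (\<lambda>x y. (F x y + G x y) $ i)"
    by (rule affine_fun_cong[OF affine_fun_add[OF affine_vecD(2)[OF F i] affine_vecD(2)[OF G i]]])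
      (use i carrier_vecD[OF affine_vecD(1)[OF G]] in simp)
qed (use affine_vecD(1)[OF F] affine_vecD(1)[OF G] in auto)

lemma affine_vec_mult_mat:
  assumes A: "A \<in> carrier_mat q p" and F: "affine_vec n m p F"
  shows "affine_vec n m q (\<lambda>x y. A *\<^sub>v F x y)"
  unfolding affine_vec_def
proof (intro conjI ballI allI impI)
  fix i assume i: "i < q"
  have "affine_fun n m (\<lambda>x y. \<Sum>j<p. A $$ (i, j) * F x y $ j)"
    by (intro affine_fun_sum affine_fun_cmult affine_vecD(2)[OF F]) auto
  then show "affine_fun n m (\<lambda>x y. (A *\<^sub>v F x y) $ i)"
    by (rule affine_fun_cong) (use mult_mat_vec_index_sum[OF A affine_vecD(1)[OF F] i] in auto)
qed (use mult_mat_vec_carrier[OF A affine_vecD(1)[OF F]] in auto)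

lemma affine_vec_slice_fst: "k + p \<le> n \<Longrightarrow> affine_vec n m p (\<lambda>x _. vslice x k p)"
  by (auto simp: affine_vec_def vslice_def intro: affine_fun_fst)

lemma affine_vec_slice_snd: "k + p \<le> m \<Longrightarrow> affine_vec n m p (\<lambda>_ y. vslice y k p)"
  by (auto simp: affine_vec_def vslice_def intro: affine_fun_snd)

lemma vstack_simps [simp]: "vstack [] = 0\<^sub>v 0" "vstack (v # vs) = v @\<^sub>v vstack vs"
  by (simp_all add: vstack_def)

text \<open>
  All blocks of the stacked vector come from one family \<open>F\<close>, so that the induction over the list of block
  indices covers blocks of different sizes.
\<close>

lemma affine_vec_vstack:
  assumes "\<And>t. t \<in> set ts \<Longrightarrow> affine_vec n m (p t) (F t)"
  shows "affine_vec n m (\<Sum>t\<leftarrow>ts. p t) (\<lambda>x y. vstack (map (\<lambda>t. F t x y) ts))"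
  using assms
proof (induction ts)
  case Nil
  show ?case by (simp add: affine_vec_def)
next
  case (Cons t ts)
  let ?r = "\<Sum>t\<leftarrow>ts. p t" and ?G = "\<lambda>x y. vstack (map (\<lambda>t. F t x y) ts)"
  have Ft: "affine_vec n m (p t) (F t)" and G: "affine_vec n m ?r ?G"
    using Cons by auto
  have "affine_fun n m (\<lambda>x y. (F t x y @\<^sub>v ?G x y) $ i)" if i: "i < p t + ?r" for i
  proof (cases "i < p t")
    case True
    show ?thesis
      by (rule affine_fun_cong[OF affine_vecD(2)[OF Ft True]])
        (use True carrier_vecD[OF affine_vecD(1)[OF Ft]] in simp)
  next
    case False
    then have "i - p t < ?r" using i by auto
    then show ?thesis
      by (rule affine_fun_cong[OF affine_vecD(2)[OF G]])
        (use i False carrier_vecD[OF affine_vecD(1)[OF Ft]] carrier_vecD[OF affine_vecD(1)[OF G]] in simp)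
  qed
  then show ?case
    using affine_vecD(1)[OF Ft] affine_vecD(1)[OF G] by (auto simp: affine_vec_def)
qed

lemma append_one_carrier [simp]: "x \<in> carrier_vec n \<Longrightarrow> append_one x \<in> carrier_vec (n + 1)"
  unfolding append_one_def by (rule append_carrier_vec) auto

lemma sum_append_one:
  assumes "x \<in> carrier_vec n"
  shows "(\<Sum>j<n + 1. c j * append_one x $ j) = (\<Sum>j<n. c j * x $ j) + c n"
  using assms by (simp add: append_one_def)

lemma mult_append_one_index:
  assumes "Z \<in> carrier_mat p (n + 1)" "x \<in> carrier_vec n" "i < p"
  shows "(Z *\<^sub>v append_one x) $ i = (\<Sum>j<n. Z $$ (i, j) * x $ j) + Z $$ (i, n)"
  using mult_mat_vec_index_sum[OF assms(1) append_one_carrier[OF assms(2)] assms(3)]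
    sum_append_one[OF assms(2), of "\<lambda>j. Z $$ (i, j)"] by simp

lemma affine_vec_matrices:
  assumes F: "affine_vec n m p F"
  shows "\<exists>Z \<in> carrier_mat p (n + 1). \<exists>E \<in> carrier_mat p m.
    \<forall>x \<in> carrier_vec n. \<forall>y \<in> carrier_vec m. F x y = Z *\<^sub>v append_one x + E *\<^sub>v y"
proof -
  have "\<forall>i. \<exists>c d k. i < p \<longrightarrow> (\<forall>x \<in> carrier_vec n. \<forall>y \<in> carrier_vec m.
      F x y $ i = (\<Sum>j<n. c j * x $ j) + (\<Sum>j<m. d j * y $ j) + k)"
    using affine_vecD(2)[OF F] unfolding affine_fun_def by blast
  then obtain c d k where F_eq: "\<forall>i. i < p \<longrightarrow> (\<forall>x \<in> carrier_vec n. \<forall>y \<in> carrier_vec m.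
      F x y $ i = (\<Sum>j<n. c i j * x $ j) + (\<Sum>j<m. d i j * y $ j) + k i)"
    by metis
  define Z where "Z = mat p (n + 1) (\<lambda>(i, j). if j < n then c i j else k i)"
  define E where "E = mat p m (\<lambda>(i, j). d i j)"
  have Zc: "Z \<in> carrier_mat p (n + 1)" and Ec: "E \<in> carrier_mat p m"
    by (simp_all add: Z_def E_def)
  have "F x y = Z *\<^sub>v append_one x + E *\<^sub>v y" if x: "x \<in> carrier_vec n" and y: "y \<in> carrier_vec m" for x y
  proof (rule eq_vecI)
    have cE: "E *\<^sub>v y \<in> carrier_vec p" by (rule mult_mat_vec_carrier[OF Ec y])
    show "dim_vec (F x y) = dim_vec (Z *\<^sub>v append_one x + E *\<^sub>v y)"
      using affine_vecD(1)[OF F x y] Ec by simp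
    fix i assume "i < dim_vec (Z *\<^sub>v append_one x + E *\<^sub>v y)"
    then have i: "i < p" using Ec by simp
    have "(Z *\<^sub>v append_one x) $ i = (\<Sum>j<n. c i j * x $ j) + k i"
      unfolding mult_append_one_index[OF Zc x i] using i by (simp add: Z_def)
    moreover have "(E *\<^sub>v y) $ i = (\<Sum>j<m. d i j * y $ j)"
      unfolding mult_mat_vec_index_sum[OF Ec y i] using i by (simp add: E_def)
    moreover have "(Z *\<^sub>v append_one x + E *\<^sub>v y) $ i = (Z *\<^sub>v append_one x) $ i + (E *\<^sub>v y) $ i"
      by (rule index_add_vec(1)) (use carrier_vecD[OF cE] i in simp)
    ultimately show "F x y $ i = (Z *\<^sub>v append_one x + E *\<^sub>v y) $ i"
      using F_eq i x y by simp
  qed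
  then show ?thesis using Zc Ec by blast
qed

text \<open>
  The argument 0 determines the last column, and then the unit vectors determine the others.
\<close>

lemma mat_eq_on_append_one:
  assumes Z: "Z \<in> carrier_mat p (n + 1)" and Z': "Z' \<in> carrier_mat p (n + 1)"
    and eq: "\<And>x. x \<in> carrier_vec n \<Longrightarrow> Z *\<^sub>v append_one x = Z' *\<^sub>v append_one (x :: real vec)"
  shows "Z = Z'"
proof (rule eq_matI)
  have ix: "(\<Sum>j<n. Z $$ (i, j) * x $ j) + Z $$ (i, n) = (\<Sum>j<n. Z' $$ (i, j) * x $ j) + Z' $$ (i, n)"
    if "i < p" "x \<in> carrier_vec n" for i x
    using mult_append_one_index[OF Z that(2,1)] mult_append_one_index[OF Z' that(2,1)] eq[OF that(2)] by simp
  fix i j assume "i < dim_row Z'" "j < dim_col Z'"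
  then have i: "i < p" and j: "j < n + 1" using Z' by auto
  have last: "Z $$ (i, n) = Z' $$ (i, n)" using ix[OF i, of "0\<^sub>v n"] by simp
  show "Z $$ (i, j) = Z' $$ (i, j)"
  proof (cases "j < n")
    case True
    then have "(\<Sum>l<n. M $$ (i, l) * unit_vec n j $ l) = M $$ (i, j)" for M :: "real mat"
      by (simp add: unit_vec_def if_distrib[of "(*) _"] cong: if_cong)
    then show ?thesis using ix[OF i, of "unit_vec n j"] last by simp
  next
    case False
    then show ?thesis using j last by (simp add: less_Suc_eq)
  qed
qed (use Z Z' in auto)

lemma mat_eq_on_vec:
  assumes E: "E \<in> carrier_mat p m" and E': "E' \<in> carrier_mat p m"
    and eq: "\<And>y. y \<in> carrier_vec m \<Longrightarrow> E *\<^sub>v y = E' *\<^sub>v (y :: real vec)"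
  shows "E = E'"
proof (rule eq_matI)
  fix i j assume "i < dim_row E'" "j < dim_col E'"
  then have i: "i < p" and j: "j < m" using E' by auto
  have "(\<Sum>l<m. M $$ (i, l) * unit_vec m j $ l) = M $$ (i, j)" for M :: "real mat"
    using j by (simp add: unit_vec_def if_distrib[of "(*) _"] cong: if_cong)
  then show "E $$ (i, j) = E' $$ (i, j)"
    using mult_mat_vec_index_sum[OF E unit_vec_carrier i, of j] mult_mat_vec_index_sum[OF E' unit_vec_carrier i, of j]
      eq[of "unit_vec m j"] by simp
qed (use E E' in auto)

section \<open>The trajectory as an affine function of the disturbances\<close>

lemma is_lin_sysD:
  assumes "is_lin_sys s" "t < horizon s"
  shows "mA s t \<in> carrier_mat (dim_x s) (dim_x s)" "mB s t \<in> carrier_mat (dim_x s) (dim_u s)"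
    "mBd s t \<in> carrier_mat (dim_x s) (dim_d s t)" "mBs s t \<in> carrier_mat (dim_x s) (dim_e s t)"
    "mC s t \<in> carrier_mat (dim_y s) (dim_x s)" "mDd s t \<in> carrier_mat (dim_y s) (dim_d s t)"
    "mDs s t \<in> carrier_mat (dim_y s) (dim_e s t)"
  using assms by (auto simp: is_lin_sys_def)

lemma pob_paramsD:
  assumes "chi \<in> pob_params s" "t < horizon s"
  shows "pob_h chi t \<in> carrier_vec (dim_u s)" "\<And>j. j \<le> t \<Longrightarrow> pob_H chi t j \<in> carrier_mat (dim_u s) (dim_y s)"
  using assms by (auto simp: pob_params_def)

lemma disturbance_carrier [simp]:
  "init_z s \<zeta> \<in> carrier_vec (dim_x s)" "init_s s \<epsilon> \<in> carrier_vec (dim_x s)"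
  "dist_d s \<zeta> t \<in> carrier_vec (dim_d s t)" "dist_e s \<epsilon> t \<in> carrier_vec (dim_e s t)"
  by (simp_all add: init_z_def init_s_def dist_d_def dist_e_def vslice_def)

lemma sum_segment_le:
  fixes f :: "nat \<Rightarrow> nat"
  assumes "t < N"
  shows "(\<Sum>i<t. f i) + f t \<le> (\<Sum>i<N. f i)"
proof -
  have "(\<Sum>i<Suc t. f i) \<le> (\<Sum>i<N. f i)" using assms by (intro sum_mono2) auto
  then show ?thesis by simp
qed

lemma affine_vec_disturbance:
  "affine_vec (n_zeta s) (n_eps s) (dim_x s) (\<lambda>\<zeta> _. init_z s \<zeta>)"
  "affine_vec (n_zeta s) (n_eps s) (dim_x s) (\<lambda>_ \<epsilon>. init_s s \<epsilon>)"
  "t < horizon s \<Longrightarrow> affine_vec (n_zeta s) (n_eps s) (dim_d s t) (\<lambda>\<zeta> _. dist_d s \<zeta> t)"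
  "t < horizon s \<Longrightarrow> affine_vec (n_zeta s) (n_eps s) (dim_e s t) (\<lambda>_ \<epsilon>. dist_e s \<epsilon> t)"
  using sum_segment_le[of t "horizon s" "dim_d s"] sum_segment_le[of t "horizon s" "dim_e s"]
  unfolding init_z_def init_s_def dist_d_def dist_e_def
  by (auto intro!: affine_vec_slice_fst affine_vec_slice_snd simp: n_zeta_def n_eps_def)

lemma affine_vec_state:
  assumes s: "is_lin_sys s" and "t \<le> horizon s"
    and "\<And>i. i < t \<Longrightarrow> affine_vec (n_zeta s) (n_eps s) (dim_u s) (\<lambda>\<zeta> \<epsilon>. u \<zeta> \<epsilon> i)"
  shows "affine_vec (n_zeta s) (n_eps s) (dim_x s) (\<lambda>\<zeta> \<epsilon>. state s (u \<zeta> \<epsilon>) \<zeta> \<epsilon> t)"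
  using assms(2,3)
proof (induction t)
  case 0
  show ?case by (simp add: affine_vec_add affine_vec_disturbance)
next
  case (Suc t)
  then have t: "t < horizon s" by simp
  show ?case
    using Suc t unfolding state.simps
    by (intro affine_vec_add affine_vec_mult_mat[OF is_lin_sysD(1)[OF s t]]
        affine_vec_mult_mat[OF is_lin_sysD(2)[OF s t]] affine_vec_mult_mat[OF is_lin_sysD(3)[OF s t]]
        affine_vec_mult_mat[OF is_lin_sysD(4)[OF s t]] affine_vec_disturbance) auto
qed

lemma state_carrier:
  assumes "is_lin_sys s" "t \<le> horizon s"
  shows "state s u \<zeta> \<epsilon> t \<in> carrier_vec (dim_x s)"
  using assms(2)
proof (induction t)
  case (Suc t)
  have "mB s t *\<^sub>v u t \<in> carrier_vec (dim_x s)"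
    using is_lin_sysD(2)[OF assms(1), of t] Suc.prems by (intro carrier_vecI) simp
  then show ?case using Suc is_lin_sysD[OF assms(1), of t] by (auto intro!: add_carrier_vec mult_mat_vec_carrier)
qed simp

lemma model_state_carrier:
  assumes "is_lin_sys s" "t \<le> horizon s"
  shows "model_state s u t \<in> carrier_vec (dim_x s)"
  using assms(2)
proof (induction t)
  case (Suc t)
  have "mB s t *\<^sub>v u t \<in> carrier_vec (dim_x s)"
    using is_lin_sysD(2)[OF assms(1), of t] Suc.prems by (intro carrier_vecI) simp
  then show ?case using Suc is_lin_sysD[OF assms(1), of t] by (auto intro!: add_carrier_vec mult_mat_vec_carrier)
qed simp

lemma vec_regroup:
  fixes a b c d e :: "real vec"
  assumes "a \<in> carrier_vec n" "b \<in> carrier_vec n" "c \<in> carrier_vec n" "d \<in> carrier_vec n" "e \<in> carrier_vec n"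
  shows "a + b + c + d + e = a + 0\<^sub>v n + d + e + (b + c)" "a + b + d + e - b = a + d + e"
  using assms by (auto intro!: eq_vecI)

lemma vec_add_left_cancel:
  fixes a b c :: "real vec"
  assumes eq: "c + a = c + b" and "a \<in> carrier_vec n" "b \<in> carrier_vec n" "c \<in> carrier_vec n"
  shows "a = b"
proof (rule eq_vecI)
  fix i assume "i < dim_vec b"
  moreover have "(c + a) $ i = (c + b) $ i" by (simp only: eq)
  ultimately show "a $ i = b $ i" using assms(2-4) by simp
qed (use assms in auto)

abbreviation zero_controls :: "lin_sys \<Rightarrow> nat \<Rightarrow> real vec" where
  "zero_controls s \<equiv> \<lambda>_. 0\<^sub>v (dim_u s)"

text \<open>
  Superposition: the controls enter the plant and the model through the same matrices, so their effect on
  the state is exactly the model state.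
\<close>

lemma state_eq_uncontrolled_plus_model:
  assumes s: "is_lin_sys s" and "t \<le> horizon s" and u: "\<And>i. u i \<in> carrier_vec (dim_u s)"
  shows "state s u \<zeta> \<epsilon> t = state s (zero_controls s) \<zeta> \<epsilon> t + model_state s u t"
  using assms(2)
proof (induction t)
  case 0
  show ?case by (intro eq_vecI) (auto simp: carrier_vecD[OF disturbance_carrier(2)])
next
  case (Suc t)
  then have t: "t < horizon s" by simp
  note M = is_lin_sysD[OF s t]
  define x where "x = state s (zero_controls s) \<zeta> \<epsilon> t"
  define y where "y = model_state s u t"
  have x: "x \<in> carrier_vec (dim_x s)" and y: "y \<in> carrier_vec (dim_x s)"
    using state_carrier[OF s, of t] model_state_carrier[OF s, of t] t by (auto simp: x_def y_def)
  have c: "mA s t *\<^sub>v x \<in> carrier_vec (dim_x s)" "mA s t *\<^sub>v y \<in> carrier_vec (dim_x s)"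
    "mB s t *\<^sub>v u t \<in> carrier_vec (dim_x s)" "mBd s t *\<^sub>v dist_d s \<zeta> t \<in> carrier_vec (dim_x s)"
    "mBs s t *\<^sub>v dist_e s \<epsilon> t \<in> carrier_vec (dim_x s)"
    using mult_mat_vec_carrier[OF M(1) x] mult_mat_vec_carrier[OF M(1) y] mult_mat_vec_carrier[OF M(2) u]
      mult_mat_vec_carrier[OF M(3)] mult_mat_vec_carrier[OF M(4)] by auto
  have 0: "mB s t *\<^sub>v 0\<^sub>v (dim_u s) = 0\<^sub>v (dim_x s)" using M(2) by (intro eq_vecI) auto
  have "state s u \<zeta> \<epsilon> t = x + y" using Suc by (simp add: x_def y_def)
  then have "state s u \<zeta> \<epsilon> (Suc t) = mA s t *\<^sub>v x + mA s t *\<^sub>v y + mB s t *\<^sub>v u t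
      + mBd s t *\<^sub>v dist_d s \<zeta> t + mBs s t *\<^sub>v dist_e s \<epsilon> t"
    using mult_add_distrib_mat_vec[OF M(1) x y] by simp
  also have "\<dots> = mA s t *\<^sub>v x + 0\<^sub>v (dim_x s) + mBd s t *\<^sub>v dist_d s \<zeta> t + mBs s t *\<^sub>v dist_e s \<epsilon> t
      + (mA s t *\<^sub>v y + mB s t *\<^sub>v u t)"
    by (rule vec_regroup(1)) (use c in auto)
  finally show ?case by (simp add: 0 x_def y_def)
qed

lemma purified_eq_uncontrolled_output:
  assumes s: "is_lin_sys s" and t: "t < horizon s" and u: "\<And>i. u i \<in> carrier_vec (dim_u s)"
  shows "purified s u \<zeta> \<epsilon> t = output_y s (zero_controls s) \<zeta> \<epsilon> t"
proof -
  note M = is_lin_sysD[OF s t]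
  define x where "x = state s (zero_controls s) \<zeta> \<epsilon> t"
  define y where "y = model_state s u t"
  have x: "x \<in> carrier_vec (dim_x s)" and y: "y \<in> carrier_vec (dim_x s)"
    using state_carrier[OF s, of t] model_state_carrier[OF s, of t] t by (auto simp: x_def y_def)
  have c: "mC s t *\<^sub>v x \<in> carrier_vec (dim_y s)" "mC s t *\<^sub>v y \<in> carrier_vec (dim_y s)"
    "mDd s t *\<^sub>v dist_d s \<zeta> t \<in> carrier_vec (dim_y s)"
    "mDs s t *\<^sub>v dist_e s \<epsilon> t \<in> carrier_vec (dim_y s)"
    using mult_mat_vec_carrier[OF M(5) x] mult_mat_vec_carrier[OF M(5) y]
      mult_mat_vec_carrier[OF M(6)] mult_mat_vec_carrier[OF M(7)] by auto
  have "state s u \<zeta> \<epsilon> t = x + y"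
    unfolding x_def y_def by (rule state_eq_uncontrolled_plus_model) (use s t u in auto)
  then have "purified s u \<zeta> \<epsilon> t = mC s t *\<^sub>v x + mC s t *\<^sub>v y + mDd s t *\<^sub>v dist_d s \<zeta> t
      + mDs s t *\<^sub>v dist_e s \<epsilon> t - mC s t *\<^sub>v y"
    using mult_add_distrib_mat_vec[OF M(5) x y] by (simp add: purified_def output_y_def y_def)
  also have "\<dots> = mC s t *\<^sub>v x + mDd s t *\<^sub>v dist_d s \<zeta> t + mDs s t *\<^sub>v dist_e s \<epsilon> t"
    by (rule vec_regroup(2)) (use c in auto)
  finally show ?thesis by (simp add: output_y_def x_def)
qed

lemma controls_upto_carrier: "controls_upto s chi \<zeta> \<epsilon> t i \<in> carrier_vec (dim_u s)"
  by (induction t arbitrary: i) (auto simp: Let_def pob_law_def)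

text \<open>
  This removes the feedback loop: the controls are an explicit affine function of outputs that no control
  influences.
\<close>

lemma controls_eq:
  assumes s: "is_lin_sys s" and t: "t < horizon s"
  shows "controls s chi \<zeta> \<epsilon> t = pob_law s chi (output_y s (zero_controls s) \<zeta> \<epsilon>) t"
proof -
  have "purified s (controls s chi \<zeta> \<epsilon>) \<zeta> \<epsilon> i = output_y s (zero_controls s) \<zeta> \<epsilon> i" if "i \<le> t" for i
    by (rule purified_eq_uncontrolled_output) (use s t that controls_upto_carrier in \<open>auto simp: controls_def\<close>)
  then show ?thesis
    unfolding controls_law[OF t] pob_law_def by (intro arg_cong[where f = "vec (dim_u s)"] ext) simp
qed

lemma output_y_carrier:
  assumes s: "is_lin_sys s" and t: "t < horizon s"
  shows "output_y s u \<zeta> \<epsilon> t \<in> carrier_vec (dim_y s)"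
  unfolding output_y_def
  using is_lin_sysD[OF s t] state_carrier[OF s, of t] t
  by (auto intro!: add_carrier_vec mult_mat_vec_carrier)

lemma affine_vec_controls:
  assumes s: "is_lin_sys s" and chi: "chi \<in> pob_params s" and t: "t < horizon s"
  shows "affine_vec (n_zeta s) (n_eps s) (dim_u s) (\<lambda>\<zeta> \<epsilon>. controls s chi \<zeta> \<epsilon> t)"
proof -
  have y: "affine_vec (n_zeta s) (n_eps s) (dim_y s) (\<lambda>\<zeta> \<epsilon>. output_y s (zero_controls s) \<zeta> \<epsilon> i)"
    if "i < horizon s" for i
    unfolding output_y_def using that s
    by (intro affine_vec_add affine_vec_mult_mat[OF is_lin_sysD(5)[OF s that]]
        affine_vec_mult_mat[OF is_lin_sysD(6)[OF s that]] affine_vec_mult_mat[OF is_lin_sysD(7)[OF s that]]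
        affine_vec_disturbance affine_vec_state affine_vec_const) auto
  have "affine_fun (n_zeta s) (n_eps s) (\<lambda>\<zeta> \<epsilon>. pob_h chi t $ r
      + (\<Sum>i\<le>t. (pob_H chi t i *\<^sub>v output_y s (zero_controls s) \<zeta> \<epsilon> i) $ r))" if r: "r < dim_u s" for r
    by (intro affine_fun_add affine_fun_const affine_fun_sum affine_vecD(2)[OF _ r]
        affine_vec_mult_mat[OF pob_paramsD(2)[OF chi t]] y) (use t in auto)
  then show ?thesis
    by (simp add: affine_vec_def controls_eq[OF s t] pob_law_def)
qed

text \<open>
  States and controls are indexed together by a sum type, to have a single family of blocks.
\<close>

lemma traj_eq:
  "traj s chi \<zeta> \<epsilon> = vstack (map (case_sum (state s (controls s chi \<zeta> \<epsilon>) \<zeta> \<epsilon>) (controls s chi \<zeta> \<epsilon>))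
     (map Inl [1..<Suc (horizon s)] @ map Inr [0..<horizon s]))"
  by (simp add: traj_def Let_def o_def)

lemma affine_vec_traj:
  assumes s: "is_lin_sys s" and chi: "chi \<in> pob_params s"
  shows "affine_vec (n_zeta s) (n_eps s) (n_w s) (traj s chi)"
proof -
  let ?ts = "map Inl [1..<Suc (horizon s)] @ map Inr [0..<horizon s]"
  let ?p = "case_sum (\<lambda>_. dim_x s) (\<lambda>_. dim_u s) :: nat + nat \<Rightarrow> nat"
  let ?F = "\<lambda>t \<zeta> \<epsilon>. case_sum (state s (controls s chi \<zeta> \<epsilon>) \<zeta> \<epsilon>) (controls s chi \<zeta> \<epsilon>) t"
  have "affine_vec (n_zeta s) (n_eps s) (\<Sum>t\<leftarrow>?ts. ?p t) (\<lambda>\<zeta> \<epsilon>. vstack (map (\<lambda>t. ?F t \<zeta> \<epsilon>) ?ts))"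
  proof (rule affine_vec_vstack)
    fix t assume "t \<in> set ?ts"
    then show "affine_vec (n_zeta s) (n_eps s) (?p t) (?F t)"
      by (auto intro!: affine_vec_state affine_vec_controls s chi)
  qed
  moreover have "(\<Sum>t\<leftarrow>?ts. ?p t) = n_w s"
    by (simp add: n_w_def o_def sum_list_triv algebra_simps)
  ultimately show ?thesis
    by (simp add: traj_eq[abs_def])
qed

lemma represents_traj_unique:
  assumes "represents_traj s chi Z E" "represents_traj s chi Z' E'"
  shows "Z = Z'" "E = E'"
proof -
  have c: "Z \<in> carrier_mat (n_w s) (n_zeta s + 1)" "Z' \<in> carrier_mat (n_w s) (n_zeta s + 1)"
    "E \<in> carrier_mat (n_w s) (n_eps s)" "E' \<in> carrier_mat (n_w s) (n_eps s)"
    and eq: "\<And>\<zeta> \<epsilon>. \<zeta> \<in> carrier_vec (n_zeta s) \<Longrightarrow> \<epsilon> \<in> carrier_vec (n_eps s) \<Longrightarrow>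
      Z *\<^sub>v append_one \<zeta> + E *\<^sub>v \<epsilon> = Z' *\<^sub>v append_one \<zeta> + E' *\<^sub>v \<epsilon>"
    using assms by (auto simp: represents_traj_def)
  have 0: "M *\<^sub>v 0\<^sub>v (n_eps s) = 0\<^sub>v (n_w s)" if "M \<in> carrier_mat (n_w s) (n_eps s)" for M :: "real mat"
    using that by (intro eq_vecI) auto
  have Zc: "M *\<^sub>v append_one \<zeta> \<in> carrier_vec (n_w s)"
    if "M \<in> carrier_mat (n_w s) (n_zeta s + 1)" "\<zeta> \<in> carrier_vec (n_zeta s)" for M \<zeta>
    by (rule mult_mat_vec_carrier[OF that(1) append_one_carrier[OF that(2)]])
  show ZZ: "Z = Z'"
  proof (rule mat_eq_on_append_one[OF c(1,2)])
    fix \<zeta> :: "real vec" assume \<zeta>: "\<zeta> \<in> carrier_vec (n_zeta s)"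
    show "Z *\<^sub>v append_one \<zeta> = Z' *\<^sub>v append_one \<zeta>"
      using eq[OF \<zeta>, of "0\<^sub>v (n_eps s)"] 0[OF c(3)] 0[OF c(4)] Zc[OF c(1) \<zeta>] Zc[OF c(2) \<zeta>] by simp
  qed
  show "E = E'"
  proof (rule mat_eq_on_vec[OF c(3,4)])
    fix \<epsilon> :: "real vec" assume \<epsilon>: "\<epsilon> \<in> carrier_vec (n_eps s)"
    have "Z *\<^sub>v append_one (0\<^sub>v (n_zeta s)) \<in> carrier_vec (n_w s)" by (rule Zc[OF c(1)]) simp
    moreover have "E *\<^sub>v \<epsilon> \<in> carrier_vec (n_w s)" "E' *\<^sub>v \<epsilon> \<in> carrier_vec (n_w s)"
      using mult_mat_vec_carrier[OF c(3) \<epsilon>] mult_mat_vec_carrier[OF c(4) \<epsilon>] by auto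
    ultimately show "E *\<^sub>v \<epsilon> = E' *\<^sub>v \<epsilon>"
      using vec_add_left_cancel[OF eq[OF zero_carrier_vec \<epsilon>, unfolded ZZ]] ZZ by simp
  qed
qed

lemma represents_traj_matZ_matE:
  assumes s: "is_lin_sys s" and chi: "chi \<in> pob_params s"
  shows "represents_traj s chi (matZ s chi) (matE s chi)"
proof -
  obtain Z E where r: "represents_traj s chi Z E"
    using affine_vec_matrices[OF affine_vec_traj[OF s chi]] unfolding represents_traj_def by blast
  have "matZ s chi = Z" unfolding matZ_def
    by (rule the_equality) (use r represents_traj_unique in blast)+
  moreover have "matE s chi = E" unfolding matE_def
    by (rule the_equality) (use r represents_traj_unique in blast)+
  ultimately show ?thesis using r by simp
qed

section \<open>Affine dependence of the trajectory on the control law\<close>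

text \<open>
  The parameters of a componentwise convex combination \<open>fvars_mix\<close> of decision variables.
\<close>

definition pob_mix :: "real \<Rightarrow> pob \<Rightarrow> pob \<Rightarrow> pob" where
  "pob_mix \<theta> a b = \<lparr>pob_h = (\<lambda>t. (1 - \<theta>) \<cdot>\<^sub>v pob_h a t + \<theta> \<cdot>\<^sub>v pob_h b t),
     pob_H = (\<lambda>t j. (1 - \<theta>) \<cdot>\<^sub>m pob_H a t j + \<theta> \<cdot>\<^sub>m pob_H b t j)\<rparr>"

lemma pob_mix_params:
  "a \<in> pob_params s \<Longrightarrow> b \<in> pob_params s \<Longrightarrow> pob_mix \<theta> a b \<in> pob_params s"
  by (auto simp: pob_params_def pob_mix_def)

lemma mix_mat_mult_vec:
  fixes A B :: "real mat"
  assumes "A \<in> carrier_mat p q" "B \<in> carrier_mat p q" "v \<in> carrier_vec q"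
  shows "((1 - \<theta>) \<cdot>\<^sub>m A + \<theta> \<cdot>\<^sub>m B) *\<^sub>v v = (1 - \<theta>) \<cdot>\<^sub>v (A *\<^sub>v v) + \<theta> \<cdot>\<^sub>v (B *\<^sub>v v)"
  using assms by (simp add: add_mult_distrib_mat_vec[of _ p q] smult_mat_mult_vec[of _ p q])

lemma mult_mat_vec_mix:
  fixes A :: "real mat"
  assumes "A \<in> carrier_mat p q" "v \<in> carrier_vec q" "w \<in> carrier_vec q"
  shows "A *\<^sub>v ((1 - \<theta>) \<cdot>\<^sub>v v + \<theta> \<cdot>\<^sub>v w) = (1 - \<theta>) \<cdot>\<^sub>v (A *\<^sub>v v) + \<theta> \<cdot>\<^sub>v (A *\<^sub>v w)"
  using assms by (simp add: mult_add_distrib_mat_vec[of _ p q] mult_mat_vec[of _ p q])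

lemma pob_law_mix:
  assumes a: "a \<in> pob_params s" and b: "b \<in> pob_params s" and t: "t < horizon s"
    and v: "\<And>i. i \<le> t \<Longrightarrow> v i \<in> carrier_vec (dim_y s)"
  shows "pob_law s (pob_mix \<theta> a b) v t = (1 - \<theta>) \<cdot>\<^sub>v pob_law s a v t + \<theta> \<cdot>\<^sub>v pob_law s b v t"
proof (rule eq_vecI)
  fix r assume "r < dim_vec ((1 - \<theta>) \<cdot>\<^sub>v pob_law s a v t + \<theta> \<cdot>\<^sub>v pob_law s b v t)"
  then have r: "r < dim_u s" by (simp add: pob_law_def)
  note ha = pob_paramsD(1)[OF a t] and hb = pob_paramsD(1)[OF b t]
  have "(pob_H (pob_mix \<theta> a b) t i *\<^sub>v v i) $ r
      = (1 - \<theta>) * (pob_H a t i *\<^sub>v v i) $ r + \<theta> * (pob_H b t i *\<^sub>v v i) $ r" if i: "i \<le> t" for i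
  proof -
    note Ha = pob_paramsD(2)[OF a t i] and Hb = pob_paramsD(2)[OF b t i]
    have "pob_H (pob_mix \<theta> a b) t i *\<^sub>v v i = (1 - \<theta>) \<cdot>\<^sub>v (pob_H a t i *\<^sub>v v i) + \<theta> \<cdot>\<^sub>v (pob_H b t i *\<^sub>v v i)"
      using mix_mat_mult_vec[OF Ha Hb v[OF i]] by (simp add: pob_mix_def)
    then show ?thesis
      using r carrier_vecD[OF mult_mat_vec_carrier[OF Ha v[OF i]]]
        carrier_vecD[OF mult_mat_vec_carrier[OF Hb v[OF i]]] by (simp del: index_mult_mat_vec)
  qed
  then have "(\<Sum>i\<le>t. (pob_H (pob_mix \<theta> a b) t i *\<^sub>v v i) $ r)
      = (1 - \<theta>) * (\<Sum>i\<le>t. (pob_H a t i *\<^sub>v v i) $ r) + \<theta> * (\<Sum>i\<le>t. (pob_H b t i *\<^sub>v v i) $ r)"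
    by (simp add: sum.distrib sum_distrib_left)
  moreover have "pob_h (pob_mix \<theta> a b) t $ r = (1 - \<theta>) * pob_h a t $ r + \<theta> * pob_h b t $ r"
    using ha hb r by (simp add: pob_mix_def)
  ultimately show "pob_law s (pob_mix \<theta> a b) v t $ r
      = ((1 - \<theta>) \<cdot>\<^sub>v pob_law s a v t + \<theta> \<cdot>\<^sub>v pob_law s b v t) $ r"
    using r by (simp add: pob_law_def algebra_simps del: index_mult_mat_vec)
qed (simp add: pob_law_def)

lemma controls_mix:
  assumes s: "is_lin_sys s" and a: "a \<in> pob_params s" and b: "b \<in> pob_params s" and t: "t < horizon s"
  shows "controls s (pob_mix \<theta> a b) \<zeta> \<epsilon> t = (1 - \<theta>) \<cdot>\<^sub>v controls s a \<zeta> \<epsilon> t + \<theta> \<cdot>\<^sub>v controls s b \<zeta> \<epsilon> t"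
  unfolding controls_eq[OF s t]
  by (rule pob_law_mix[OF a b t]) (use output_y_carrier[OF s] t in auto)

lemma mix_regroup:
  fixes a a' b b' d e :: "real vec"
  assumes "a \<in> carrier_vec n" "a' \<in> carrier_vec n" "b \<in> carrier_vec n" "b' \<in> carrier_vec n"
    "d \<in> carrier_vec n" "e \<in> carrier_vec n"
  shows "((1 - \<theta>) \<cdot>\<^sub>v a + \<theta> \<cdot>\<^sub>v a') + ((1 - \<theta>) \<cdot>\<^sub>v b + \<theta> \<cdot>\<^sub>v b') + d + e
    = (1 - \<theta>) \<cdot>\<^sub>v (a + b + d + e) + \<theta> \<cdot>\<^sub>v (a' + b' + d + e)"
  using assms by (auto intro!: eq_vecI simp: algebra_simps)

lemma state_mix:
  assumes s: "is_lin_sys s" and "t \<le> horizon s"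
    and u: "\<And>i. u i \<in> carrier_vec (dim_u s)" and u': "\<And>i. u' i \<in> carrier_vec (dim_u s)"
    and mix: "\<And>i. i < t \<Longrightarrow> u'' i = (1 - \<theta>) \<cdot>\<^sub>v u i + \<theta> \<cdot>\<^sub>v u' i"
  shows "state s u'' \<zeta> \<epsilon> t = (1 - \<theta>) \<cdot>\<^sub>v state s u \<zeta> \<epsilon> t + \<theta> \<cdot>\<^sub>v state s u' \<zeta> \<epsilon> t"
  using assms(2) mix
proof (induction t)
  case 0
  show ?case by (intro eq_vecI) (auto simp: algebra_simps)
next
  case (Suc t)
  then have t: "t < horizon s" by simp
  note M = is_lin_sysD[OF s t]
  define x where "x = state s u \<zeta> \<epsilon> t"
  define x' where "x' = state s u' \<zeta> \<epsilon> t"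
  have x: "x \<in> carrier_vec (dim_x s)" and x': "x' \<in> carrier_vec (dim_x s)"
    using state_carrier[OF s] t by (auto simp: x_def x'_def)
  have IH: "state s u'' \<zeta> \<epsilon> t = (1 - \<theta>) \<cdot>\<^sub>v x + \<theta> \<cdot>\<^sub>v x'"
    unfolding x_def x'_def by (rule Suc.IH) (use Suc.prems in auto)
  have "u'' t = (1 - \<theta>) \<cdot>\<^sub>v u t + \<theta> \<cdot>\<^sub>v u' t" using Suc.prems by simp
  then show ?case
    by (simp add: IH mult_mat_vec_mix[OF M(1) x x'] mult_mat_vec_mix[OF M(2) u u'] flip: x_def x'_def)
      (rule mix_regroup[of _ "dim_x s"], use mult_mat_vec_carrier[OF M(1) x] mult_mat_vec_carrier[OF M(1) x']
        mult_mat_vec_carrier[OF M(2) u] mult_mat_vec_carrier[OF M(2) u'] mult_mat_vec_carrier[OF M(3)]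
        mult_mat_vec_carrier[OF M(4)] in auto)
qed

lemma vstack_mix:
  assumes "\<And>t. t \<in> set ts \<Longrightarrow> dim_vec (f t) = dim_vec (g t)"
  shows "dim_vec (vstack (map f ts)) = dim_vec (vstack (map g ts)) \<and>
    vstack (map (\<lambda>t. (1 - \<theta>) \<cdot>\<^sub>v f t + \<theta> \<cdot>\<^sub>v g t) ts) = (1 - \<theta>) \<cdot>\<^sub>v vstack (map f ts) + \<theta> \<cdot>\<^sub>v vstack (map g ts)"
  using assms by (induction ts) (auto intro!: eq_vecI)

lemma traj_mix:
  assumes s: "is_lin_sys s" and a: "a \<in> pob_params s" and b: "b \<in> pob_params s"
  shows "traj s (pob_mix \<theta> a b) \<zeta> \<epsilon> = (1 - \<theta>) \<cdot>\<^sub>v traj s a \<zeta> \<epsilon> + \<theta> \<cdot>\<^sub>v traj s b \<zeta> \<epsilon>"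
proof -
  let ?ts = "map Inl [1..<Suc (horizon s)] @ map Inr [0..<horizon s] :: (nat + nat) list"
  let ?f = "\<lambda>chi. case_sum (state s (controls s chi \<zeta> \<epsilon>) \<zeta> \<epsilon>) (controls s chi \<zeta> \<epsilon>)"
  have u: "controls s chi \<zeta> \<epsilon> i \<in> carrier_vec (dim_u s)" for chi i
    unfolding controls_def by (rule controls_upto_carrier)
  have mix: "map (?f (pob_mix \<theta> a b)) ?ts = map (\<lambda>t. (1 - \<theta>) \<cdot>\<^sub>v ?f a t + \<theta> \<cdot>\<^sub>v ?f b t) ?ts"
  proof (rule map_cong[OF refl])
    fix t assume "t \<in> set ?ts"
    then show "?f (pob_mix \<theta> a b) t = (1 - \<theta>) \<cdot>\<^sub>v ?f a t + \<theta> \<cdot>\<^sub>v ?f b t"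
      by (auto intro!: state_mix[OF s _ u u] controls_mix[OF s a b])
  qed
  have dim: "dim_vec (?f a t) = dim_vec (?f b t)" if "t \<in> set ?ts" for t
  proof (cases t)
    case (Inl j)
    then have "j \<le> horizon s" using that by auto
    then show ?thesis using carrier_vecD[OF state_carrier[OF s]] Inl by simp
  qed (use carrier_vecD[OF u] in simp)
  show ?thesis
    unfolding traj_eq mix by (rule vstack_mix[OF dim, THEN conjunct2])
qed

lemma matZ_carrier:
  "is_lin_sys s \<Longrightarrow> chi \<in> pob_params s \<Longrightarrow> matZ s chi \<in> carrier_mat (n_w s) (n_zeta s + 1)"
  and matE_carrier:
  "is_lin_sys s \<Longrightarrow> chi \<in> pob_params s \<Longrightarrow> matE s chi \<in> carrier_mat (n_w s) (n_eps s)"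
  and traj_eq_matZ_matE:
  "is_lin_sys s \<Longrightarrow> chi \<in> pob_params s \<Longrightarrow> \<zeta> \<in> carrier_vec (n_zeta s) \<Longrightarrow> \<epsilon> \<in> carrier_vec (n_eps s) \<Longrightarrow>
    traj s chi \<zeta> \<epsilon> = matZ s chi *\<^sub>v append_one \<zeta> + matE s chi *\<^sub>v \<epsilon>"
  using represents_traj_matZ_matE[of s chi] by (auto simp: represents_traj_def)

text \<open>
  The combination of the matrices represents the combined trajectory, so uniqueness of the representing
  pair gives the claim.
\<close>

lemma matZ_matE_mix:
  assumes s: "is_lin_sys s" and a: "a \<in> pob_params s" and b: "b \<in> pob_params s"
  shows "matZ s (pob_mix \<theta> a b) = (1 - \<theta>) \<cdot>\<^sub>m matZ s a + \<theta> \<cdot>\<^sub>m matZ s b"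
    "matE s (pob_mix \<theta> a b) = (1 - \<theta>) \<cdot>\<^sub>m matE s a + \<theta> \<cdot>\<^sub>m matE s b"
proof -
  let ?Z = "(1 - \<theta>) \<cdot>\<^sub>m matZ s a + \<theta> \<cdot>\<^sub>m matZ s b"
  let ?E = "(1 - \<theta>) \<cdot>\<^sub>m matE s a + \<theta> \<cdot>\<^sub>m matE s b"
  note Za = matZ_carrier[OF s a] and Zb = matZ_carrier[OF s b]
  note Ea = matE_carrier[OF s a] and Eb = matE_carrier[OF s b]
  have "represents_traj s (pob_mix \<theta> a b) ?Z ?E"
    unfolding represents_traj_def
  proof (intro conjI ballI)
    fix \<zeta> \<epsilon> :: "real vec" assume \<zeta>: "\<zeta> \<in> carrier_vec (n_zeta s)" and \<epsilon>: "\<epsilon> \<in> carrier_vec (n_eps s)"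
    note a1 = append_one_carrier[OF \<zeta>]
    have c: "matZ s a *\<^sub>v append_one \<zeta> \<in> carrier_vec (n_w s)" "matZ s b *\<^sub>v append_one \<zeta> \<in> carrier_vec (n_w s)"
      "matE s a *\<^sub>v \<epsilon> \<in> carrier_vec (n_w s)" "matE s b *\<^sub>v \<epsilon> \<in> carrier_vec (n_w s)"
      using mult_mat_vec_carrier[OF Za a1] mult_mat_vec_carrier[OF Zb a1]
        mult_mat_vec_carrier[OF Ea \<epsilon>] mult_mat_vec_carrier[OF Eb \<epsilon>] by auto
    have regroup: "(1 - \<theta>) \<cdot>\<^sub>v (z + e) + \<theta> \<cdot>\<^sub>v (z' + e') = ((1 - \<theta>) \<cdot>\<^sub>v z + \<theta> \<cdot>\<^sub>v z') + ((1 - \<theta>) \<cdot>\<^sub>v e + \<theta> \<cdot>\<^sub>v e')"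
      if "z \<in> carrier_vec k" "e \<in> carrier_vec k" "z' \<in> carrier_vec k" "e' \<in> carrier_vec k"
      for z e z' e' :: "real vec" and k
      using that by (auto intro!: eq_vecI simp: algebra_simps)
    show "traj s (pob_mix \<theta> a b) \<zeta> \<epsilon> = ?Z *\<^sub>v append_one \<zeta> + ?E *\<^sub>v \<epsilon>"
      unfolding traj_mix[OF s a b] traj_eq_matZ_matE[OF s a \<zeta> \<epsilon>] traj_eq_matZ_matE[OF s b \<zeta> \<epsilon>]
        mix_mat_mult_vec[OF Za Zb a1] mix_mat_mult_vec[OF Ea Eb \<epsilon>]
      by (rule regroup) (use c in auto)
  qed (use Za Zb Ea Eb in auto)
  from represents_traj_unique[OF represents_traj_matZ_matE[OF s pob_mix_params[OF a b]] this]
  show "matZ s (pob_mix \<theta> a b) = ?Z" "matE s (pob_mix \<theta> a b) = ?E" by auto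
qed

section \<open>The affine forms of the quadratic and linear specifications\<close>

text \<open>
  The left-hand side of the identity that defines \<open>p\<close> and \<open>q\<close>.
\<close>

definition pq_functional :: "lin_sys \<Rightarrow> 'i spec \<Rightarrow> pob \<Rightarrow> 'i \<Rightarrow> real vec \<Rightarrow> real" where
  "pq_functional s sp chi i \<zeta> = (if i \<in> I2 sp then spa sp i \<bullet> (matZ s chi *\<^sub>v append_one \<zeta>)
     else - 2 * (spbeta sp i \<bullet> (spA sp i *\<^sub>v (matZ s chi *\<^sub>v append_one \<zeta>))))"

lemma defines_pq_alt:
  "defines_pq s sp chi i p q \<longleftrightarrow> p \<in> carrier_vec (n_zeta s) \<and>
     (\<forall>\<zeta> \<in> carrier_vec (n_zeta s). pq_functional s sp chi i \<zeta> = 2 * (p \<bullet> \<zeta>) + q)"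
  by (simp add: defines_pq_def pq_functional_def)

lemma defines_pq_unique:
  assumes "defines_pq s sp chi i p q" "defines_pq s sp chi i p' q'"
  shows "p = p'" "q = q'"
proof -
  have p: "p \<in> carrier_vec (n_zeta s)" "p' \<in> carrier_vec (n_zeta s)"
    and eq: "\<And>\<zeta>. \<zeta> \<in> carrier_vec (n_zeta s) \<Longrightarrow> 2 * (p \<bullet> \<zeta>) + q = 2 * (p' \<bullet> \<zeta>) + q'"
    using assms by (auto simp: defines_pq_alt)
  show q: "q = q'" using eq[of "0\<^sub>v (n_zeta s)"] p by simp
  show "p = p'"
  proof (rule eq_vecI)
    fix j assume "j < dim_vec p'"
    then show "p $ j = p' $ j" using eq[of "unit_vec (n_zeta s) j"] p q by simp
  qed (use p in auto)
qed

lemma is_specD: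
  assumes "is_spec m sp"
  shows "\<And>i. i \<in> I1 sp \<union> I3 sp \<Longrightarrow> spA sp i \<in> psd_mats m"
    "\<And>i. i \<in> I1 sp \<union> I3 sp \<Longrightarrow> spbeta sp i \<in> carrier_vec m"
    "\<And>i. i \<in> I1 sp \<union> I3 sp \<Longrightarrow> i \<notin> I2 sp"
    "\<And>i. i \<in> I2 sp \<Longrightarrow> spa sp i \<in> carrier_vec m"
    "\<And>i. i \<in> I4 sp \<Longrightarrow> spQ sp i \<in> carrier_mat (spm sp i) m"
    "\<And>i. i \<in> I4 sp \<Longrightarrow> spSigma sp i \<in> sym_mats (spm sp i)"
  using assms by (auto simp: is_spec_def pd_mats_def)

text \<open>
  The functional has the form \<open>g \<bullet> Z[\<zeta>;1] = (Z\<^sup>T g) \<bullet> [\<zeta>;1]\<close>; halving all entries of \<open>Z\<^sup>T g\<close> but the last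
  gives \<open>p\<close>, and the last entry is \<open>q\<close>.
\<close>

lemma defines_pq_vec_p_real_q:
  assumes s: "is_lin_sys s" and chi: "chi \<in> pob_params s" and sp: "is_spec (n_w s) sp"
    and i: "i \<in> I1 sp \<union> I2 sp \<union> I3 sp"
  shows "defines_pq s sp chi i (vec_p s sp chi i) (real_q s sp chi i)"
proof -
  let ?n = "n_zeta s" and ?Z = "matZ s chi"
  note Z = matZ_carrier[OF s chi]
  have Zt: "transpose_mat ?Z \<in> carrier_mat (?n + 1) (n_w s)" using Z by simp
  have "\<exists>g \<in> carrier_vec (n_w s). \<forall>\<zeta> \<in> carrier_vec ?n. pq_functional s sp chi i \<zeta> = g \<bullet> (?Z *\<^sub>v append_one \<zeta>)"
  proof (cases "i \<in> I2 sp")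
    case True
    then show ?thesis using is_specD(4)[OF sp True] by (auto simp: pq_functional_def)
  next
    case False
    then have i13: "i \<in> I1 sp \<union> I3 sp" using i by auto
    note A = is_specD(1)[OF sp i13] and \<beta> = is_specD(2)[OF sp i13]
    have "spbeta sp i \<bullet> (spA sp i *\<^sub>v y) = (spA sp i *\<^sub>v spbeta sp i) \<bullet> y" if "y \<in> carrier_vec (n_w s)" for y
      using transpose_vec_mult_scalar[OF psd_matsD(2)[OF A] that \<beta>] psd_matsD(3)[OF A] by simp
    then show ?thesis
      using False mult_mat_vec_carrier[OF psd_matsD(2)[OF A] \<beta>] mult_mat_vec_carrier[OF Z append_one_carrier]
      by (intro bexI[of _ "(- 2) \<cdot>\<^sub>v (spA sp i *\<^sub>v spbeta sp i)"]) (auto simp: pq_functional_def)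
  qed
  then obtain g where g: "g \<in> carrier_vec (n_w s)"
    "\<And>\<zeta>. \<zeta> \<in> carrier_vec ?n \<Longrightarrow> pq_functional s sp chi i \<zeta> = g \<bullet> (?Z *\<^sub>v append_one \<zeta>)" by blast
  define h where "h = transpose_mat ?Z *\<^sub>v g"
  have "defines_pq s sp chi i (vec ?n (\<lambda>j. h $ j / 2)) (h $ ?n)"
    unfolding defines_pq_alt
  proof (intro conjI ballI)
    fix \<zeta> :: "real vec" assume \<zeta>: "\<zeta> \<in> carrier_vec ?n"
    have "pq_functional s sp chi i \<zeta> = h \<bullet> append_one \<zeta>"
      unfolding h_def g(2)[OF \<zeta>]
      by (rule transpose_vec_mult_scalar[OF Z append_one_carrier[OF \<zeta>] g(1), symmetric])
    also have "\<dots> = (\<Sum>j<?n. h $ j * \<zeta> $ j) + h $ ?n"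
      unfolding scalar_prod_sum[OF append_one_carrier[OF \<zeta>]] by (rule sum_append_one[OF \<zeta>])
    finally show "pq_functional s sp chi i \<zeta> = 2 * (vec ?n (\<lambda>j. h $ j / 2) \<bullet> \<zeta>) + h $ ?n"
      by (simp add: scalar_prod_sum[OF \<zeta>] sum_distrib_left)
  qed simp
  then obtain p q where pq: "defines_pq s sp chi i p q" by blast
  have "vec_p s sp chi i = p"
    unfolding vec_p_def
  proof (rule the_equality)
    show "\<exists>q. defines_pq s sp chi i p q" using pq by (rule exI)
    fix p' assume "\<exists>q. defines_pq s sp chi i p' q"
    then obtain q' where "defines_pq s sp chi i p' q'" ..
    then show "p' = p" using pq by (rule defines_pq_unique(1))
  qed
  moreover have "real_q s sp chi i = q"
    unfolding real_q_def
  proof (rule the_equality)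
    show "\<exists>p. defines_pq s sp chi i p q" using pq by (rule exI)
    fix q' assume "\<exists>p. defines_pq s sp chi i p q'"
    then obtain p' where "defines_pq s sp chi i p' q'" ..
    then show "q' = q" using pq by (rule defines_pq_unique(2))
  qed
  ultimately show ?thesis using pq by simp
qed

lemma vec_p_carrier:
  assumes "is_lin_sys s" "chi \<in> pob_params s" "is_spec (n_w s) sp" "i \<in> I1 sp \<union> I2 sp \<union> I3 sp"
  shows "vec_p s sp chi i \<in> carrier_vec (n_zeta s)"
  using defines_pq_vec_p_real_q[OF assms] by (simp add: defines_pq_def)

lemma vec_p_real_q_mix:
  assumes s: "is_lin_sys s" and a: "a \<in> pob_params s" and b: "b \<in> pob_params s"
    and sp: "is_spec (n_w s) sp" and i: "i \<in> I1 sp \<union> I2 sp \<union> I3 sp"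
  shows "vec_p s sp (pob_mix \<theta> a b) i = (1 - \<theta>) \<cdot>\<^sub>v vec_p s sp a i + \<theta> \<cdot>\<^sub>v vec_p s sp b i"
    "real_q s sp (pob_mix \<theta> a b) i = (1 - \<theta>) * real_q s sp a i + \<theta> * real_q s sp b i"
proof -
  let ?p = "(1 - \<theta>) \<cdot>\<^sub>v vec_p s sp a i + \<theta> \<cdot>\<^sub>v vec_p s sp b i"
  let ?q = "(1 - \<theta>) * real_q s sp a i + \<theta> * real_q s sp b i"
  note da = defines_pq_vec_p_real_q[OF s a sp i, unfolded defines_pq_alt]
  note db = defines_pq_vec_p_real_q[OF s b sp i, unfolded defines_pq_alt]
  note Za = matZ_carrier[OF s a] and Zb = matZ_carrier[OF s b]
  have mix: "pq_functional s sp (pob_mix \<theta> a b) i \<zeta>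
      = (1 - \<theta>) * pq_functional s sp a i \<zeta> + \<theta> * pq_functional s sp b i \<zeta>"
    if \<zeta>: "\<zeta> \<in> carrier_vec (n_zeta s)" for \<zeta>
  proof -
    define z where "z = matZ s a *\<^sub>v append_one \<zeta>"
    define z' where "z' = matZ s b *\<^sub>v append_one \<zeta>"
    have z: "z \<in> carrier_vec (n_w s)" "z' \<in> carrier_vec (n_w s)"
      using mult_mat_vec_carrier[OF Za append_one_carrier[OF \<zeta>]]
        mult_mat_vec_carrier[OF Zb append_one_carrier[OF \<zeta>]] by (auto simp: z_def z'_def)
    have Zmix: "matZ s (pob_mix \<theta> a b) *\<^sub>v append_one \<zeta> = (1 - \<theta>) \<cdot>\<^sub>v z + \<theta> \<cdot>\<^sub>v z'"
      unfolding matZ_matE_mix(1)[OF s a b] z_def z'_def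
      by (rule mix_mat_mult_vec[OF Za Zb append_one_carrier[OF \<zeta>]])
    show ?thesis
    proof (cases "i \<in> I2 sp")
      case True
      then show ?thesis using z is_specD(4)[OF sp True]
        by (simp add: pq_functional_def Zmix scalar_prod_add_distrib[of _ "n_w s"] flip: z_def z'_def)
    next
      case False
      then have i13: "i \<in> I1 sp \<union> I3 sp" using i by auto
      note A = psd_matsD(2)[OF is_specD(1)[OF sp i13]] and \<beta> = is_specD(2)[OF sp i13]
      show ?thesis using False z mult_mat_vec_carrier[OF A z(1)] mult_mat_vec_carrier[OF A z(2)] \<beta>
        by (simp add: pq_functional_def Zmix mult_mat_vec_mix[OF A z]
            scalar_prod_add_distrib[of _ "n_w s"] algebra_simps flip: z_def z'_def)
    qed
  qed
  have "defines_pq s sp (pob_mix \<theta> a b) i ?p ?q"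
    unfolding defines_pq_alt
  proof (intro conjI ballI)
    fix \<zeta> :: "real vec" assume \<zeta>: "\<zeta> \<in> carrier_vec (n_zeta s)"
    show "pq_functional s sp (pob_mix \<theta> a b) i \<zeta> = 2 * (?p \<bullet> \<zeta>) + ?q"
      using da db \<zeta> by (simp add: mix[OF \<zeta>] add_scalar_prod_distrib[of _ "n_zeta s"] algebra_simps)
  qed (use da db in auto)
  from defines_pq_unique[OF defines_pq_vec_p_real_q[OF s pob_mix_params[OF a b] sp i] this]
  show "vec_p s sp (pob_mix \<theta> a b) i = ?p" "real_q s sp (pob_mix \<theta> a b) i = ?q" by auto
qed

section \<open>Moments of the trajectory\<close>

locale centered_noise = prob_space M for M :: "'a measure" +
  fixes n :: nat and eps :: "'a \<Rightarrow> real vec" and Cov :: "real mat"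
  assumes sq_int: "square_integrable_vec M n eps"
    and mean_0: "mean_vec M n eps = 0\<^sub>v n"
    and Cov: "cov_mat M n eps = Cov"
begin

lemma eps_carrier: "\<omega> \<in> space M \<Longrightarrow> eps \<omega> \<in> carrier_vec n"
  using sq_int by (auto simp: square_integrable_vec_def)

lemma integrable_component: "i < n \<Longrightarrow> integrable M (\<lambda>\<omega>. eps \<omega> $ i)"
  using sq_int by (auto simp: square_integrable_vec_def intro: square_integrable_imp_integrable)

lemma integrable_product:
  assumes "i < n" "j < n"
  shows "integrable M (\<lambda>\<omega>. eps \<omega> $ i * eps \<omega> $ j)"
proof (rule Bochner_Integration.integrable_bound)
  show "integrable M (\<lambda>\<omega>. (eps \<omega> $ i)\<^sup>2 + (eps \<omega> $ j)\<^sup>2)"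
    using sq_int assms by (auto simp: square_integrable_vec_def)
  show "(\<lambda>\<omega>. eps \<omega> $ i * eps \<omega> $ j) \<in> borel_measurable M"
    using sq_int assms by (auto simp: square_integrable_vec_def intro!: borel_measurable_times)
  have "\<bar>x * y\<bar> \<le> x\<^sup>2 + y\<^sup>2" for x y :: real
  proof -
    have "2 * (\<bar>x\<bar> * \<bar>y\<bar>) \<le> x\<^sup>2 + y\<^sup>2"
      using zero_le_power2[of "\<bar>x\<bar> - \<bar>y\<bar>"] by (simp add: power2_diff)
    moreover have "0 \<le> \<bar>x\<bar> * \<bar>y\<bar>" by simp
    ultimately show ?thesis unfolding abs_mult by linarith
  qed
  then show "AE \<omega> in M. norm (eps \<omega> $ i * eps \<omega> $ j) \<le> norm ((eps \<omega> $ i)\<^sup>2 + (eps \<omega> $ j)\<^sup>2)" by simp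
qed

lemma expectation_component: "i < n \<Longrightarrow> expectation (\<lambda>\<omega>. eps \<omega> $ i) = 0"
  using arg_cong[OF mean_0, of "\<lambda>v. v $ i"] by (simp add: mean_vec_def)

lemma Cov_carrier: "Cov \<in> carrier_mat n n"
  unfolding Cov[symmetric] by (simp add: cov_mat_def)

lemma expectation_product:
  assumes "i < n" "j < n"
  shows "expectation (\<lambda>\<omega>. eps \<omega> $ i * eps \<omega> $ j) = Cov $$ (i, j)"
  using assms unfolding Cov[symmetric] by (simp add: cov_mat_def mean_0)

lemma expectation_linear:
  "integrable M (\<lambda>\<omega>. \<Sum>j<n. d j * eps \<omega> $ j)" "expectation (\<lambda>\<omega>. \<Sum>j<n. d j * eps \<omega> $ j) = 0"
proof -
  show "integrable M (\<lambda>\<omega>. \<Sum>j<n. d j * eps \<omega> $ j)"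
    by (intro Bochner_Integration.integrable_sum integrable_mult_right integrable_component) auto
  show "expectation (\<lambda>\<omega>. \<Sum>j<n. d j * eps \<omega> $ j) = 0"
    by (subst Bochner_Integration.integral_sum)
      (auto simp: integrable_component expectation_component intro!: integrable_mult_right)
qed

lemma expectation_quadratic:
  "integrable M (\<lambda>\<omega>. \<Sum>k<n. \<Sum>l<n. G k l * (eps \<omega> $ k * eps \<omega> $ l))"
  "expectation (\<lambda>\<omega>. \<Sum>k<n. \<Sum>l<n. G k l * (eps \<omega> $ k * eps \<omega> $ l)) = (\<Sum>k<n. \<Sum>l<n. G k l * Cov $$ (k, l))"
proof -
  have i: "integrable M (\<lambda>\<omega>. \<Sum>l<n. G k l * (eps \<omega> $ k * eps \<omega> $ l))" if "k < n" for k
    by (intro Bochner_Integration.integrable_sum integrable_mult_right integrable_product that) auto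
  show "integrable M (\<lambda>\<omega>. \<Sum>k<n. \<Sum>l<n. G k l * (eps \<omega> $ k * eps \<omega> $ l))"
    by (intro Bochner_Integration.integrable_sum i) auto
  have "expectation (\<lambda>\<omega>. \<Sum>l<n. G k l * (eps \<omega> $ k * eps \<omega> $ l)) = (\<Sum>l<n. G k l * Cov $$ (k, l))"
    if "k < n" for k
    using that by (subst Bochner_Integration.integral_sum)
      (auto intro!: integrable_mult_right integrable_product sum.cong simp: expectation_product)
  then show "expectation (\<lambda>\<omega>. \<Sum>k<n. \<Sum>l<n. G k l * (eps \<omega> $ k * eps \<omega> $ l)) = (\<Sum>k<n. \<Sum>l<n. G k l * Cov $$ (k, l))"
    by (subst Bochner_Integration.integral_sum) (auto intro: i)
qed

lemma Cov_psd: "Cov \<in> psd_mats n"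
proof -
  have "Cov \<in> sym_mats n"
    by (rule sym_matsI_index[OF Cov_carrier]) (simp add: mult.commute flip: expectation_product)
  moreover have "0 \<le> v \<bullet> (Cov *\<^sub>v v)" if v: "v \<in> carrier_vec n" for v
  proof -
    have "v \<bullet> (Cov *\<^sub>v v) = (\<Sum>k<n. \<Sum>l<n. (v $ k * v $ l) * Cov $$ (k, l))"
      unfolding scalar_prod_mult_mat_vec_sum[OF Cov_carrier v v] by (simp add: mult_ac)
    also have "\<dots> = expectation (\<lambda>\<omega>. \<Sum>k<n. \<Sum>l<n. (v $ k * v $ l) * (eps \<omega> $ k * eps \<omega> $ l))"
      by (rule expectation_quadratic(2)[symmetric])
    also have "\<dots> = expectation (\<lambda>\<omega>. (\<Sum>k<n. v $ k * eps \<omega> $ k)\<^sup>2)"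
      by (simp add: power2_eq_square sum_product mult_ac)
    also have "\<dots> \<ge> 0" by simp
    finally show ?thesis .
  qed
  ultimately show ?thesis by (simp add: psd_mats_def)
qed

text \<open>
  The cross term is linear in the centred noise and has expectation 0.
\<close>

lemma expectation_quad_form_affine:
  assumes A: "A \<in> psd_mats m" and g: "g \<in> carrier_vec m" and E: "E \<in> carrier_mat m n"
  shows "expectation (\<lambda>\<omega>. (A *\<^sub>v (g + E *\<^sub>v eps \<omega>)) \<bullet> (g + E *\<^sub>v eps \<omega>))
    = (A *\<^sub>v g) \<bullet> g + (fro_norm (psd_sqrt m A * E * psd_sqrt n Cov))\<^sup>2"
proof -
  note Ac = psd_matsD(2)[OF A]
  define G where "G = transpose_mat E * A * E"
  have EtA: "transpose_mat E * A \<in> carrier_mat n m" using E Ac by (intro mult_carrier_mat[of _ n m]) auto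
  have Gc: "G \<in> carrier_mat n n" unfolding G_def by (rule mult_carrier_mat[OF EtA E])
  define h where "h = transpose_mat E *\<^sub>v (A *\<^sub>v g)"
  note Ag = mult_mat_vec_carrier[OF Ac g]
  have pointwise: "(A *\<^sub>v (g + E *\<^sub>v eps \<omega>)) \<bullet> (g + E *\<^sub>v eps \<omega>)
      = (A *\<^sub>v g) \<bullet> g + (\<Sum>j<n. (2 * h $ j) * eps \<omega> $ j)
        + (\<Sum>k<n. \<Sum>l<n. G $$ (k, l) * (eps \<omega> $ k * eps \<omega> $ l))" if \<omega>: "\<omega> \<in> space M" for \<omega>
  proof -
    define y where "y = eps \<omega>"
    have y: "y \<in> carrier_vec n" using eps_carrier[OF \<omega>] by (simp add: y_def)
    note Ey = mult_mat_vec_carrier[OF E y]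
    have w: "g + E *\<^sub>v y \<in> carrier_vec m" using g Ey by simp
    have "(A *\<^sub>v (g + E *\<^sub>v y)) \<bullet> (g + E *\<^sub>v y) = (g + 1 \<cdot>\<^sub>v (E *\<^sub>v y)) \<bullet> (A *\<^sub>v (g + 1 \<cdot>\<^sub>v (E *\<^sub>v y)))"
      using comm_scalar_prod[OF mult_mat_vec_carrier[OF Ac w] w] by simp
    also have "\<dots> = g \<bullet> (A *\<^sub>v g) + 2 * ((E *\<^sub>v y) \<bullet> (A *\<^sub>v g)) + (E *\<^sub>v y) \<bullet> (A *\<^sub>v (E *\<^sub>v y))"
      using quad_form_add_smult[OF psd_matsD(1)[OF A] g Ey, of 1] by simp
    also have "(E *\<^sub>v y) \<bullet> (A *\<^sub>v g) = h \<bullet> y"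
      using comm_scalar_prod[OF Ey Ag] transpose_vec_mult_scalar[OF E y Ag] by (simp add: h_def)
    also have "(E *\<^sub>v y) \<bullet> (A *\<^sub>v (E *\<^sub>v y)) = y \<bullet> (G *\<^sub>v y)"
      unfolding G_def by (rule quad_form_congruence[OF Ac E y, symmetric])
    finally show ?thesis
      unfolding y_def[symmetric] scalar_prod_sum[OF y] scalar_prod_mult_mat_vec_sum[OF Gc y y]
      by (simp add: comm_scalar_prod[OF g Ag] sum_distrib_left mult_ac)
  qed
  have "expectation (\<lambda>\<omega>. (A *\<^sub>v (g + E *\<^sub>v eps \<omega>)) \<bullet> (g + E *\<^sub>v eps \<omega>))
      = expectation (\<lambda>\<omega>. (A *\<^sub>v g) \<bullet> g + (\<Sum>j<n. (2 * h $ j) * eps \<omega> $ j)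
        + (\<Sum>k<n. \<Sum>l<n. G $$ (k, l) * (eps \<omega> $ k * eps \<omega> $ l)))"
    by (rule Bochner_Integration.integral_cong[OF refl pointwise])
  also have "\<dots> = (A *\<^sub>v g) \<bullet> g + (\<Sum>k<n. \<Sum>l<n. G $$ (k, l) * Cov $$ (k, l))"
    using expectation_linear[of "\<lambda>j. 2 * h $ j"] expectation_quadratic[of "\<lambda>k l. G $$ (k, l)"]
    by (simp add: prob_space)
  finally show ?thesis
    unfolding fro_norm_sqrt_sandwich[OF A E Cov_psd] G_def .
qed

lemma mean_affine:
  assumes g: "g \<in> carrier_vec m" and E: "E \<in> carrier_mat m n"
    and X: "\<And>\<omega>. \<omega> \<in> space M \<Longrightarrow> X \<omega> = g + E *\<^sub>v eps \<omega>"
  shows "mean_vec M m X = g"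
proof (rule eq_vecI)
  fix i assume "i < dim_vec g"
  then have i: "i < m" using g by simp
  have "expectation (\<lambda>\<omega>. X \<omega> $ i) = expectation (\<lambda>\<omega>. g $ i + (\<Sum>j<n. E $$ (i, j) * eps \<omega> $ j))"
  proof (rule Bochner_Integration.integral_cong[OF refl])
    fix \<omega> assume \<omega>: "\<omega> \<in> space M"
    note y = eps_carrier[OF \<omega>]
    show "X \<omega> $ i = g $ i + (\<Sum>j<n. E $$ (i, j) * eps \<omega> $ j)"
      using i g carrier_vecD[OF mult_mat_vec_carrier[OF E y]]
      by (simp add: X[OF \<omega>] mult_mat_vec_index_sum[OF E y i, symmetric] del: index_mult_mat_vec)
  qed
  also have "\<dots> = g $ i"
    using expectation_linear[of "\<lambda>j. E $$ (i, j)"] by (simp add: prob_space)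
  finally show "mean_vec M m X $ i = g $ i" using i by (simp add: mean_vec_def)
qed (use g in \<open>simp add: mean_vec_def\<close>)

end

section \<open>Certificates for the robust constraints\<close>

lemma ell_set_carrier:
  assumes "is_ellitope m D" "\<zeta> \<in> ell_set D \<rho>"
  shows "\<zeta> \<in> carrier_vec m"
  using assms is_ellitopeD(1)[OF assms(1)] by (auto simp: ell_set_def)

text \<open>
  Allows \<open>Z\<^sup>T A Z\<close> itself to serve as the bordered matrix of the feasibility problem.
\<close>

lemma sym_mats_Suc_bordered:
  assumes G: "G \<in> sym_mats (n + 1)"
  obtains X x \<alpha> where "X \<in> sym_mats n" "x \<in> carrier_vec n" "G = bordered X x \<alpha>"
proof -
  define X where "X = mat n n (\<lambda>(i, j). G $$ (i, j))"
  define x where "x = vec n (\<lambda>i. G $$ (i, n))"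
  note Gc = sym_matsD(1)[OF G]
  have "X \<in> sym_mats n"
    by (rule sym_matsI_index) (use sym_mats_index[OF G] in \<open>auto simp: X_def\<close>)
  moreover have "x \<in> carrier_vec n" by (simp add: x_def)
  moreover have "G = bordered X x (G $$ (n, n))"
  proof (rule eq_matI)
    fix i j assume "i < dim_row (bordered X x (G $$ (n, n)))" "j < dim_col (bordered X x (G $$ (n, n)))"
    then have ij: "i < n + 1" "j < n + 1" by (auto simp: bordered_def X_def)
    then consider "i < n" "j < n" | "i < n" "j = n" | "i = n" "j < n" | "i = n" "j = n" by linarith
    then show "G $$ (i, j) = bordered X x (G $$ (n, n)) $$ (i, j)"
    proof cases
      case 3
      then show ?thesis
        using sym_mats_index[OF G, of i j] by (simp add: bordered_def X_def x_def mat_of_rows_def)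
    qed (auto simp: bordered_def X_def x_def mat_of_cols_def)
  qed (use Gc in \<open>auto simp: bordered_def X_def\<close>)
  ultimately show thesis using that by blast
qed

lemma append_one_bordered:
  assumes X: "X \<in> carrier_mat n n" and x: "x \<in> carrier_vec n" and v: "v \<in> carrier_vec n"
  shows "append_one v \<bullet> (bordered X x \<alpha> *\<^sub>v append_one v) = v \<bullet> (X *\<^sub>v v) + 2 * (v \<bullet> x) + \<alpha>"
  using quad_form_bordered[OF assms, of 1 \<alpha>] by (simp add: append_one_def)

lemma quad_form_centered:
  assumes A: "A \<in> sym_mats m" and w: "w \<in> carrier_vec m" and b: "b \<in> carrier_vec m"
  shows "(A *\<^sub>v (w - b)) \<bullet> (w - b) = w \<bullet> (A *\<^sub>v w) - 2 * (b \<bullet> (A *\<^sub>v w)) + b \<bullet> (A *\<^sub>v b)"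
proof -
  have wb: "w - b \<in> carrier_vec m" using w b by simp
  have "w - b = w + (- 1) \<cdot>\<^sub>v b" using w b by (intro eq_vecI) auto
  then have "(w - b) \<bullet> (A *\<^sub>v (w - b)) = w \<bullet> (A *\<^sub>v w) - 2 * (b \<bullet> (A *\<^sub>v w)) + b \<bullet> (A *\<^sub>v b)"
    using quad_form_add_smult[OF A w b, of "- 1"] by simp
  then show ?thesis
    using comm_scalar_prod[OF mult_mat_vec_carrier[OF sym_matsD(1)[OF A] wb] wb] by simp
qed

text \<open>
  The value of the quadratic function at \<open>\<zeta>\<close> is \<open>[\<zeta>;1] \<bullet> G [\<zeta>;1] + 2 p \<bullet> \<zeta> + q + r\<close> with
  \<open>G = Z\<^sup>T A Z\<close>. Any bordered matrix above \<open>G\<close> gives an upper bound, and the choice of \<open>G\<close> itself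
  loses nothing. The constant \<open>\<kappa>\<close> stands for the contribution of the noise.
\<close>

lemma robust_quad_iff:
  assumes s: "is_lin_sys s" and chi: "chi \<in> pob_params s" and sp: "is_spec (n_w s) sp"
    and i: "i \<in> I1 sp \<union> I3 sp" and U: "\<And>\<zeta>. \<zeta> \<in> U \<Longrightarrow> \<zeta> \<in> carrier_vec (n_zeta s)"
  defines "w \<equiv> \<lambda>\<zeta>. matZ s chi *\<^sub>v append_one \<zeta>"
  shows "(\<forall>\<zeta> \<in> U. (spA sp i *\<^sub>v (w \<zeta> - spbeta sp i)) \<bullet> (w \<zeta> - spbeta sp i) + \<kappa> \<le> \<gamma>) \<longleftrightarrow>
    (\<exists>X x \<alpha> \<delta>. X \<in> sym_mats (n_zeta s) \<and> x \<in> carrier_vec (n_zeta s) \<and>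
       loewner_ge (n_zeta s + 1) (bordered X x \<alpha>) (transpose_mat (matZ s chi) * spA sp i * matZ s chi) \<and>
       (\<forall>\<zeta> \<in> U. \<zeta> \<bullet> (X *\<^sub>v \<zeta>) + 2 * (\<zeta> \<bullet> (x + vec_p s sp chi i)) \<le> \<delta> - real_q s sp chi i) \<and>
       \<alpha> + \<delta> + \<kappa> + r_const sp i \<le> \<gamma>)" (is "?robust \<longleftrightarrow> ?ext")
proof -
  let ?n = "n_zeta s" and ?Z = "matZ s chi" and ?A = "spA sp i" and ?b = "spbeta sp i"
    and ?p = "vec_p s sp chi i" and ?q = "real_q s sp chi i"
  note Z = matZ_carrier[OF s chi] and A = is_specD(1)[OF sp i] and b = is_specD(2)[OF sp i]
  define G where "G = transpose_mat ?Z * ?A * ?Z"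
  have G: "G \<in> sym_mats (?n + 1)"
    unfolding G_def by (rule sym_mats_congruence[OF psd_matsD(1)[OF A] Z])
  have pq: "defines_pq s sp chi i ?p ?q"
    by (rule defines_pq_vec_p_real_q[OF s chi sp]) (use i in auto)
  then have p: "?p \<in> carrier_vec ?n" by (simp add: defines_pq_def)
  have val: "(?A *\<^sub>v (w \<zeta> - ?b)) \<bullet> (w \<zeta> - ?b)
      = append_one \<zeta> \<bullet> (G *\<^sub>v append_one \<zeta>) + 2 * (?p \<bullet> \<zeta>) + ?q + r_const sp i"
    if \<zeta>: "\<zeta> \<in> carrier_vec ?n" for \<zeta>
  proof -
    note a1 = append_one_carrier[OF \<zeta>]
    have wc: "w \<zeta> \<in> carrier_vec (n_w s)" unfolding w_def by (rule mult_mat_vec_carrier[OF Z a1])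
    have "- 2 * (?b \<bullet> (?A *\<^sub>v w \<zeta>)) = 2 * (?p \<bullet> \<zeta>) + ?q"
      using pq \<zeta> is_specD(3)[OF sp i] by (simp add: defines_pq_def w_def)
    moreover have "w \<zeta> \<bullet> (?A *\<^sub>v w \<zeta>) = append_one \<zeta> \<bullet> (G *\<^sub>v append_one \<zeta>)"
      unfolding G_def w_def by (rule quad_form_congruence[OF psd_matsD(2)[OF A] Z a1, symmetric])
    ultimately show ?thesis
      unfolding quad_form_centered[OF psd_matsD(1)[OF A] wc b] r_const_def by simp
  qed
  have split: "\<zeta> \<bullet> (x + ?p) = \<zeta> \<bullet> x + ?p \<bullet> \<zeta>" if "\<zeta> \<in> carrier_vec ?n" "x \<in> carrier_vec ?n" for \<zeta> x
    using that p comm_scalar_prod[OF that(1) p] by (simp add: scalar_prod_add_distrib[of _ ?n])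
  show ?thesis
  proof
    assume R: ?robust
    obtain X x \<alpha> where X: "X \<in> sym_mats ?n" and x: "x \<in> carrier_vec ?n" and GX: "G = bordered X x \<alpha>"
      using sym_mats_Suc_bordered[OF G] by blast
    have "\<zeta> \<bullet> (X *\<^sub>v \<zeta>) + 2 * (\<zeta> \<bullet> (x + ?p)) \<le> (\<gamma> - \<alpha> - \<kappa> - r_const sp i) - ?q" if "\<zeta> \<in> U" for \<zeta>
      using R[rule_format, OF that] append_one_bordered[OF sym_matsD(1)[OF X] x U[OF that], of \<alpha>]
      unfolding val[OF U[OF that]] split[OF U[OF that] x] GX by simp
    moreover have "loewner_ge (?n + 1) (bordered X x \<alpha>) G"
      using loewner_ge_iff[OF G G] by (simp flip: GX)
    ultimately show ?ext
      using X x unfolding G_def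
      by (intro exI[of _ X] exI[of _ x] exI[of _ \<alpha>] exI[of _ "\<gamma> - \<alpha> - \<kappa> - r_const sp i"]) auto
  next
    assume ?ext
    then obtain X x \<alpha> \<delta> where X: "X \<in> sym_mats ?n" and x: "x \<in> carrier_vec ?n"
      and L: "loewner_ge (?n + 1) (bordered X x \<alpha>) G"
      and R: "\<forall>\<zeta> \<in> U. \<zeta> \<bullet> (X *\<^sub>v \<zeta>) + 2 * (\<zeta> \<bullet> (x + ?p)) \<le> \<delta> - ?q"
      and B: "\<alpha> + \<delta> + \<kappa> + r_const sp i \<le> \<gamma>"
      unfolding G_def by blast
    show ?robust
    proof
      fix \<zeta> assume "\<zeta> \<in> U"
      note \<zeta> = U[OF this]
      have "append_one \<zeta> \<bullet> (G *\<^sub>v append_one \<zeta>) \<le> append_one \<zeta> \<bullet> (bordered X x \<alpha> *\<^sub>v append_one \<zeta>)"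
        using L append_one_carrier[OF \<zeta>] unfolding loewner_ge_iff[OF bordered_sym[OF X x] G] by blast
      also have "\<dots> = \<zeta> \<bullet> (X *\<^sub>v \<zeta>) + 2 * (\<zeta> \<bullet> x) + \<alpha>"
        by (rule append_one_bordered[OF sym_matsD(1)[OF X] x \<zeta>])
      finally show "(?A *\<^sub>v (w \<zeta> - ?b)) \<bullet> (w \<zeta> - ?b) + \<kappa> \<le> \<gamma>"
        using R[rule_format, OF \<open>\<zeta> \<in> U\<close>] B unfolding val[OF \<zeta>] split[OF \<zeta> x] by simp
    qed
  qed
qed

lemma robust_linear_iff:
  fixes D :: "'k::finite ellitope"
  assumes s: "is_lin_sys s" and chi: "chi \<in> pob_params s" and sp: "is_spec (n_w s) sp"
    and i: "i \<in> I2 sp" and D: "is_ellitope (n_zeta s) D" and \<rho>: "\<rho> > 0"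
  shows "(\<forall>\<zeta> \<in> ell_set D \<rho>. spa sp i \<bullet> (matZ s chi *\<^sub>v append_one \<zeta>) \<le> \<gamma>) \<longleftrightarrow>
    (\<exists>l \<alpha>. 0 \<le> l \<and>
       bordered_tl \<alpha> (- (transpose_mat (ell_P D) *\<^sub>v vec_p s sp chi i))
         (sum_mat (dim_z D) (\<lambda>k. vec_nth l k \<cdot>\<^sub>m ell_S D k)) \<in> psd_mats (1 + dim_z D) \<and>
       \<alpha> + \<rho> * phi_T (ell_T D) l + real_q s sp chi i \<le> \<gamma>)"
proof -
  have pq: "defines_pq s sp chi i (vec_p s sp chi i) (real_q s sp chi i)"
    by (rule defines_pq_vec_p_real_q[OF s chi sp]) (use i in auto)
  then have p: "vec_p s sp chi i \<in> carrier_vec (n_zeta s)" by (simp add: defines_pq_def)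
  have "(\<forall>\<zeta> \<in> ell_set D \<rho>. spa sp i \<bullet> (matZ s chi *\<^sub>v append_one \<zeta>) \<le> \<gamma>) \<longleftrightarrow>
      (\<forall>\<zeta> \<in> ell_set D \<rho>. 2 * (vec_p s sp chi i \<bullet> \<zeta>) \<le> \<gamma> - real_q s sp chi i)"
    using pq i ell_set_carrier[OF D] by (auto simp: defines_pq_def algebra_simps)
  then show ?thesis
    unfolding ellitope_robust_linear_iff[OF D \<rho> p] by (simp add: algebra_simps)
qed

text \<open>
  The covariance constraint in terms of \<open>B = Q E R\<close>: since \<open>R\<close> is symmetric with \<open>R\<^sup>2 = \<Pi>\<close>, one has
  \<open>B B\<^sup>T = Q E \<Pi> E\<^sup>T Q\<^sup>T\<close>, which is the Schur complement term.
\<close>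

lemma con_cov_eq_schur:
  fixes V :: "('i, 'k::finite) fvars"
  assumes s: "is_lin_sys s" and chi: "vchi V \<in> pob_params s" and sp: "is_spec (n_w s) sp"
    and i: "i \<in> I4 sp" and C: "C \<in> psd_mats (n_eps s)"
  defines "B \<equiv> spQ sp i * matE s (vchi V) * psd_sqrt (n_eps s) C"
  shows "B \<in> carrier_mat (spm sp i) (n_eps s)"
    "con_cov s C sp i V \<longleftrightarrow>
      four_block_mat (spSigma sp i) B (transpose_mat B) (1\<^sub>m (n_eps s)) \<in> psd_mats (spm sp i + n_eps s)"
    "spQ sp i * Sigma_w s C (vchi V) * transpose_mat (spQ sp i) = B * transpose_mat B"
proof -
  define E where "E = matE s (vchi V)"
  define R where "R = psd_sqrt (n_eps s) C"
  define Q where "Q = spQ sp i"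
  have E: "E \<in> carrier_mat (n_w s) (n_eps s)" unfolding E_def by (rule matE_carrier[OF s chi])
  have Q: "Q \<in> carrier_mat (spm sp i) (n_w s)" unfolding Q_def by (rule is_specD(5)[OF sp i])
  have R: "R \<in> carrier_mat (n_eps s) (n_eps s)" "transpose_mat R = R" "R * R = C"
    using psd_sqrt[OF C] psd_matsD(2,3) unfolding R_def by auto
  note QE = mult_carrier_mat[OF Q E]
  have B: "B = Q * E * R" by (simp add: B_def E_def R_def Q_def)
  show Bc: "B \<in> carrier_mat (spm sp i) (n_eps s)" unfolding B by (rule mult_carrier_mat[OF QE R(1)])
  have Et: "transpose_mat E \<in> carrier_mat (n_eps s) (n_w s)" and Qt: "transpose_mat Q \<in> carrier_mat (n_w s) (spm sp i)"
    using E Q by auto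
  note EQ = mult_carrier_mat[OF Et Qt]
  have Bt: "transpose_mat B = R * (transpose_mat E * transpose_mat Q)"
    unfolding B using transpose_mult[OF QE R(1)] transpose_mult[OF Q E] R(2) by simp
  also have "\<dots> = transpose_mat R * transpose_mat E * transpose_mat Q"
    using assoc_mult_mat[OF R(1) Et Qt] R(2) by simp
  finally have "transpose_mat B = transpose_mat R * transpose_mat E * transpose_mat Q" .
  then show "con_cov s C sp i V \<longleftrightarrow>
      four_block_mat (spSigma sp i) B (transpose_mat B) (1\<^sub>m (n_eps s)) \<in> psd_mats (spm sp i + n_eps s)"
    by (simp add: con_cov_def Let_def B E_def R_def Q_def)
  have "B * transpose_mat B = Q * E * (R * (R * (transpose_mat E * transpose_mat Q)))"
    unfolding Bt unfolding B by (rule assoc_mult_mat[OF QE R(1) mult_carrier_mat[OF R(1) EQ]])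
  also have "R * (R * (transpose_mat E * transpose_mat Q)) = C * (transpose_mat E * transpose_mat Q)"
    using assoc_mult_mat[OF R(1) R(1) EQ] R(3) by simp
  also have "Q * E * (C * (transpose_mat E * transpose_mat Q)) = Q * (E * (C * (transpose_mat E * transpose_mat Q)))"
    by (rule assoc_mult_mat[OF Q E mult_carrier_mat[OF psd_matsD(2)[OF C] EQ]])
  also have "E * (C * (transpose_mat E * transpose_mat Q)) = E * C * transpose_mat E * transpose_mat Q"
    using assoc_mult_mat[OF E psd_matsD(2)[OF C] EQ]
      assoc_mult_mat[OF mult_carrier_mat[OF E psd_matsD(2)[OF C]] Et Qt] by simp
  also have "Q * (E * C * transpose_mat E * transpose_mat Q) = Q * (E * C * transpose_mat E) * transpose_mat Q"
    by (rule assoc_mult_mat[OF Q mult_carrier_mat[OF mult_carrier_mat[OF E psd_matsD(2)[OF C]] Et] Qt, symmetric])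
  finally show "spQ sp i * Sigma_w s C (vchi V) * transpose_mat (spQ sp i) = B * transpose_mat B"
    by (simp add: Sigma_w_def E_def Q_def)
qed

lemma con_cov_iff:
  fixes V :: "('i, 'k::finite) fvars"
  assumes s: "is_lin_sys s" and chi: "vchi V \<in> pob_params s" and sp: "is_spec (n_w s) sp"
    and i: "i \<in> I4 sp" and C: "C \<in> psd_mats (n_eps s)"
  shows "con_cov s C sp i V \<longleftrightarrow> loewner_ge (spm sp i) (spSigma sp i)
     (spQ sp i * Sigma_w s C (vchi V) * transpose_mat (spQ sp i))"
proof -
  let ?B = "spQ sp i * matE s (vchi V) * psd_sqrt (n_eps s) C"
  note B = con_cov_eq_schur[OF assms]
  note S = is_specD(6)[OF sp i]
  have Bt: "transpose_mat ?B \<in> carrier_mat (n_eps s) (spm sp i)" using B(1) by simp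
  have "transpose_mat (?B * transpose_mat ?B) = ?B * transpose_mat ?B"
    using transpose_mult[OF B(1) Bt] by simp
  then have BB: "?B * transpose_mat ?B \<in> sym_mats (spm sp i)"
    using mult_carrier_mat[OF B(1) Bt] by (simp add: sym_mats_def)
  have "(transpose_mat ?B *\<^sub>v a) \<bullet> (transpose_mat ?B *\<^sub>v a) = a \<bullet> ((?B * transpose_mat ?B) *\<^sub>v a)"
    if "a \<in> carrier_vec (spm sp i)" for a
    using scalar_prod_mult_self[OF Bt that] by simp
  then show ?thesis
    unfolding B(2,3) schur_identity_block_iff[OF S B(1)] loewner_ge_iff[OF S BB] by simp
qed

section \<open>Convexity of the constraints\<close>

lemma fvars_mix_simps [simp]:
  "vchi (fvars_mix \<theta> V W) = pob_mix \<theta> (vchi V) (vchi W)"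
  "vX (fvars_mix \<theta> V W) i = (1 - \<theta>) \<cdot>\<^sub>m vX V i + \<theta> \<cdot>\<^sub>m vX W i"
  "vx (fvars_mix \<theta> V W) i = (1 - \<theta>) \<cdot>\<^sub>v vx V i + \<theta> \<cdot>\<^sub>v vx W i"
  "valpha (fvars_mix \<theta> V W) i = (1 - \<theta>) * valpha V i + \<theta> * valpha W i"
  "vdelta (fvars_mix \<theta> V W) i = (1 - \<theta>) * vdelta V i + \<theta> * vdelta W i"
  "vlambda (fvars_mix \<theta> V W) i = (1 - \<theta>) *\<^sub>R vlambda V i + \<theta> *\<^sub>R vlambda W i"
  by (simp_all add: fvars_mix_def pob_mix_def)

lemma sym_mats_mix:
  assumes "X \<in> sym_mats n" "Y \<in> sym_mats n"
  shows "(1 - \<theta>) \<cdot>\<^sub>m X + \<theta> \<cdot>\<^sub>m Y \<in> sym_mats n"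
  using sym_matsD(1)[OF assms(1)] sym_matsD(1)[OF assms(2)] sym_mats_index[OF assms(1)] sym_mats_index[OF assms(2)]
  by (intro sym_matsI_index) auto

lemma fvars_mix_dom:
  assumes "V \<in> fvars_dom s sp" "W \<in> fvars_dom s sp"
  shows "fvars_mix \<theta> V W \<in> fvars_dom s sp"
  using assms by (auto simp: fvars_dom_def pob_mix_params sym_mats_mix)

lemma fvars_domD:
  assumes "V \<in> fvars_dom s sp"
  shows "vchi V \<in> pob_params s" "\<And>i. i \<in> I1 sp \<union> I3 sp \<Longrightarrow> vX V i \<in> sym_mats (n_zeta s)"
    "\<And>i. i \<in> I1 sp \<union> I3 sp \<Longrightarrow> vx V i \<in> carrier_vec (n_zeta s)"
  using assms by (auto simp: fvars_dom_def)

lemma convex_constraintI: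
  assumes "\<And>V W \<theta>. V \<in> fvars_dom s sp \<Longrightarrow> W \<in> fvars_dom s sp \<Longrightarrow> c V \<Longrightarrow> c W \<Longrightarrow> 0 \<le> \<theta> \<Longrightarrow> \<theta> \<le> 1 \<Longrightarrow>
    c (fvars_mix \<theta> V W)"
  shows "convex_constraint (fvars_dom s sp) c"
  using assms fvars_mix_dom by (auto simp: convex_constraint_def)

lemma mix_le:
  fixes x y c :: real
  assumes "x \<le> c" "y \<le> c" "0 \<le> \<theta>" "\<theta> \<le> 1"
  shows "(1 - \<theta>) * x + \<theta> * y \<le> c"
  using convex_bound_le[OF assms(1,2), of "1 - \<theta>" \<theta>] assms(3,4) by simp

lemma quad_form_mat_mix:
  assumes "A \<in> carrier_mat n n" "B \<in> carrier_mat n n" "v \<in> carrier_vec n"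
  shows "v \<bullet> (((1 - \<theta>) \<cdot>\<^sub>m A + \<theta> \<cdot>\<^sub>m B) *\<^sub>v v) = (1 - \<theta>) * (v \<bullet> (A *\<^sub>v v)) + \<theta> * (v \<bullet> (B *\<^sub>v (v :: real vec)))"
  using assms mult_mat_vec_carrier[OF assms(1,3)] mult_mat_vec_carrier[OF assms(2,3)]
  by (simp add: mix_mat_mult_vec[OF assms] scalar_prod_add_distrib[of _ n])

text \<open>
  For a fixed vector \<open>[\<zeta>;\<tau>]\<close> the left-hand side is a convex function of \<open>\<chi>\<close>, namely a convex quadratic
  form composed with an affine map, and the right-hand side is linear in \<open>X\<close>, \<open>x\<close>, \<open>\<alpha>\<close>. This is
  why the matrix inequality is convex although \<open>Z[\<chi>]\<close> enters it quadratically.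
\<close>

lemma con_quad_iff:
  assumes s: "is_lin_sys s" and sp: "is_spec (n_w s) sp" and V: "V \<in> fvars_dom s sp"
    and i: "i \<in> I1 sp \<union> I3 sp"
  shows "con_quad s sp i V \<longleftrightarrow> (\<forall>\<zeta> \<in> carrier_vec (n_zeta s). \<forall>\<tau>.
    (matZ s (vchi V) *\<^sub>v (\<zeta> @\<^sub>v vec 1 (\<lambda>_. \<tau>))) \<bullet> (spA sp i *\<^sub>v (matZ s (vchi V) *\<^sub>v (\<zeta> @\<^sub>v vec 1 (\<lambda>_. \<tau>))))
    \<le> \<zeta> \<bullet> (vX V i *\<^sub>v \<zeta>) + 2 * \<tau> * (\<zeta> \<bullet> vx V i) + valpha V i * \<tau>\<^sup>2)" (is "_ \<longleftrightarrow> (\<forall>\<zeta> \<in> _. \<forall>\<tau>. ?le \<zeta> \<tau>)")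
proof -
  note chi = fvars_domD(1)[OF V] and X = fvars_domD(2)[OF V i] and x = fvars_domD(3)[OF V i]
  note Z = matZ_carrier[OF s chi] and A = is_specD(1)[OF sp i]
  have app: "\<zeta> @\<^sub>v vec 1 (\<lambda>_. \<tau>) \<in> carrier_vec (n_zeta s + 1)" if "\<zeta> \<in> carrier_vec (n_zeta s)" for \<zeta> and \<tau> :: real
    by (rule append_carrier_vec[OF that]) simp
  have dec: "\<exists>\<zeta> \<in> carrier_vec (n_zeta s). \<exists>\<tau>. v = \<zeta> @\<^sub>v vec 1 (\<lambda>_. \<tau>)"
    if v: "v \<in> carrier_vec (n_zeta s + 1)" for v :: "real vec"
  proof -
    obtain a d where ad: "a \<in> carrier_vec (n_zeta s)" "d \<in> carrier_vec 1" "v = a @\<^sub>v d"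
      using carrier_vec_add_cases[OF v] by blast
    have "d = vec 1 (\<lambda>_. d $ 0)" using ad(2) by (intro eq_vecI) auto
    with ad show ?thesis by metis
  qed
  show ?thesis
    unfolding con_quad_def loewner_ge_iff[OF bordered_sym[OF X x] sym_mats_congruence[OF psd_matsD(1)[OF A] Z]]
  proof (intro iffI ballI allI)
    fix \<zeta> :: "real vec" and \<tau> :: real
    assume *: "\<forall>v \<in> carrier_vec (n_zeta s + 1). v \<bullet> (transpose_mat (matZ s (vchi V)) * spA sp i * matZ s (vchi V) *\<^sub>v v)
        \<le> v \<bullet> (bordered (vX V i) (vx V i) (valpha V i) *\<^sub>v v)" and \<zeta>: "\<zeta> \<in> carrier_vec (n_zeta s)"
    show "?le \<zeta> \<tau>"
      using *[rule_format, OF app[OF \<zeta>, of \<tau>]]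
      unfolding quad_form_congruence[OF psd_matsD(2)[OF A] Z app[OF \<zeta>]] quad_form_bordered[OF sym_matsD(1)[OF X] x \<zeta>] .
  next
    fix v :: "real vec" assume v: "v \<in> carrier_vec (n_zeta s + 1)"
      and *: "\<forall>\<zeta> \<in> carrier_vec (n_zeta s). \<forall>\<tau>. ?le \<zeta> \<tau>"
    obtain \<zeta> \<tau> where \<zeta>: "\<zeta> \<in> carrier_vec (n_zeta s)" and v_eq: "v = \<zeta> @\<^sub>v vec 1 (\<lambda>_. \<tau>)"
      using dec[OF v] by blast
    show "v \<bullet> (transpose_mat (matZ s (vchi V)) * spA sp i * matZ s (vchi V) *\<^sub>v v)
        \<le> v \<bullet> (bordered (vX V i) (vx V i) (valpha V i) *\<^sub>v v)"
      unfolding v_eq quad_form_congruence[OF psd_matsD(2)[OF A] Z app[OF \<zeta>]] quad_form_bordered[OF sym_matsD(1)[OF X] x \<zeta>]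
      using * \<zeta> by blast
  qed
qed

lemma convex_con_quad:
  assumes s: "is_lin_sys s" and sp: "is_spec (n_w s) sp" and i: "i \<in> I1 sp \<union> I3 sp"
  shows "convex_constraint (fvars_dom s sp) (con_quad s sp i)"
proof (rule convex_constraintI)
  fix V W :: "('a, 'b) fvars" and \<theta> :: real
  assume V: "V \<in> fvars_dom s sp" and W: "W \<in> fvars_dom s sp"
    and cV: "con_quad s sp i V" and cW: "con_quad s sp i W" and \<theta>: "0 \<le> \<theta>" "\<theta> \<le> 1"
  let ?M = "fvars_mix \<theta> V W"
  note chi = fvars_domD(1)[OF V] fvars_domD(1)[OF W]
  note X = sym_matsD(1)[OF fvars_domD(2)[OF V i]] sym_matsD(1)[OF fvars_domD(2)[OF W i]]
    and x = fvars_domD(3)[OF V i] fvars_domD(3)[OF W i]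
  note Z = matZ_carrier[OF s chi(1)] matZ_carrier[OF s chi(2)] and A = is_specD(1)[OF sp i]
  show "con_quad s sp i ?M"
    unfolding con_quad_iff[OF s sp fvars_mix_dom[OF V W] i]
  proof (intro ballI allI)
    fix \<zeta> :: "real vec" and \<tau> :: real
    assume \<zeta>: "\<zeta> \<in> carrier_vec (n_zeta s)"
    define y where "y = \<zeta> @\<^sub>v vec 1 (\<lambda>_. \<tau>)"
    have y: "y \<in> carrier_vec (n_zeta s + 1)" unfolding y_def by (rule append_carrier_vec[OF \<zeta>]) simp
    define v where "v = matZ s (vchi V) *\<^sub>v y"
    define w where "w = matZ s (vchi W) *\<^sub>v y"
    have v: "v \<in> carrier_vec (n_w s)" and w: "w \<in> carrier_vec (n_w s)"
      unfolding v_def w_def by (rule mult_mat_vec_carrier[OF Z(1) y] mult_mat_vec_carrier[OF Z(2) y])+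
    have mix: "matZ s (vchi ?M) *\<^sub>v y = (1 - \<theta>) \<cdot>\<^sub>v v + \<theta> \<cdot>\<^sub>v w"
      unfolding v_def w_def fvars_mix_simps matZ_matE_mix(1)[OF s chi] by (rule mix_mat_mult_vec[OF Z y])
    have xm: "\<zeta> \<bullet> ((1 - \<theta>) \<cdot>\<^sub>v vx V i + \<theta> \<cdot>\<^sub>v vx W i) = (1 - \<theta>) * (\<zeta> \<bullet> vx V i) + \<theta> * (\<zeta> \<bullet> vx W i)"
      using x \<zeta> by (simp add: scalar_prod_add_distrib[of _ "n_zeta s"])
    have "((1 - \<theta>) \<cdot>\<^sub>v v + \<theta> \<cdot>\<^sub>v w) \<bullet> (spA sp i *\<^sub>v ((1 - \<theta>) \<cdot>\<^sub>v v + \<theta> \<cdot>\<^sub>v w))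
        \<le> (1 - \<theta>) * (v \<bullet> (spA sp i *\<^sub>v v)) + \<theta> * (w \<bullet> (spA sp i *\<^sub>v w))"
      by (rule quad_form_convex[OF A v w \<theta>])
    also have "\<dots> \<le> (1 - \<theta>) * (\<zeta> \<bullet> (vX V i *\<^sub>v \<zeta>) + 2 * \<tau> * (\<zeta> \<bullet> vx V i) + valpha V i * \<tau>\<^sup>2)
        + \<theta> * (\<zeta> \<bullet> (vX W i *\<^sub>v \<zeta>) + 2 * \<tau> * (\<zeta> \<bullet> vx W i) + valpha W i * \<tau>\<^sup>2)"
      using cV[unfolded con_quad_iff[OF s sp V i], rule_format, OF \<zeta>, of \<tau>]
        cW[unfolded con_quad_iff[OF s sp W i], rule_format, OF \<zeta>, of \<tau>] \<theta>
      unfolding v_def w_def y_def by (intro add_mono mult_left_mono) auto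
    also have "\<dots> = \<zeta> \<bullet> (vX ?M i *\<^sub>v \<zeta>) + 2 * \<tau> * (\<zeta> \<bullet> vx ?M i)
        + valpha ?M i * \<tau>\<^sup>2"
      unfolding fvars_mix_simps quad_form_mat_mix[OF X \<zeta>] xm by (simp add: algebra_simps)
    finally show "(matZ s (vchi ?M) *\<^sub>v (\<zeta> @\<^sub>v vec 1 (\<lambda>_. \<tau>)))
        \<bullet> (spA sp i *\<^sub>v (matZ s (vchi ?M) *\<^sub>v (\<zeta> @\<^sub>v vec 1 (\<lambda>_. \<tau>))))
      \<le> \<zeta> \<bullet> (vX ?M i *\<^sub>v \<zeta>) + 2 * \<tau> * (\<zeta> \<bullet> vx ?M i)
        + valpha ?M i * \<tau>\<^sup>2"
      unfolding y_def[symmetric] mix .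
  qed
qed

lemma mult_mat_mix:
  fixes A B E E' :: "real mat"
  assumes A: "A \<in> carrier_mat n m" and E: "E \<in> carrier_mat m k" and E': "E' \<in> carrier_mat m k"
    and B: "B \<in> carrier_mat k l"
  shows "A * ((1 - \<theta>) \<cdot>\<^sub>m E + \<theta> \<cdot>\<^sub>m E') * B = (1 - \<theta>) \<cdot>\<^sub>m (A * E * B) + \<theta> \<cdot>\<^sub>m (A * E' * B)"
proof -
  note AE = mult_carrier_mat[OF A E] and AE' = mult_carrier_mat[OF A E']
  have "A * ((1 - \<theta>) \<cdot>\<^sub>m E + \<theta> \<cdot>\<^sub>m E') = (1 - \<theta>) \<cdot>\<^sub>m (A * E) + \<theta> \<cdot>\<^sub>m (A * E')"
    using A E E' by (simp add: mult_add_distrib_mat[of _ n m _ k] mult_smult_distrib[of _ n m _ k])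
  also have "\<dots> * B = (1 - \<theta>) \<cdot>\<^sub>m (A * E * B) + \<theta> \<cdot>\<^sub>m (A * E' * B)"
    using AE AE' B by (simp add: add_mult_distrib_mat[of _ n k _ _ l] mult_smult_assoc_mat[of _ n k _ l])
  finally show ?thesis .
qed

lemma fro_norm_sq_convex:
  assumes A: "A \<in> carrier_mat n m" and B: "B \<in> carrier_mat n m" and \<theta>: "0 \<le> \<theta>" "\<theta> \<le> 1"
  shows "(fro_norm ((1 - \<theta>) \<cdot>\<^sub>m A + \<theta> \<cdot>\<^sub>m B))\<^sup>2 \<le> (1 - \<theta>) * (fro_norm A)\<^sup>2 + \<theta> * (fro_norm B)\<^sup>2"
proof -
  have sq: "((1 - \<theta>) * a + \<theta> * b)\<^sup>2 \<le> (1 - \<theta>) * a\<^sup>2 + \<theta> * b\<^sup>2" for a b :: real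
  proof -
    have "0 \<le> \<theta> * (1 - \<theta>) * (a - b)\<^sup>2" using \<theta> by simp
    then show ?thesis by (simp add: power2_eq_square algebra_simps)
  qed
  have "(fro_norm ((1 - \<theta>) \<cdot>\<^sub>m A + \<theta> \<cdot>\<^sub>m B))\<^sup>2 = (\<Sum>i<n. \<Sum>j<m. ((1 - \<theta>) * A $$ (i, j) + \<theta> * B $$ (i, j))\<^sup>2)"
    using A B by (simp add: fro_norm_sq)
  also have "\<dots> \<le> (\<Sum>i<n. \<Sum>j<m. (1 - \<theta>) * (A $$ (i, j))\<^sup>2 + \<theta> * (B $$ (i, j))\<^sup>2)"
    by (intro sum_mono sq)
  also have "\<dots> = (1 - \<theta>) * (fro_norm A)\<^sup>2 + \<theta> * (fro_norm B)\<^sup>2"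
    using A B by (simp add: fro_norm_sq sum.distrib sum_distrib_left)
  finally show ?thesis .
qed

lemma convex_con_budget1:
  assumes s: "is_lin_sys s" and sp: "is_spec (n_w s) sp" and i: "i \<in> I1 sp"
    and C: "C \<in> psd_mats (n_eps s)"
  shows "convex_constraint (fvars_dom s sp) (con_budget1 s C sp i)"
proof (rule convex_constraintI)
  fix V W :: "('a, 'b) fvars" and \<theta> :: real
  assume V: "V \<in> fvars_dom s sp" and W: "W \<in> fvars_dom s sp"
    and cV: "con_budget1 s C sp i V" and cW: "con_budget1 s C sp i W" and \<theta>: "0 \<le> \<theta>" "\<theta> \<le> 1"
  note chi = fvars_domD(1)[OF V] fvars_domD(1)[OF W]
  note E = matE_carrier[OF s chi(1)] matE_carrier[OF s chi(2)]
  have i13: "i \<in> I1 sp \<union> I3 sp" using i by simp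
  define H where "H = psd_sqrt (n_w s) (spA sp i)"
  define R where "R = psd_sqrt (n_eps s) C"
  have H: "H \<in> carrier_mat (n_w s) (n_w s)"
    unfolding H_def by (rule psd_matsD(2)[OF psd_sqrt(1)[OF is_specD(1)[OF sp i13]]])
  have R: "R \<in> carrier_mat (n_eps s) (n_eps s)"
    unfolding R_def by (rule psd_matsD(2)[OF psd_sqrt(1)[OF C]])
  define L where "L chi = H * matE s chi * R" for chi
  have L: "L (vchi V) \<in> carrier_mat (n_w s) (n_eps s)" "L (vchi W) \<in> carrier_mat (n_w s) (n_eps s)"
    unfolding L_def using mult_carrier_mat[OF mult_carrier_mat[OF H E(1)] R]
      mult_carrier_mat[OF mult_carrier_mat[OF H E(2)] R] by auto
  have "L (pob_mix \<theta> (vchi V) (vchi W)) = (1 - \<theta>) \<cdot>\<^sub>m L (vchi V) + \<theta> \<cdot>\<^sub>m L (vchi W)"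
    unfolding L_def matZ_matE_mix(2)[OF s chi] by (rule mult_mat_mix[OF H E R])
  then have "(fro_norm (L (pob_mix \<theta> (vchi V) (vchi W))))\<^sup>2
      \<le> (1 - \<theta>) * (fro_norm (L (vchi V)))\<^sup>2 + \<theta> * (fro_norm (L (vchi W)))\<^sup>2"
    using fro_norm_sq_convex[OF L \<theta>] by simp
  moreover have "(1 - \<theta>) * (valpha V i + vdelta V i + (fro_norm (L (vchi V)))\<^sup>2 + r_const sp i)
      + \<theta> * (valpha W i + vdelta W i + (fro_norm (L (vchi W)))\<^sup>2 + r_const sp i) \<le> spgamma sp i"
    using cV cW unfolding con_budget1_def L_def H_def R_def by (intro mix_le \<theta>)
  ultimately show "con_budget1 s C sp i (fvars_mix \<theta> V W)"
    unfolding con_budget1_def fvars_mix_simps H_def[symmetric] R_def[symmetric] L_def[symmetric]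
    by (simp add: algebra_simps)
qed

lemma convex_con_budget3: "convex_constraint (fvars_dom s sp) (con_budget3 sp i)"
proof (rule convex_constraintI)
  fix V W :: "('a, 'b) fvars" and \<theta> :: real
  assume "con_budget3 sp i V" "con_budget3 sp i W" and \<theta>: "0 \<le> \<theta>" "\<theta> \<le> 1"
  then have "(1 - \<theta>) * (valpha V i + vdelta V i + r_const sp i)
      + \<theta> * (valpha W i + vdelta W i + r_const sp i) \<le> spgamma sp i"
    unfolding con_budget3_def by (intro mix_le)
  then show "con_budget3 sp i (fvars_mix \<theta> V W)" by (simp add: con_budget3_def algebra_simps)
qed

lemma convex_con_lambda: "convex_constraint (fvars_dom s sp) (con_lambda i)"
  by (rule convex_constraintI) (auto simp: con_lambda_def intro!: add_nonneg_nonneg scaleR_nonneg_nonneg)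

lemma convex_con_lin:
  fixes D :: "'k::finite ellitope"
  assumes s: "is_lin_sys s" and sp: "is_spec (n_w s) sp" and i: "i \<in> I2 sp"
    and D: "is_ellitope (n_zeta s) D"
  shows "convex_constraint (fvars_dom s sp) (con_lin s D sp i)"
proof (rule convex_constraintI)
  fix V W :: "('a, 'k) fvars" and \<theta> :: real
  assume V: "V \<in> fvars_dom s sp" and W: "W \<in> fvars_dom s sp"
    and cV: "con_lin s D sp i V" and cW: "con_lin s D sp i W" and \<theta>: "0 \<le> \<theta>" "\<theta> \<le> 1"
  let ?M = "fvars_mix \<theta> V W"
  note chi = fvars_domD(1)[OF V] fvars_domD(1)[OF W]
  have i': "i \<in> I1 sp \<union> I2 sp \<union> I3 sp" using i by simp
  define n where "n = dim_z D"
  note Dd = is_ellitopeD[OF D, folded n_def]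
  have Pt: "transpose_mat (ell_P D) \<in> carrier_mat n (n_zeta s)" using Dd(1) by simp
  define c where "c chi = - (transpose_mat (ell_P D) *\<^sub>v vec_p s sp chi i)" for chi
  have c: "c chi \<in> carrier_vec n" if "chi \<in> pob_params s" for chi
    unfolding c_def using mult_mat_vec_carrier[OF Pt vec_p_carrier[OF s that sp i']] by simp
  have c_mix: "c (pob_mix \<theta> (vchi V) (vchi W)) = (1 - \<theta>) \<cdot>\<^sub>v c (vchi V) + \<theta> \<cdot>\<^sub>v c (vchi W)"
  proof -
    note p = vec_p_carrier[OF s chi(1) sp i'] vec_p_carrier[OF s chi(2) sp i']
    have "- ((1 - \<theta>) \<cdot>\<^sub>v a + \<theta> \<cdot>\<^sub>v b) = (1 - \<theta>) \<cdot>\<^sub>v (- a) + \<theta> \<cdot>\<^sub>v (- b)"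
      if "a \<in> carrier_vec n" "b \<in> carrier_vec n" for a b :: "real vec"
      using that by (intro eq_vecI) (auto simp: algebra_simps)
    then show ?thesis
      unfolding c_def vec_p_real_q_mix(1)[OF s chi sp i'] mult_mat_vec_mix[OF Pt p]
      using mult_mat_vec_carrier[OF Pt p(1)] mult_mat_vec_carrier[OF Pt p(2)] by blast
  qed
  define S where "S l = sum_mat n (\<lambda>k. vec_nth l k \<cdot>\<^sub>m ell_S D k)" for l
  have S: "S l \<in> sym_mats n" for l
    unfolding S_def using psd_matsD(2)[OF Dd(2)] carrier_matD[OF psd_matsD(2)[OF Dd(2)]]
      sym_mats_index[OF psd_matsD(1)[OF Dd(2)]]
    by (intro sum_mat_sym sym_matsI_index) auto
  have con_iff: "con_lin s D sp i V \<longleftrightarrow> (\<forall>\<tau>. \<forall>z \<in> carrier_vec n.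
      0 \<le> valpha V i * \<tau>\<^sup>2 + 2 * \<tau> * (c (vchi V) \<bullet> z) + z \<bullet> (S (vlambda V i) *\<^sub>v z))"
    if "vchi V \<in> pob_params s" for V
    unfolding con_lin_def n_def[symmetric] S_def[symmetric] c_def[symmetric]
    by (rule bordered_tl_psd_iff[OF S c[OF that]])
  show "con_lin s D sp i ?M"
    unfolding con_iff[OF fvars_domD(1)[OF fvars_mix_dom[OF V W]]]
  proof (intro allI ballI)
    fix \<tau> :: real and z :: "real vec" assume z: "z \<in> carrier_vec n"
    have 1: "c (vchi ?M) \<bullet> z = (1 - \<theta>) * (c (vchi V) \<bullet> z) + \<theta> * (c (vchi W) \<bullet> z)"
      using c[OF chi(1)] c[OF chi(2)] z by (simp add: c_mix add_scalar_prod_distrib[of _ n])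
    have 2: "z \<bullet> (S (vlambda ?M i) *\<^sub>v z)
        = (1 - \<theta>) * (z \<bullet> (S (vlambda V i) *\<^sub>v z)) + \<theta> * (z \<bullet> (S (vlambda W i) *\<^sub>v z))"
      unfolding S_def quad_form_weighted_sum_mat[OF psd_matsD(2)[OF Dd(2)] z]
      by (simp add: sum_distrib_left distrib_right mult.assoc sum.distrib)
    have "0 \<le> (1 - \<theta>) * (valpha V i * \<tau>\<^sup>2 + 2 * \<tau> * (c (vchi V) \<bullet> z) + z \<bullet> (S (vlambda V i) *\<^sub>v z))
        + \<theta> * (valpha W i * \<tau>\<^sup>2 + 2 * \<tau> * (c (vchi W) \<bullet> z) + z \<bullet> (S (vlambda W i) *\<^sub>v z))"
      using cV[unfolded con_iff[OF chi(1)]] cW[unfolded con_iff[OF chi(2)]] z \<theta>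
      by (intro add_nonneg_nonneg[OF mult_nonneg_nonneg mult_nonneg_nonneg]) auto
    then show "0 \<le> valpha ?M i * \<tau>\<^sup>2 + 2 * \<tau> * (c (vchi ?M) \<bullet> z)
        + z \<bullet> (S (vlambda ?M i) *\<^sub>v z)"
      unfolding 1 2 by (simp add: algebra_simps)
  qed
qed

lemma convex_con_budget2:
  fixes D :: "'k::finite ellitope"
  assumes s: "is_lin_sys s" and sp: "is_spec (n_w s) sp" and i: "i \<in> I2 sp"
    and D: "is_ellitope (n_zeta s) D" and \<rho>: "\<rho> > 0"
  shows "convex_constraint (fvars_dom s sp) (con_budget2 s D \<rho> sp i)"
proof (rule convex_constraintI)
  fix V W :: "('a, 'k) fvars" and \<theta> :: real
  assume V: "V \<in> fvars_dom s sp" and W: "W \<in> fvars_dom s sp"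
    and cV: "con_budget2 s D \<rho> sp i V" and cW: "con_budget2 s D \<rho> sp i W" and \<theta>: "0 \<le> \<theta>" "\<theta> \<le> 1"
  note chi = fvars_domD(1)[OF V] fvars_domD(1)[OF W]
  have i': "i \<in> I1 sp \<union> I2 sp \<union> I3 sp" using i by simp
  let ?phi = "phi_T (ell_T D)"
  have "\<rho> * ?phi (vlambda (fvars_mix \<theta> V W) i) \<le> \<rho> * ((1 - \<theta>) * ?phi (vlambda V i) + \<theta> * ?phi (vlambda W i))"
    using phi_T_convex[OF is_ellitopeD(5,3)[OF D] \<theta>] \<rho> by (intro mult_left_mono) auto
  moreover have "(1 - \<theta>) * (valpha V i + \<rho> * ?phi (vlambda V i) + real_q s sp (vchi V) i)
      + \<theta> * (valpha W i + \<rho> * ?phi (vlambda W i) + real_q s sp (vchi W) i) \<le> spgamma sp i"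
    using cV cW unfolding con_budget2_def by (intro mix_le \<theta>)
  ultimately show "con_budget2 s D \<rho> sp i (fvars_mix \<theta> V W)"
    by (simp add: con_budget2_def vec_p_real_q_mix(2)[OF s chi sp i'] algebra_simps)
qed

lemma convex_con_cov:
  assumes s: "is_lin_sys s" and sp: "is_spec (n_w s) sp" and i: "i \<in> I4 sp"
    and C: "C \<in> psd_mats (n_eps s)"
  shows "convex_constraint (fvars_dom s sp) (con_cov s C sp i)"
proof (rule convex_constraintI)
  fix V W :: "('a, 'b) fvars" and \<theta> :: real
  assume V: "V \<in> fvars_dom s sp" and W: "W \<in> fvars_dom s sp"
    and cV: "con_cov s C sp i V" and cW: "con_cov s C sp i W" and \<theta>: "0 \<le> \<theta>" "\<theta> \<le> 1"
  note chi = fvars_domD(1)[OF V] fvars_domD(1)[OF W]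
  note E = matE_carrier[OF s chi(1)] matE_carrier[OF s chi(2)]
  let ?m = "spm sp i" and ?n = "n_eps s"
  define R where "R = psd_sqrt ?n C"
  have R: "R \<in> carrier_mat ?n ?n"
    unfolding R_def by (rule psd_matsD(2)[OF psd_sqrt(1)[OF C]])
  define B where "B chi = spQ sp i * matE s chi * R" for chi
  have Bc: "B (vchi V) \<in> carrier_mat ?m ?n" if "vchi V \<in> pob_params s" for V :: "('a, 'b) fvars"
    unfolding B_def R_def by (rule con_cov_eq_schur(1)[OF s that sp i C])
  have I: "1\<^sub>m ?n \<in> sym_mats ?n" by (simp add: sym_mats_def)
  have con_iff: "con_cov s C sp i V \<longleftrightarrow> (\<forall>a \<in> carrier_vec ?m. \<forall>d \<in> carrier_vec ?n.
       0 \<le> a \<bullet> (spSigma sp i *\<^sub>v a) + 2 * (a \<bullet> (B (vchi V) *\<^sub>v d)) + d \<bullet> (1\<^sub>m ?n *\<^sub>v d))"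
    if "vchi V \<in> pob_params s" for V :: "('a, 'b) fvars"
    unfolding con_cov_eq_schur(2)[OF s that sp i C] B_def[symmetric] R_def[symmetric]
    by (rule psd_four_block_iff[OF is_specD(6)[OF sp i] Bc[OF that] I])
  have B_mix: "B (pob_mix \<theta> (vchi V) (vchi W)) = (1 - \<theta>) \<cdot>\<^sub>m B (vchi V) + \<theta> \<cdot>\<^sub>m B (vchi W)"
    unfolding B_def matZ_matE_mix(2)[OF s chi] by (rule mult_mat_mix[OF is_specD(5)[OF sp i] E R])
  show "con_cov s C sp i (fvars_mix \<theta> V W)"
    unfolding con_iff[OF fvars_domD(1)[OF fvars_mix_dom[OF V W]]]
  proof (intro ballI)
    fix a d :: "real vec" assume a: "a \<in> carrier_vec ?m" and d: "d \<in> carrier_vec ?n"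
    have 1: "a \<bullet> (B (vchi (fvars_mix \<theta> V W)) *\<^sub>v d)
        = (1 - \<theta>) * (a \<bullet> (B (vchi V) *\<^sub>v d)) + \<theta> * (a \<bullet> (B (vchi W) *\<^sub>v d))"
      unfolding fvars_mix_simps B_mix mix_mat_mult_vec[OF Bc[OF chi(1)] Bc[OF chi(2)] d]
      using a mult_mat_vec_carrier[OF Bc[OF chi(1)] d] mult_mat_vec_carrier[OF Bc[OF chi(2)] d]
      by (simp add: scalar_prod_add_distrib[of _ ?m])
    define c where "c = a \<bullet> (spSigma sp i *\<^sub>v a) + d \<bullet> (1\<^sub>m ?n *\<^sub>v d)"
    have "0 \<le> (1 - \<theta>) * (c + 2 * (a \<bullet> (B (vchi V) *\<^sub>v d))) + \<theta> * (c + 2 * (a \<bullet> (B (vchi W) *\<^sub>v d)))"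
      using cV[unfolded con_iff[OF chi(1)], rule_format, OF a d] cW[unfolded con_iff[OF chi(2)], rule_format, OF a d] \<theta>
      by (intro add_nonneg_nonneg[OF mult_nonneg_nonneg mult_nonneg_nonneg]) (auto simp: c_def)
    also have "\<dots> = c + 2 * (a \<bullet> (B (vchi (fvars_mix \<theta> V W)) *\<^sub>v d))"
      unfolding 1 by (simp add: algebra_simps)
    finally show "0 \<le> a \<bullet> (spSigma sp i *\<^sub>v a) + 2 * (a \<bullet> (B (vchi (fvars_mix \<theta> V W)) *\<^sub>v d)) + d \<bullet> (1\<^sub>m ?n *\<^sub>v d)"
      by (simp add: c_def)
  qed
qed

lemma convex_con_robust:
  fixes D :: "'k::finite ellitope"
  assumes s: "is_lin_sys s" and sp: "is_spec (n_w s) sp" and i: "i \<in> I1 sp \<union> I3 sp"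
    and D: "is_ellitope (n_zeta s) D"
  shows "convex_constraint (fvars_dom s sp) (con_robust s D \<rho> sp i)"
proof (rule convex_constraintI)
  fix V W :: "('a, 'k) fvars" and \<theta> :: real
  assume V: "V \<in> fvars_dom s sp" and W: "W \<in> fvars_dom s sp"
    and cV: "con_robust s D \<rho> sp i V" and cW: "con_robust s D \<rho> sp i W" and \<theta>: "0 \<le> \<theta>" "\<theta> \<le> 1"
  let ?M = "fvars_mix \<theta> V W"
  note chi = fvars_domD(1)[OF V] fvars_domD(1)[OF W]
  note X = sym_matsD(1)[OF fvars_domD(2)[OF V i]] sym_matsD(1)[OF fvars_domD(2)[OF W i]]
    and x = fvars_domD(3)[OF V i] fvars_domD(3)[OF W i]
  have i': "i \<in> I1 sp \<union> I2 sp \<union> I3 sp" using i by auto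
  note p = vec_p_carrier[OF s chi(1) sp i'] vec_p_carrier[OF s chi(2) sp i']
  show "con_robust s D \<rho> sp i ?M"
    unfolding con_robust_def
  proof
    fix \<zeta> assume \<zeta>D: "\<zeta> \<in> ell_set D \<rho>"
    note \<zeta> = ell_set_carrier[OF D \<zeta>D]
    define f where "f V = \<zeta> \<bullet> (vX V i *\<^sub>v \<zeta>) + 2 * (\<zeta> \<bullet> (vx V i + vec_p s sp (vchi V) i)) + real_q s sp (vchi V) i"
      for V :: "('a, 'k) fvars"
    have "f V - vdelta V i \<le> 0" "f W - vdelta W i \<le> 0"
      using cV cW \<zeta>D by (auto simp: con_robust_def f_def algebra_simps)
    then have "(1 - \<theta>) * (f V - vdelta V i) + \<theta> * (f W - vdelta W i) \<le> 0"
      by (intro mix_le \<theta>)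
    moreover have "f ?M = (1 - \<theta>) * f V + \<theta> * f W"
      unfolding f_def fvars_mix_simps vec_p_real_q_mix[OF s chi sp i'] quad_form_mat_mix[OF X \<zeta>]
      using \<zeta> x p by (simp add: scalar_prod_add_distrib[of _ "n_zeta s"] algebra_simps)
    ultimately show "\<zeta> \<bullet> (vX ?M i *\<^sub>v \<zeta>)
        + 2 * (\<zeta> \<bullet> (vx ?M i + vec_p s sp (vchi ?M) i))
      \<le> vdelta ?M i - real_q s sp (vchi ?M) i"
      by (simp add: f_def algebra_simps)
  qed
qed

section \<open>Specifications and feasible extensions\<close>

lemma F_solutions_iff:
  "V \<in> F_solutions s C D \<rho> sp \<longleftrightarrow> V \<in> fvars_dom s sp \<and>
     (\<forall>i \<in> I1 sp \<union> I3 sp. con_quad s sp i V \<and> con_robust s D \<rho> sp i V) \<and>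
     (\<forall>i \<in> I1 sp. con_budget1 s C sp i V) \<and> (\<forall>i \<in> I3 sp. con_budget3 sp i V) \<and>
     (\<forall>i \<in> I2 sp. con_lambda i V \<and> con_lin s D sp i V \<and> con_budget2 s D \<rho> sp i V) \<and>
     (\<forall>i \<in> I4 sp. con_cov s C sp i V)"
  unfolding F_solutions_def F_constraints_def by (simp add: ball_Un ball_conj_distrib) blast

text \<open>
  The quadratic specifications of both kinds differ only in this term, which is present for the
  specifications on the expectation over the noise.
\<close>

definition noise_penalty :: "lin_sys \<Rightarrow> real mat \<Rightarrow> 'i spec \<Rightarrow> pob \<Rightarrow> 'i \<Rightarrow> real" where
  "noise_penalty s C sp chi i = (if i \<in> I1 sp
     then (fro_norm (psd_sqrt (n_w s) (spA sp i) * matE s chi * psd_sqrt (n_eps s) C))\<^sup>2 else 0)"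

text \<open>
  The constraints of the feasibility problem at a single index, as a condition on the values of the
  additional variables there. Distinct indices share only \<open>\<chi>\<close>, so values can be chosen
  index by index.
\<close>

definition quad_certificate ::
    "lin_sys \<Rightarrow> real mat \<Rightarrow> 'k::finite ellitope \<Rightarrow> real \<Rightarrow> 'i spec \<Rightarrow> pob \<Rightarrow> 'i
      \<Rightarrow> real mat \<Rightarrow> real vec \<Rightarrow> real \<Rightarrow> real \<Rightarrow> bool" where
  "quad_certificate s C D \<rho> sp chi i X x \<alpha> \<delta> \<longleftrightarrow> X \<in> sym_mats (n_zeta s) \<and> x \<in> carrier_vec (n_zeta s) \<and>
     loewner_ge (n_zeta s + 1) (bordered X x \<alpha>) (transpose_mat (matZ s chi) * spA sp i * matZ s chi) \<and>
     (\<forall>\<zeta> \<in> ell_set D \<rho>. \<zeta> \<bullet> (X *\<^sub>v \<zeta>) + 2 * (\<zeta> \<bullet> (x + vec_p s sp chi i)) \<le> \<delta> - real_q s sp chi i) \<and>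
     \<alpha> + \<delta> + noise_penalty s C sp chi i + r_const sp i \<le> spgamma sp i"

definition linear_certificate ::
    "lin_sys \<Rightarrow> 'k::finite ellitope \<Rightarrow> real \<Rightarrow> 'i spec \<Rightarrow> pob \<Rightarrow> 'i \<Rightarrow> real ^ 'k \<Rightarrow> real \<Rightarrow> bool" where
  "linear_certificate s D \<rho> sp chi i l \<alpha> \<longleftrightarrow> 0 \<le> l \<and>
     bordered_tl \<alpha> (- (transpose_mat (ell_P D) *\<^sub>v vec_p s sp chi i))
       (sum_mat (dim_z D) (\<lambda>k. vec_nth l k \<cdot>\<^sub>m ell_S D k)) \<in> psd_mats (1 + dim_z D) \<and>
     \<alpha> + \<rho> * phi_T (ell_T D) l + real_q s sp chi i \<le> spgamma sp i"

lemma F_solutions_iff_certificate: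
  assumes sp: "is_spec (n_w s) sp" and chi: "vchi V \<in> pob_params s"
  shows "V \<in> F_solutions s C D \<rho> sp \<longleftrightarrow>
    (\<forall>i \<in> I1 sp \<union> I3 sp. quad_certificate s C D \<rho> sp (vchi V) i (vX V i) (vx V i) (valpha V i) (vdelta V i)) \<and>
    (\<forall>i \<in> I2 sp. linear_certificate s D \<rho> sp (vchi V) i (vlambda V i) (valpha V i)) \<and>
    (\<forall>i \<in> I4 sp. con_cov s C sp i V)"
proof -
  have "i \<notin> I1 sp" if "i \<in> I3 sp" for i using sp that by (auto simp: is_spec_def)
  then show ?thesis
    unfolding F_solutions_iff fvars_dom_def quad_certificate_def linear_certificate_def con_quad_def
      con_robust_def con_budget1_def con_budget3_def con_lambda_def con_lin_def con_budget2_def noise_penalty_def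
    using chi by auto
qed

text \<open>
  The additional variables are assembled from certificates chosen separately for each index. The
  variable \<open>\<alpha>\<^sub>i\<close> occurs in certificates of both kinds; this is consistent as the index sets are disjoint.
\<close>

lemma F_extension_iff:
  fixes D :: "'k::finite ellitope" and sp :: "'i spec"
  assumes s: "is_lin_sys s" and sp: "is_spec (n_w s) sp" and chi: "chi \<in> pob_params s"
    and C: "C \<in> psd_mats (n_eps s)"
  shows "(\<exists>V \<in> F_solutions s C D \<rho> sp. vchi V = chi) \<longleftrightarrow>
    (\<forall>i \<in> I1 sp \<union> I3 sp. \<exists>X x \<alpha> \<delta>. quad_certificate s C D \<rho> sp chi i X x \<alpha> \<delta>) \<and>
    (\<forall>i \<in> I2 sp. \<exists>l \<alpha>. linear_certificate s D \<rho> sp chi i l \<alpha>) \<and>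
    (\<forall>i \<in> I4 sp. loewner_ge (spm sp i) (spSigma sp i)
       (spQ sp i * Sigma_w s C chi * transpose_mat (spQ sp i)))" (is "?l \<longleftrightarrow> ?r")
proof
  assume ?l
  then obtain V where V: "V \<in> F_solutions s C D \<rho> sp" "vchi V = chi" by blast
  have cov: "\<forall>i \<in> I4 sp. con_cov s C sp i V"
    and cert: "\<forall>i \<in> I1 sp \<union> I3 sp. quad_certificate s C D \<rho> sp chi i (vX V i) (vx V i) (valpha V i) (vdelta V i)"
      "\<forall>i \<in> I2 sp. linear_certificate s D \<rho> sp chi i (vlambda V i) (valpha V i)"
    using V F_solutions_iff_certificate[OF sp, of V C D \<rho>] chi by auto
  have "loewner_ge (spm sp i) (spSigma sp i) (spQ sp i * Sigma_w s C chi * transpose_mat (spQ sp i))"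
    if "i \<in> I4 sp" for i
    using cov that con_cov_iff[OF s _ sp that C, of V] V(2) chi by simp
  with cert show ?r by blast
next
  assume r: ?r
  have "\<forall>i. \<exists>X x \<alpha> \<delta>. i \<in> I1 sp \<union> I3 sp \<longrightarrow> quad_certificate s C D \<rho> sp chi i X x \<alpha> \<delta>"
    using r by blast
  then obtain X x \<alpha> \<delta> where q: "\<And>i. i \<in> I1 sp \<union> I3 sp \<Longrightarrow> quad_certificate s C D \<rho> sp chi i (X i) (x i) (\<alpha> i) (\<delta> i)"
    by metis
  have "\<forall>i. \<exists>l \<alpha>. i \<in> I2 sp \<longrightarrow> linear_certificate s D \<rho> sp chi i l \<alpha>"
    using r by blast
  then obtain l \<alpha>' where l: "\<And>i. i \<in> I2 sp \<Longrightarrow> linear_certificate s D \<rho> sp chi i (l i) (\<alpha>' i)"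
    by metis
  define V :: "('i, 'k) fvars" where
    "V = \<lparr>vchi = chi, vX = X, vx = x, valpha = (\<lambda>i. if i \<in> I2 sp then \<alpha>' i else \<alpha> i), vdelta = \<delta>, vlambda = l\<rparr>"
  have V_chi: "vchi V = chi" by (simp add: V_def)
  have "V \<in> F_solutions s C D \<rho> sp"
    unfolding F_solutions_iff_certificate[OF sp, of V C D \<rho>, unfolded V_chi, OF chi]
  proof (intro conjI ballI)
    fix i assume i: "i \<in> I1 sp \<union> I3 sp"
    then show "quad_certificate s C D \<rho> sp chi i (vX V i) (vx V i) (valpha V i) (vdelta V i)"
      using q[OF i] is_specD(3)[OF sp i] by (simp add: V_def)
  next
    fix i assume i: "i \<in> I2 sp"
    then show "linear_certificate s D \<rho> sp chi i (vlambda V i) (valpha V i)"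
      using l by (simp add: V_def)
  next
    fix i assume i: "i \<in> I4 sp"
    then show "con_cov s C sp i V"
      using r con_cov_iff[OF s _ sp i C, of V] V_chi chi by simp
  qed
  with V_chi show ?l by blast
qed

theorem corollary1:
  fixes s :: lin_sys
    and M :: "'a measure" and eps :: "'a \<Rightarrow> real vec" and Cov :: "real mat"
    and D :: "'k::finite ellitope" and \<rho> :: real
    and sp :: "'i spec"
  assumes "is_lin_sys s"
    and "prob_space M"
    and "square_integrable_vec M (n_eps s) eps"
    and "mean_vec M (n_eps s) eps = 0\<^sub>v (n_eps s)"
    and "cov_mat M (n_eps s) eps = Cov"
    and "is_ellitope (n_zeta s) D"
    and "\<rho> > 0"
    and "is_spec (n_w s) sp"
  shows "(\<forall>chi \<in> pob_params s. meets_spec s M eps Cov D \<rho> sp chi \<longleftrightarrow>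
            (\<exists>V \<in> F_solutions s Cov D \<rho> sp. vchi V = chi)) \<and>
         (\<forall>c \<in> F_constraints s Cov D \<rho> sp. convex_constraint (fvars_dom s sp) c)"
proof (intro conjI ballI)
  note s = assms(1) and D = assms(6) and \<rho> = assms(7) and sp = assms(8)
  interpret centered_noise M "n_eps s" eps Cov
    using assms(2-5) by (simp add: centered_noise_def centered_noise_axioms_def)
  {
    fix chi assume chi: "chi \<in> pob_params s"
    note Z = matZ_carrier[OF s chi] and E = matE_carrier[OF s chi]
    define w where "w \<zeta> = matZ s chi *\<^sub>v append_one \<zeta>" for \<zeta>
    have w: "w \<zeta> \<in> carrier_vec (n_w s)" if "\<zeta> \<in> ell_set D \<rho>" for \<zeta>
      unfolding w_def by (rule mult_mat_vec_carrier[OF Z append_one_carrier[OF ell_set_carrier[OF D that]]])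
    have traj: "traj s chi \<zeta> (eps \<omega>) = w \<zeta> + matE s chi *\<^sub>v eps \<omega>"
      if "\<zeta> \<in> ell_set D \<rho>" "\<omega> \<in> space M" for \<zeta> \<omega>
      unfolding w_def by (rule traj_eq_matZ_matE[OF s chi ell_set_carrier[OF D that(1)] eps_carrier[OF that(2)]])
    have mu: "mu_w s M eps chi \<zeta> = w \<zeta>" if "\<zeta> \<in> ell_set D \<rho>" for \<zeta>
      unfolding mu_w_def by (rule mean_affine[OF w[OF that] E traj[OF that]])
    have expect: "expectation (\<lambda>\<omega>. (spA sp i *\<^sub>v (traj s chi \<zeta> (eps \<omega>) - spbeta sp i))
          \<bullet> (traj s chi \<zeta> (eps \<omega>) - spbeta sp i))
        = (spA sp i *\<^sub>v (w \<zeta> - spbeta sp i)) \<bullet> (w \<zeta> - spbeta sp i) + noise_penalty s Cov sp chi i"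
      if \<zeta>: "\<zeta> \<in> ell_set D \<rho>" and i: "i \<in> I1 sp" for \<zeta> i
    proof -
      have i13: "i \<in> I1 sp \<union> I3 sp" using i by simp
      note A = is_specD(1)[OF sp i13] and b = is_specD(2)[OF sp i13]
      have regroup: "a + e - b' = (a - b') + e"
        if "a \<in> carrier_vec k" "b' \<in> carrier_vec k" "e \<in> carrier_vec k" for a b' e :: "real vec" and k
        using that by (intro eq_vecI) auto
      have g: "w \<zeta> - spbeta sp i \<in> carrier_vec (n_w s)" using w[OF \<zeta>] b by simp
      have "traj s chi \<zeta> (eps \<omega>) - spbeta sp i = (w \<zeta> - spbeta sp i) + matE s chi *\<^sub>v eps \<omega>"
        if "\<omega> \<in> space M" for \<omega>
        unfolding traj[OF \<zeta> that]
        by (rule regroup[OF w[OF \<zeta>] b mult_mat_vec_carrier[OF E eps_carrier[OF that]]])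
      then have "expectation (\<lambda>\<omega>. (spA sp i *\<^sub>v (traj s chi \<zeta> (eps \<omega>) - spbeta sp i))
          \<bullet> (traj s chi \<zeta> (eps \<omega>) - spbeta sp i))
        = expectation (\<lambda>\<omega>. (spA sp i *\<^sub>v ((w \<zeta> - spbeta sp i) + matE s chi *\<^sub>v eps \<omega>))
          \<bullet> ((w \<zeta> - spbeta sp i) + matE s chi *\<^sub>v eps \<omega>))"
        by (intro Bochner_Integration.integral_cong refl) simp
      then show ?thesis
        unfolding expectation_quad_form_affine[OF A g E] using i by (simp add: noise_penalty_def)
    qed
    have quad: "(\<forall>\<zeta> \<in> ell_set D \<rho>. (spA sp i *\<^sub>v (w \<zeta> - spbeta sp i)) \<bullet> (w \<zeta> - spbeta sp i)
          + noise_penalty s Cov sp chi i \<le> spgamma sp i)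
        \<longleftrightarrow> (\<exists>X x \<alpha> \<delta>. quad_certificate s Cov D \<rho> sp chi i X x \<alpha> \<delta>)"
      if "i \<in> I1 sp \<union> I3 sp" for i
      unfolding w_def quad_certificate_def by (rule robust_quad_iff[OF s chi sp that ell_set_carrier[OF D]])
    have q1: "(\<forall>\<zeta> \<in> ell_set D \<rho>. expectation (\<lambda>\<omega>. (spA sp i *\<^sub>v (traj s chi \<zeta> (eps \<omega>) - spbeta sp i))
          \<bullet> (traj s chi \<zeta> (eps \<omega>) - spbeta sp i)) \<le> spgamma sp i)
        \<longleftrightarrow> (\<exists>X x \<alpha> \<delta>. quad_certificate s Cov D \<rho> sp chi i X x \<alpha> \<delta>)" if i: "i \<in> I1 sp" for i
      using quad[of i] i by (simp add: expect)
    have q3: "(\<forall>\<zeta> \<in> ell_set D \<rho>. (spA sp i *\<^sub>v (mu_w s M eps chi \<zeta> - spbeta sp i))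
          \<bullet> (mu_w s M eps chi \<zeta> - spbeta sp i) \<le> spgamma sp i)
        \<longleftrightarrow> (\<exists>X x \<alpha> \<delta>. quad_certificate s Cov D \<rho> sp chi i X x \<alpha> \<delta>)" if i: "i \<in> I3 sp" for i
    proof -
      have "i \<notin> I1 sp" using sp i by (auto simp: is_spec_def)
      then show ?thesis using quad[of i] i by (simp add: mu noise_penalty_def)
    qed
    have q2: "(\<forall>\<zeta> \<in> ell_set D \<rho>. spa sp i \<bullet> mu_w s M eps chi \<zeta> \<le> spgamma sp i)
        \<longleftrightarrow> (\<exists>l \<alpha>. linear_certificate s D \<rho> sp chi i l \<alpha>)" if i: "i \<in> I2 sp" for i
      unfolding linear_certificate_def robust_linear_iff[OF s chi sp i D \<rho>, symmetric]
      by (simp add: mu w_def)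
    show "meets_spec s M eps Cov D \<rho> sp chi \<longleftrightarrow> (\<exists>V \<in> F_solutions s Cov D \<rho> sp. vchi V = chi)"
      unfolding F_extension_iff[OF s sp chi Cov_psd] meets_spec_def by (simp add: q1 q2 q3 ball_Un) blast
  }
  fix c assume "c \<in> F_constraints s Cov D \<rho> sp"
  then show "convex_constraint (fvars_dom s sp) c"
    unfolding F_constraints_def
    by (auto intro: convex_con_quad[OF s sp] convex_con_budget1[OF s sp _ Cov_psd] convex_con_budget3
        convex_con_lambda convex_con_lin[OF s sp _ D] convex_con_budget2[OF s sp _ D \<rho>]
        convex_con_cov[OF s sp _ Cov_psd] convex_con_robust[OF s sp _ D])
qed

end
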